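(* Let $X$ and $Y$ be continuous random variables on a common probability space with copula $C$. Then $\omega_*(X,Y)=\sqrt3\,\|C-\Pi\|_*$ has the following properties: (1) $\omega_*(X,Y)=\omega_*(Y,X)$. (2) $0\le\omega_*(X,Y)\le1$. (3) $\omega_*(X,Y)=0$ if and only if $X$ and $Y$ are independent. (4) $\omega_*(X,Y)=1$ if $Y$ is completely dependent on $X$ or $X$ is completely dependent on $Y$. (5) If $f,g\colon\mathbb{R}\to\mathbb{R}$ are Borel measurable bijective transformations, then $\omega_*(f(X),g(Y))=\omega_*(X,Y)$. (6) If $\{(X_n,Y_n)\}_{n\in\mathbb{N}}$ is a sequence of pairs of continuous random variables with copulas $\{C_n\}_{n\in\mathbb{N}}$ and if $\lim_{n\to\infty}\|C_n-C\|_*=0$, then $\lim_{n\to\infty}\omega_*(X_n,Y_n)=\omega_*(X,Y)$.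
   Context: A copula is a function $C\colon[0,1]^2\to[0,1]$ with $C(u,0)=0=C(0,v)$, $C(u,1)=u$, $C(1,v)=v$ and $C(u,v)-C(u,y)-C(x,v)+C(x,y)\ge 0$ whenever $x\le u$, $y\le v$; $\mathfrak{C}$ is the set of copulas. For continuous random variables $X,Y$ (continuous distribution functions $F,G$) with joint distribution function $H$, the copula of $X$ and $Y$ is the unique copula $C_{X,Y}$ with $H(x,y)=C_{X,Y}(F(x),G(y))$. $Y$ is completely dependent on $X$ if $Y=h(X)$ almost surely for some Borel measurable $h$. $\Pi(x,y)=xy$ and $M(x,y)=\min(x,y)$. On $\operatorname{span}\mathfrak{C}$, the $*$-product is $(A*B)(x,y)=\int_0^1\partial_2A(x,t)\,\partial_1B(t,y)\,dt$ and the Sobolev norm is $\|A\|^2=\int_0^1\int_0^1\big((\partial_1A)^2+(\partial_2A)^2\big)\,dx\,dy$. $\operatorname{Inv}\mathfrak{C}$ is the set of invertible copulas, i.e. copulas $U$ for which there is a copula $D$ with $U*D=M=D*U$; equivalently (known), copulas with $\|U\|=1$. The $*$-norm is $\|A\|_*=\sup_{U,V\in\operatorname{Inv}\mathfrak{C}}\|U*A*V\|$ for $A\in\operatorname{span}\mathfrak{C}$. For any pair of continuous random variables, $\omega_*(X,Y)=\sqrt3\,\|C_{X,Y}-\Pi\|_*$. *)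

theory Defs
  imports "HOL-Probability.Probability"
begin

abbreviation unit_square :: "(real \<times> real) set" where
  "unit_square \<equiv> {0..1} \<times> {0..1}"

text \<open>Functions on the closed unit square are extensional (\<open>undefined\<close> elsewhere), so that
  equality of copulas is equality of functions and the copula of two random variables is
  unique.\<close>

definition copulas :: "(real \<times> real \<Rightarrow> real) set" where
  "copulas = {C \<in> unit_square \<rightarrow>\<^sub>E {0..1}.
     (\<forall>u\<in>{0..1}. C (u, 0) = 0 \<and> C (u, 1) = u) \<and>
     (\<forall>v\<in>{0..1}. C (0, v) = 0 \<and> C (1, v) = v) \<and>
     (\<forall>x\<in>{0..1}. \<forall>u\<in>{0..1}. \<forall>y\<in>{0..1}. \<forall>v\<in>{0..1}. x \<le> u \<longrightarrow> y \<le> v \<longrightarrow>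
        C (u, v) - C (u, y) - C (x, v) + C (x, y) \<ge> 0)}"

definition prod_copula :: "real \<times> real \<Rightarrow> real" where
  "prod_copula = (\<lambda>(x, y)\<in>unit_square. x * y)"

definition min_copula :: "real \<times> real \<Rightarrow> real" where
  "min_copula = (\<lambda>(x, y)\<in>unit_square. min x y)"

text \<open>For functions in the span of the copulas the partial derivatives exist almost everywhere;
  where they do not exist, \<^const>\<open>deriv\<close> is a fixed unspecified constant.\<close>

definition pd1 :: "(real \<times> real \<Rightarrow> real) \<Rightarrow> real \<times> real \<Rightarrow> real" where
  "pd1 A = (\<lambda>(x, y). deriv (\<lambda>s. A (s, y)) x)"

definition pd2 :: "(real \<times> real \<Rightarrow> real) \<Rightarrow> real \<times> real \<Rightarrow> real" where
  "pd2 A = (\<lambda>(x, y). deriv (\<lambda>t. A (x, t)) y)"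

text \<open>The integrals \<open>LBINT t=0..1\<close> are taken over the open interval, and there the derivatives
  depend only on the values on the closed unit square. Hence the following three operations,
  which are meant for the span of the copulas, ignore the values of their arguments elsewhere.\<close>

definition star_prod ::
  "(real \<times> real \<Rightarrow> real) \<Rightarrow> (real \<times> real \<Rightarrow> real) \<Rightarrow> real \<times> real \<Rightarrow> real" where
  "star_prod A B = (\<lambda>(x, y)\<in>unit_square. LBINT t=0..1. pd2 A (x, t) * pd1 B (t, y))"

definition sobolev_norm :: "(real \<times> real \<Rightarrow> real) \<Rightarrow> real" where
  "sobolev_norm A =
     sqrt (LBINT y=0..1. (LBINT x=0..1. (pd1 A (x, y))\<^sup>2 + (pd2 A (x, y))\<^sup>2))"

definition inv_copulas :: "(real \<times> real \<Rightarrow> real) set" where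
  "inv_copulas = {U \<in> copulas. \<exists>D\<in>copulas.
     star_prod U D = min_copula \<and> star_prod D U = min_copula}"

text \<open>On the span of the copulas the supremum is over a nonempty bounded set of reals.\<close>

definition star_norm :: "(real \<times> real \<Rightarrow> real) \<Rightarrow> real" where
  "star_norm A = (SUP (U, V) \<in> inv_copulas \<times> inv_copulas.
     sobolev_norm (star_prod (star_prod U A) V))"

definition continuous_rv :: "'a measure \<Rightarrow> ('a \<Rightarrow> real) \<Rightarrow> bool" where
  "continuous_rv M X \<longleftrightarrow>
     X \<in> borel_measurable M \<and> continuous_on UNIV (cdf (distr M borel X))"

definition joint_cdf ::
  "'a measure \<Rightarrow> ('a \<Rightarrow> real) \<Rightarrow> ('a \<Rightarrow> real) \<Rightarrow> real \<Rightarrow> real \<Rightarrow> real" where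
  "joint_cdf M X Y x y = measure M {\<omega> \<in> space M. X \<omega> \<le> x \<and> Y \<omega> \<le> y}"

definition copula_of ::
  "'a measure \<Rightarrow> ('a \<Rightarrow> real) \<Rightarrow> ('a \<Rightarrow> real) \<Rightarrow> real \<times> real \<Rightarrow> real" where
  "copula_of M X Y = (THE C. C \<in> copulas \<and>
     (\<forall>x y. joint_cdf M X Y x y = C (cdf (distr M borel X) x, cdf (distr M borel Y) y)))"

definition completely_dependent ::
  "'a measure \<Rightarrow> ('a \<Rightarrow> real) \<Rightarrow> ('a \<Rightarrow> real) \<Rightarrow> bool" where
  \<comment> \<open>\<open>Y\<close> is completely dependent on \<open>X\<close>\<close>
  "completely_dependent M Y X \<longleftrightarrow>
     (\<exists>h \<in> borel_measurable borel. AE \<omega> in M. Y \<omega> = h (X \<omega>))"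

definition omega_star :: "'a measure \<Rightarrow> ('a \<Rightarrow> real) \<Rightarrow> ('a \<Rightarrow> real) \<Rightarrow> real" where
  "omega_star M X Y = sqrt 3 * star_norm (\<lambda>p. copula_of M X Y p - prod_copula p)"

end

theory Submission
  imports Defs
begin

text \<open>
  The joint distribution of two continuous random variables is encoded by the copula of their ranks, and
  the partial derivatives of a copula are conditional distribution functions of one rank given the other.
  Everything below follows from four facts about them.

  The star product of copulas is associative (\<open>star_prod_assoc\<close>). A copula \<open>B\<close> acts on bounded measurable
  functions as a Markov operator, star products are values of such operators, and the operators of \<open>B\<close> and
  of its transpose are adjoint (\<open>markov_duality\<close>). The measure on the square that belongs to \<open>B\<close> is never
  constructed: adjointness is checked on initial intervals, where it is the fundamental theorem of calculus,
  and extended by \<open>L\<^sup>1\<close> bounds. Consequently the invertible copulas form a group under the star product, and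
  the supremum that defines the star norm is invariant under multiplication by them.

  The calculus rests on almost everywhere differentiability of Lipschitz functions, which is derived from
  the Vitali covering theorem (\<open>lipschitz_AE_differentiable\<close>, \<open>lipschitz_unit_interval\<close>).

  The squared Sobolev distance of a copula from the product copula is at most \<open>1 / 3\<close>, vanishes only
  for the product copula, and is close to \<open>1 / 3\<close> if the copula is close to its maximum on the diagonal
  (\<open>sobolev_dist_prod_upper\<close>, \<open>sobolev_dist_prod_eq_0\<close>, \<open>sobolev_dist_prod_lower\<close>). The product copula
  absorbs all factors, so the upper bound carries over to the star norm. This gives the range of the
  dependence measure and its value 0.

  If \<open>Y\<close> determines \<open>Z\<close>, the star product of the copulas of \<open>(X, Y)\<close> and \<open>(Y, Z)\<close> is the copula of
  \<open>(X, Z)\<close> (\<open>star_prod_rank_copula\<close>). So passing from \<open>X\<close> to a variable that determines \<open>X\<close> and is determined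
  by it multiplies the copula by an invertible copula and leaves the star norm unchanged; injective Borel
  images are of this kind (\<open>injective_image_determines\<close>). If \<open>Y\<close> is a function of \<open>X\<close>, a suitable injective
  image of \<open>X\<close> has almost the same rank as \<open>Y\<close>, so its copula with \<open>Y\<close> has almost maximal Sobolev norm; this
  yields the value 1 for complete dependence (\<open>star_dist_completely_dependent\<close>).

  Symmetry is transposition, and continuity is the triangle inequality for the star norm.
\<close>

section \<open>Differentiability of Lipschitz functions\<close>

text \<open>A bounded function without a limit at 0 has different lower and upper limits there; any two
  rationals strictly between them are crossed arbitrarily close to 0.\<close>

lemma at_zero_not_convergent_oscillates:
  fixes Q :: "real \<Rightarrow> real"
  assumes bnd: "\<And>h. h \<noteq> 0 \<Longrightarrow> \<bar>Q h\<bar> \<le> K"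
    and nc: "\<nexists>l. (Q \<longlongrightarrow> l) (at 0)"
  obtains p q where "p \<in> \<rat>" "q \<in> \<rat>" "p < q"
    "\<And>d. d > 0 \<Longrightarrow> \<exists>h. h \<noteq> 0 \<and> \<bar>h\<bar> < d \<and> Q h < p"
    "\<And>d. d > 0 \<Longrightarrow> \<exists>h. h \<noteq> 0 \<and> \<bar>h\<bar> < d \<and> q < Q h"
proof -
  let ?i = "Liminf (at 0) (\<lambda>h. ereal (Q h))" and ?s = "Limsup (at 0) (\<lambda>h. ereal (Q h))"
  have ev: "\<forall>\<^sub>F h in at 0. \<bar>Q h\<bar> \<le> K"
    unfolding eventually_at by (rule exI[of _ 1]) (auto intro: bnd)
  have "?i \<le> ?s" by (rule Liminf_le_Limsup) simp
  moreover have "?i \<noteq> ?s"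
  proof
    assume eq: "?i = ?s"
    have "ereal (-K) \<le> ?i"
      by (rule Liminf_bounded) (use ev in \<open>auto elim: eventually_mono\<close>)
    moreover have "?s \<le> ereal K"
      by (rule Limsup_bounded) (use ev in \<open>auto elim: eventually_mono\<close>)
    ultimately obtain l where l: "?i = ereal l"
      using eq by (cases ?i; cases ?s) auto
    have "((\<lambda>h. ereal (Q h)) \<longlongrightarrow> ereal l) (at 0)"
      using l eq by (intro Liminf_eq_Limsup) auto
    then show False using nc by (auto simp: lim_ereal)
  qed
  ultimately have "?i < ?s" by simp
  then obtain p' where p': "?i < p'" "p' < ?s" using dense by blast
  have "\<exists>p. ?i < ereal (of_rat p) \<and> ereal (of_rat p) < p'"
    using ereal_dense3[OF p'(1)] by auto
  then obtain p where p: "?i < ereal (of_rat p)" "ereal (of_rat p) < p'" by blast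
  obtain q where q: "p' < ereal (of_rat q)" "ereal (of_rat q) < ?s"
    using ereal_dense3[OF p'(2)] by auto
  show thesis
  proof (rule that[of "of_rat p" "of_rat q"])
    have "ereal (of_rat p) < ereal (of_rat q)" using p q by (meson less_trans)
    then show "(of_rat p :: real) < of_rat q" by simp
    fix d :: real assume d: "d > 0"
    show "\<exists>h. h \<noteq> 0 \<and> \<bar>h\<bar> < d \<and> Q h < of_rat p"
    proof (rule ccontr)
      assume "\<not> ?thesis"
      then have "\<forall>\<^sub>F h in at 0. ereal (of_rat p) \<le> ereal (Q h)"
        unfolding eventually_at using d by (intro exI[of _ d]) (auto simp: not_less)
      then have "ereal (of_rat p) \<le> ?i" by (rule Liminf_bounded)
      with p(1) show False by simp
    qed
    show "\<exists>h. h \<noteq> 0 \<and> \<bar>h\<bar> < d \<and> of_rat q < Q h"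
    proof (rule ccontr)
      assume "\<not> ?thesis"
      then have "\<forall>\<^sub>F h in at 0. ereal (Q h) \<le> ereal (of_rat q)"
        unfolding eventually_at using d by (intro exI[of _ d]) (auto simp: not_less)
      then have "?s \<le> ereal (of_rat q)" by (rule Limsup_bounded)
      with q(2) show False by simp
    qed
  qed auto
qed

text \<open>The points \<open>z\<close> at which the difference quotients in the first variable drop below
  \<open>p\<close> and exceed \<open>q\<close> at arbitrarily small increments. The definition only takes unions
  over all \<open>h\<close> and a countable intersection over \<open>m\<close>, which makes the set a
  \<open>G\<^sub>\<delta>\<close> for continuous \<open>g\<close> without passing to rational
  increments.\<close>

definition osc1 :: "(real \<times> real \<Rightarrow> real) \<Rightarrow> real \<Rightarrow> real \<Rightarrow> (real \<times> real) set" where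
  "osc1 g p q = (\<Inter>m::nat.
     {z. \<exists>h. h \<noteq> 0 \<and> \<bar>h\<bar> < 1 / Suc m \<and> (g (fst z + h, snd z) - g z) / h < p} \<inter>
     {z. \<exists>h. h \<noteq> 0 \<and> \<bar>h\<bar> < 1 / Suc m \<and> q < (g (fst z + h, snd z) - g z) / h})"

lemma osc1_borel:
  assumes g: "continuous_on UNIV g"
  shows "osc1 g p q \<in> sets borel"
proof -
  have c: "continuous_on UNIV (\<lambda>z. (g (fst z + h, snd z) - g z) / h)" if "h \<noteq> 0" for h
    using that by (intro continuous_intros continuous_on_compose2[OF g]) auto
  have "open (\<Union>h\<in>{h. h \<noteq> 0 \<and> \<bar>h\<bar> < 1 / Suc m}. {z. (g (fst z + h, snd z) - g z) / h < p})"
    "open (\<Union>h\<in>{h. h \<noteq> 0 \<and> \<bar>h\<bar> < 1 / Suc m}. {z. q < (g (fst z + h, snd z) - g z) / h})" for m :: nat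
    by (intro open_UN ballI open_Collect_less c continuous_intros; simp)+
  moreover have "(\<Union>h\<in>{h. h \<noteq> 0 \<and> \<bar>h\<bar> < d}. {z. P h z}) = {z. \<exists>h. h \<noteq> 0 \<and> \<bar>h\<bar> < d \<and> P h z}"
    for d :: real and P :: "real \<Rightarrow> real \<times> real \<Rightarrow> bool" by auto
  ultimately show ?thesis
    unfolding osc1_def by (intro sets.countable_INT'' sets.Int borel_open) auto
qed

lemma osc1_iff:
  "z \<in> osc1 g p q \<longleftrightarrow>
    (\<forall>d>0. \<exists>h. h \<noteq> 0 \<and> \<bar>h\<bar> < d \<and> (g (fst z + h, snd z) - g z) / h < p) \<and>
    (\<forall>d>0. \<exists>h. h \<noteq> 0 \<and> \<bar>h\<bar> < d \<and> q < (g (fst z + h, snd z) - g z) / h)"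
  (is "_ \<longleftrightarrow> (\<forall>d>0. \<exists>h. ?A d h) \<and> (\<forall>d>0. \<exists>h. ?B d h)")
proof
  assume z: "z \<in> osc1 g p q"
  have "(\<exists>h. ?A d h) \<and> (\<exists>h. ?B d h)" if "d > 0" for d :: real
  proof -
    obtain m :: nat where m: "1 / Suc m < d" using \<open>d > 0\<close> nat_approx_posE by blast
    from z have "(\<exists>h. ?A (1 / Suc m) h) \<and> (\<exists>h. ?B (1 / Suc m) h)"
      unfolding osc1_def by auto
    then show ?thesis using m by (meson less_trans)
  qed
  then show "(\<forall>d>0. \<exists>h. ?A d h) \<and> (\<forall>d>0. \<exists>h. ?B d h)" by blast
next
  assume "(\<forall>d>0. \<exists>h. ?A d h) \<and> (\<forall>d>0. \<exists>h. ?B d h)"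
  then show "z \<in> osc1 g p q" unfolding osc1_def by auto
qed

definition nondiff1 :: "(real \<times> real \<Rightarrow> real) \<Rightarrow> (real \<times> real) set" where
  "nondiff1 g = {z. \<not> (\<lambda>s. g (s, snd z)) differentiable at (fst z)}"

text \<open>For a Lipschitz function the quotients are bounded, so the only obstruction to differentiability is
  oscillation across some pair of rationals.\<close>

lemma nondiff1_eq:
  assumes lip: "\<And>x x' y. \<bar>g (x, y) - g (x', y)\<bar> \<le> K * \<bar>x - x'\<bar>"
  shows "nondiff1 g = (\<Union>p\<in>\<rat>. \<Union>q\<in>{q\<in>\<rat>. p < q}. osc1 g p q)"
proof (intro set_eqI iffI)
  fix z assume z: "z \<in> nondiff1 g"
  obtain x y where xy: "z = (x, y)" by (cases z)
  let ?Q = "\<lambda>h. (g (x + h, y) - g (x, y)) / h"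
  have b: "\<bar>?Q h\<bar> \<le> K" if "h \<noteq> 0" for h
    using lip[of "x + h" y x] that by (simp add: divide_simps)
  have nc: "\<nexists>l. (?Q \<longlongrightarrow> l) (at 0)"
    using z unfolding nondiff1_def xy real_differentiable_def DERIV_def by auto
  obtain p q where "p \<in> \<rat>" "q \<in> \<rat>" "p < q"
    "\<And>d. d > 0 \<Longrightarrow> \<exists>h. h \<noteq> 0 \<and> \<bar>h\<bar> < d \<and> ?Q h < p"
    "\<And>d. d > 0 \<Longrightarrow> \<exists>h. h \<noteq> 0 \<and> \<bar>h\<bar> < d \<and> q < ?Q h"
    using at_zero_not_convergent_oscillates[OF b nc] by blast
  then show "z \<in> (\<Union>p\<in>\<rat>. \<Union>q\<in>{q\<in>\<rat>. p < q}. osc1 g p q)"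
    by (auto simp: osc1_iff xy)
next
  fix z assume "z \<in> (\<Union>p\<in>\<rat>. \<Union>q\<in>{q\<in>\<rat>. p < q}. osc1 g p q)"
  then obtain p q where pq: "p < q" and z: "z \<in> osc1 g p q" by blast
  obtain x y where xy: "z = (x, y)" by (cases z)
  let ?Q = "\<lambda>h. (g (x + h, y) - g (x, y)) / h"
  show "z \<in> nondiff1 g"
  proof (rule ccontr)
    assume "z \<notin> nondiff1 g"
    then obtain l where l: "(?Q \<longlongrightarrow> l) (at 0)"
      unfolding nondiff1_def xy real_differentiable_def DERIV_def by auto
    from pq have "p < l \<or> l < q" by linarith
    then show False
    proof
      assume "p < l"
      with l have "\<forall>\<^sub>F h in at 0. p < ?Q h" by (rule order_tendstoD)
      then show False using z unfolding osc1_iff xy eventually_at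
        by (fastforce simp: dist_real_def)
    next
      assume "l < q"
      with l have "\<forall>\<^sub>F h in at 0. ?Q h < q" by (rule order_tendstoD)
      then show False using z unfolding osc1_iff xy eventually_at
        by (fastforce simp: dist_real_def)
    qed
  qed
qed

lemma nondiff1_borel:
  assumes "continuous_on UNIV g"
    and lip: "\<And>x x' y. \<bar>g (x, y) - g (x', y)\<bar> \<le> K * \<bar>x - x'\<bar>"
  shows "nondiff1 g \<in> sets borel"
  unfolding nondiff1_eq[OF lip]
  by (intro sets.countable_UN' countable_rat countable_Collect osc1_borel assms)
     (auto intro: countable_subset[OF _ countable_rat] osc1_borel assms)

lemma difference_quotients_converge:
  fixes F :: "real \<Rightarrow> real"
  assumes "DERIV F t :> D"
  shows "(\<lambda>n. (F (t + 1 / real (Suc n)) - F t) / (1 / real (Suc n))) \<longlonglongrightarrow> D"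
proof -
  have "filterlim (\<lambda>n. 1 / real (Suc n)) (at 0) sequentially"
    unfolding filterlim_at using LIMSEQ_inverse_real_of_nat by (auto simp: inverse_eq_divide)
  then show ?thesis using assms unfolding DERIV_def by (rule filterlim_compose[rotated])
qed

text \<open>On the complement of the Borel set \<^term>\<open>nondiff1 g\<close> the derivative is a limit of
  difference quotients, and on that set it is a constant, because \<^const>\<open>deriv\<close> then chooses
  from the empty set.\<close>

lemma pd1_borel:
  assumes g: "continuous_on UNIV g"
    and lip: "\<And>x x' y. \<bar>g (x, y) - g (x', y)\<bar> \<le> K * \<bar>x - x'\<bar>"
  shows "pd1 g \<in> borel_measurable borel"
proof -
  let ?q = "\<lambda>n z. (g (fst z + 1 / Suc n, snd z) - g z) / (1 / Suc n)"
  have m: "?q n \<in> borel_measurable borel" for n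
    by (intro borel_measurable_continuous_onI continuous_intros continuous_on_compose2[OF g]) auto
  define c :: real where "c = (SOME D. False)"
  have "pd1 g = (\<lambda>z. if z \<in> nondiff1 g then c else lim (\<lambda>n. ?q n z))"
  proof
    fix z :: "real \<times> real"
    obtain x y where xy: "z = (x, y)" by (cases z)
    show "pd1 g z = (if z \<in> nondiff1 g then c else lim (\<lambda>n. ?q n z))"
    proof (cases "z \<in> nondiff1 g")
      case True
      then have "\<not> (DERIV (\<lambda>s. g (s, y)) x :> D)" for D
        unfolding nondiff1_def xy real_differentiable_def by auto
      then show ?thesis using True unfolding pd1_def xy deriv_def c_def by simp
    next
      case False
      then have "(\<lambda>s. g (s, y)) differentiable at x" by (simp add: nondiff1_def xy)
      then have D: "DERIV (\<lambda>s. g (s, y)) x :> pd1 g z"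
        using DERIV_deriv_iff_real_differentiable by (auto simp: pd1_def xy)
      then have "(\<lambda>n. ?q n z) \<longlonglongrightarrow> pd1 g z"
        unfolding xy fst_conv snd_conv by (rule difference_quotients_converge)
      then show ?thesis using False by (simp add: limI)
    qed
  qed
  moreover have "(\<lambda>z. if z \<in> nondiff1 g then c else lim (\<lambda>n. ?q n z)) \<in> borel_measurable borel"
    using nondiff1_borel[OF assms] m by (intro measurable_If_set borel_measurable_lim_metric) auto
  ultimately show ?thesis by simp
qed


text \<open>The Vitali covering theorem for closed intervals that have the covered point as an endpoint and
  satisfy a given relation between their endpoints.\<close>

lemma Vitali_intervals:
  fixes E Q :: "real set"
  assumes "open Q" "E \<subseteq> Q"
    and fine: "\<And>x d. x \<in> E \<Longrightarrow> d > 0 \<Longrightarrow> \<exists>h. h \<noteq> 0 \<and> \<bar>h\<bar> < d \<and> R (min x (x + h)) (max x (x + h))"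
  obtains C where "countable C" "disjoint_family_on (\<lambda>(a, b). {a..b}) C"
    "\<And>a b. (a, b) \<in> C \<Longrightarrow> a < b \<and> {a..b} \<subseteq> Q \<and> R a b"
    "negligible (E - (\<Union>(a, b)\<in>C. {a..b}))"
proof -
  define K where "K = {(a, b). a < b \<and> {a..b} \<subseteq> Q \<and> R a b}"
  define c r :: "real \<times> real \<Rightarrow> real" where "c = (\<lambda>(a, b). (a + b) / 2)" and "r = (\<lambda>(a, b). (b - a) / 2)"
  have ball: "cball (c i) (r i) = (case i of (a, b) \<Rightarrow> {a..b})" for i
    by (auto simp: c_def r_def cball_eq_atLeastAtMost field_simps split: prod.splits)
  have r_pos: "0 < r i" if "i \<in> K" for i using that by (auto simp: K_def r_def)
  have cover: "\<exists>i. i \<in> K \<and> x \<in> cball (c i) (r i) \<and> r i < d" if x: "x \<in> E" and d: "d > 0" for x d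
  proof -
    obtain e where e: "e > 0" "ball x e \<subseteq> Q"
      using assms x by (meson open_contains_ball subsetD)
    obtain h where h: "h \<noteq> 0" "\<bar>h\<bar> < min d e" "R (min x (x + h)) (max x (x + h))"
      using fine[OF x, of "min d e"] d e by auto
    have "{min x (x + h)..max x (x + h)} \<subseteq> ball x e"
      using h by (auto simp: dist_real_def)
    then have "(min x (x + h), max x (x + h)) \<in> K"
      using h e by (auto simp: K_def)
    moreover have "x \<in> {min x (x + h)..max x (x + h)}" by auto
    moreover have "r (min x (x + h), max x (x + h)) < d"
      using h d by (auto simp: r_def min_def max_def split: if_splits)
    ultimately show ?thesis unfolding ball by (intro exI[of _ "(min x (x + h), max x (x + h))"]) auto
  qed
  obtain C where C: "countable C" "C \<subseteq> K"
     "pairwise (\<lambda>i j. disjnt (cball (c i) (r i)) (cball (c j) (r j))) C"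
     "negligible (E - (\<Union>i \<in> C. cball (c i) (r i)))"
    by (rule Vitali_covering_theorem_cballs[of K r E c, OF r_pos cover]) (assumption | rule that)+
  show thesis
  proof (rule that[OF C(1)])
    show "disjoint_family_on (\<lambda>(a, b). {a..b}) C"
      using C(3) unfolding ball disjoint_family_on_def pairwise_def disjnt_def by blast
    show "negligible (E - (\<Union>(a, b)\<in>C. {a..b}))" using C(4) unfolding ball .
  qed (use C(2) in \<open>auto simp: K_def\<close>)
qed

text \<open>Both covers come from Vitali's theorem. Intervals on which \<open>F\<close> has slope less than
  \<open>p\<close> cover almost all of \<open>E\<close>; inside their union, intervals with slope greater than
  \<open>q\<close> again cover almost all of \<open>E\<close>. Since the increments of \<open>F\<close> are
  additive on disjoint intervals, \<open>q\<close> times the measure of \<open>E\<close> is at most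
  \<open>p\<close> times that of any open set around \<open>E\<close>, which forces the measure to be 0. The
  additivity is expressed by the interval measure of \<open>F\<close>.\<close>

lemma oscillation_null:
  fixes F :: "real \<Rightarrow> real" and E :: "real set"
  assumes mono: "mono F" and cont: "continuous_on UNIV F"
    and E: "E \<in> sets borel" "E \<subseteq> {0..1}" and pq: "0 < p" "p < q"
    and lo: "\<And>x d. x \<in> E \<Longrightarrow> d > 0 \<Longrightarrow> \<exists>h. h \<noteq> 0 \<and> \<bar>h\<bar> < d \<and> (F (x + h) - F x) / h < p"
    and hi: "\<And>x d. x \<in> E \<Longrightarrow> d > 0 \<Longrightarrow> \<exists>h. h \<noteq> 0 \<and> \<bar>h\<bar> < d \<and> q < (F (x + h) - F x) / h"
  shows "E \<in> null_sets lborel"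
proof -
  let ?\<mu> = "interval_measure F" and ?I = "\<lambda>(a, b). {a..b::real}"
  have \<mu>: "emeasure ?\<mu> {a..b} = ennreal (F b - F a)" if "a \<le> b" for a b
    using that mono cont by (intro emeasure_interval_measure_Icc) (auto dest: monoD)
  have I_sets: "(\<And>i. i \<in> C \<Longrightarrow> ?I i \<in> sets lborel)" "(\<And>i. i \<in> C \<Longrightarrow> ?I i \<in> sets ?\<mu>)" for C
    by auto
  have null: "E' - (\<Union>i\<in>C. ?I i) \<in> null_sets lborel"
    if "negligible (E' - (\<Union>i\<in>C. ?I i))" "countable C" "E' \<in> sets borel" for C E'
  proof -
    have "E' - (\<Union>i\<in>C. ?I i) \<in> sets lborel" using that by (intro sets.Diff sets.countable_UN') auto
    then show ?thesis using that by (simp add: negligible_iff_null_sets null_sets_completion_iff)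
  qed
  have key: "ennreal q * emeasure lborel E \<le> ennreal p * (emeasure lborel E + ennreal e)"
    if e: "e > 0" for e
  proof -
    obtain Q where Q: "open Q" "E \<subseteq> Q" "emeasure lborel (Q - E) < ennreal e"
      using outer_regular_lborel[OF E(1) e] by blast
    have slope_lo: "\<exists>h. h \<noteq> 0 \<and> \<bar>h\<bar> < d \<and>
        F (max x (x + h)) - F (min x (x + h)) < p * (max x (x + h) - min x (x + h))"
      if x: "x \<in> E" "d > 0" for x d
    proof -
      from lo[OF x] obtain h where "h \<noteq> 0" "\<bar>h\<bar> < d" "(F (x + h) - F x) / h < p" by blast
      then show ?thesis
      proof (intro exI[of _ h] conjI)
        show "F (max x (x + h)) - F (min x (x + h)) < p * (max x (x + h) - min x (x + h))"
          using \<open>h \<noteq> 0\<close> \<open>(F (x + h) - F x) / h < p\<close>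
          by (cases "h > 0") (simp_all add: pos_divide_less_eq neg_divide_less_eq min_def max_def)
      qed
    qed
    obtain C where C: "countable C" "disjoint_family_on ?I C"
      "\<And>a b. (a, b) \<in> C \<Longrightarrow> a < b \<and> {a..b} \<subseteq> Q \<and> F b - F a < p * (b - a)"
      "negligible (E - (\<Union>i\<in>C. ?I i))"
      by (rule Vitali_intervals[of Q E "\<lambda>a b. F b - F a < p * (b - a)", OF Q(1,2) slope_lo]) (assumption | rule that)+
    define V where "V = (\<Union>(a, b)\<in>C. {a<..<b})"
    have "open V" unfolding V_def by (auto intro!: open_UN)
    have "V \<subseteq> (\<Union>i\<in>C. ?I i)" unfolding V_def by fastforce
    have slope_hi: "\<exists>h. h \<noteq> 0 \<and> \<bar>h\<bar> < d \<and>
        q * (max x (x + h) - min x (x + h)) < F (max x (x + h)) - F (min x (x + h))"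
      if x: "x \<in> E \<inter> V" "d > 0" for x d
    proof -
      from hi[of x d] x obtain h where "h \<noteq> 0" "\<bar>h\<bar> < d" "q < (F (x + h) - F x) / h" by blast
      then show ?thesis
      proof (intro exI[of _ h] conjI)
        show "q * (max x (x + h) - min x (x + h)) < F (max x (x + h)) - F (min x (x + h))"
          using \<open>h \<noteq> 0\<close> \<open>q < (F (x + h) - F x) / h\<close>
          by (cases "h > 0") (simp_all add: pos_less_divide_eq neg_less_divide_eq min_def max_def)
      qed
    qed
    obtain D where D: "countable D" "disjoint_family_on ?I D"
      "\<And>a b. (a, b) \<in> D \<Longrightarrow> a < b \<and> {a..b} \<subseteq> V \<and> q * (b - a) < F b - F a"
      "negligible (E \<inter> V - (\<Union>i\<in>D. ?I i))"
      by (rule Vitali_intervals[of V "E \<inter> V" "\<lambda>a b. q * (b - a) < F b - F a", OF \<open>open V\<close> Int_lower2 slope_hi]) (assumption | rule that)+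
    have N1: "E - (\<Union>i\<in>C. ?I i) \<in> null_sets lborel" by (rule null) (use C E in auto)
    have N2: "E \<inter> V - (\<Union>i\<in>D. ?I i) \<in> null_sets lborel"
      by (rule null) (use D E \<open>open V\<close> in auto)
    \<comment> \<open>The endpoints are lost when the first cover is replaced by its open interior \<open>V\<close>.\<close>
    have N3: "(\<Union>(a, b)\<in>C. {a, b}) \<in> null_sets lborel"
      using C(1) by (intro countable_imp_null_set_lborel) auto
    have "E \<subseteq> (\<Union>i\<in>D. ?I i) \<union> ((E - (\<Union>i\<in>C. ?I i)) \<union> (E \<inter> V - (\<Union>i\<in>D. ?I i)) \<union> (\<Union>(a, b)\<in>C. {a, b}))"
      unfolding V_def by fastforce
    then have "emeasure lborel E \<le> emeasure lborel ((\<Union>i\<in>D. ?I i) \<union>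
        ((E - (\<Union>i\<in>C. ?I i)) \<union> (E \<inter> V - (\<Union>i\<in>D. ?I i)) \<union> (\<Union>(a, b)\<in>C. {a, b})))"
      using D C N1 N2 N3 by (intro emeasure_mono) (auto intro!: sets.countable_UN' sets.Un)
    also have "\<dots> = emeasure lborel (\<Union>i\<in>D. ?I i)"
      using D by (intro emeasure_Un_null_set null_sets.Un N1 N2 N3) (auto intro!: sets.countable_UN')
    also have "\<dots> = (\<integral>\<^sup>+i. emeasure lborel (?I i) \<partial>count_space D)"
      by (rule emeasure_UN_countable) (use D I_sets in auto)
    finally have "ennreal q * emeasure lborel E \<le> ennreal q * (\<integral>\<^sup>+i. emeasure lborel (?I i) \<partial>count_space D)"
      by (rule mult_left_mono) simp
    also have "\<dots> = (\<integral>\<^sup>+i. ennreal q * emeasure lborel (?I i) \<partial>count_space D)"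
      by (simp add: nn_integral_cmult)
    also have "\<dots> \<le> (\<integral>\<^sup>+i. emeasure ?\<mu> (?I i) \<partial>count_space D)"
    proof (rule nn_integral_mono)
      fix i assume "i \<in> space (count_space D)"
      then obtain a b where i: "i = (a, b)" "(a, b) \<in> D" by (cases i) auto
      with D(3)[OF i(2)] pq show "ennreal q * emeasure lborel (?I i) \<le> emeasure ?\<mu> (?I i)"
        by (simp add: \<mu> ennreal_mult[symmetric] ennreal_leI del: emeasure_interval_measure_Icc)
    qed
    also have "\<dots> = emeasure ?\<mu> (\<Union>i\<in>D. ?I i)"
      by (rule emeasure_UN_countable[symmetric]) (use D I_sets in auto)
    also have "\<dots> \<le> emeasure ?\<mu> (\<Union>i\<in>C. ?I i)"
    proof (rule emeasure_mono)
      show "(\<Union>i\<in>D. ?I i) \<subseteq> (\<Union>i\<in>C. ?I i)"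
        using D(3) \<open>V \<subseteq> (\<Union>i\<in>C. ?I i)\<close> by blast
    qed (use C in \<open>auto intro!: sets.countable_UN'\<close>)
    also have "\<dots> = (\<integral>\<^sup>+i. emeasure ?\<mu> (?I i) \<partial>count_space C)"
      by (rule emeasure_UN_countable) (use C I_sets in auto)
    also have "\<dots> \<le> (\<integral>\<^sup>+i. ennreal p * emeasure lborel (?I i) \<partial>count_space C)"
    proof (rule nn_integral_mono)
      fix i assume "i \<in> space (count_space C)"
      then obtain a b where i: "i = (a, b)" "(a, b) \<in> C" by (cases i) auto
      with C(3)[OF i(2)] pq show "emeasure ?\<mu> (?I i) \<le> ennreal p * emeasure lborel (?I i)"
        by (simp add: \<mu> ennreal_mult[symmetric] ennreal_leI del: emeasure_interval_measure_Icc)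
    qed
    also have "\<dots> = ennreal p * emeasure lborel (\<Union>i\<in>C. ?I i)"
      by (subst emeasure_UN_countable) (use C I_sets in \<open>auto simp: nn_integral_cmult\<close>)
    also have "\<dots> \<le> ennreal p * emeasure lborel Q"
      using C Q by (intro mult_left_mono emeasure_mono) auto
    also have "emeasure lborel Q = emeasure lborel E + emeasure lborel (Q - E)"
      using Q E by (subst plus_emeasure) (auto simp: Un_absorb1)
    also have "ennreal p * \<dots> \<le> ennreal p * (emeasure lborel E + ennreal e)"
      using Q by (intro mult_left_mono add_left_mono) auto
    finally show ?thesis .
  qed
  have fin: "emeasure lborel E < \<infinity>"
    using emeasure_mono[OF E(2), of lborel] by (auto simp: top.not_eq_extremum le_less_trans)
  define m where "m = measure lborel E"
  have m: "emeasure lborel E = ennreal m" "0 \<le> m"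
    using fin by (auto simp: m_def emeasure_eq_ennreal_measure)
  have "q * m \<le> p * m + e" if "e > 0" for e
  proof -
    have "ennreal (q * m) \<le> ennreal (p * (m + e / p))"
      using key[of "e / p"] that pq m
      by (simp add: ennreal_mult[symmetric] ennreal_plus[symmetric] del: ennreal_plus)
    moreover have "p * (m + e / p) = p * m + e" using pq by (simp add: distrib_left)
    ultimately show ?thesis using pq m that
      by (simp add: ennreal_plus[symmetric] del: ennreal_plus)
  qed
  then have "q * m \<le> p * m" by (rule field_le_epsilon)
  then have "(q - p) * m \<le> 0" by (simp add: left_diff_distrib)
  then have "m = 0" using pq m by (auto simp: mult_le_0_iff)
  then show ?thesis using m E by auto
qed


text \<open>Adding a multiple of the identity makes the function increasing and shifts all slopes by the same
  amount, so the oscillation sets are null by the monotone case.\<close>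

lemma lipschitz_AE_differentiable:
  fixes F :: "real \<Rightarrow> real"
  assumes lip: "\<And>x x'. \<bar>F x - F x'\<bar> \<le> K * \<bar>x - x'\<bar>"
  shows "AE x in lborel. x \<in> {0..1} \<longrightarrow> F differentiable at x"
proof -
  have K: "K \<ge> 0" using lip[of 0 1] by simp
  have cont: "continuous_on UNIV F"
    by (rule lipschitz_on_continuous_on[of K]) (use lip K in \<open>auto simp: lipschitz_on_def dist_real_def\<close>)
  define g :: "real \<times> real \<Rightarrow> real" where "g = (\<lambda>z. F (fst z))"
  have contg: "continuous_on UNIV g"
    unfolding g_def by (intro continuous_on_compose2[OF cont] continuous_intros) auto
  have lipg: "\<bar>g (x, y) - g (x', y)\<bar> \<le> K * \<bar>x - x'\<bar>" for x x' y
    using lip by (simp add: g_def)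
  define N where "N p q = {x \<in> {0..1}. (x, 0) \<in> osc1 g p q}" for p q
  define G where "G x = F x + (K + 1) * x" for x
  have contG: "continuous_on UNIV G" unfolding G_def by (intro continuous_intros cont)
  have monoG: "mono G"
  proof
    fix x y :: real assume "x \<le> y"
    then show "G x \<le> G y" using lip[of x y] by (simp add: G_def algebra_simps)
  qed
  have slope: "(G (x + h) - G x) / h = (F (x + h) - F x) / h + (K + 1)" if "h \<noteq> 0" for x h
    using that by (simp add: G_def field_simps)
  have "N p q \<in> null_sets lborel" if pq: "p < q" for p q
  proof (cases "N p q = {}")
    case False
    then obtain x where "x \<in> N p q" by blast
    then obtain h where h: "h \<noteq> 0" "(F (x + h) - F x) / h < p"
      unfolding N_def osc1_iff g_def by (auto dest!: spec[of _ 1])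
    have "- K \<le> (F (x + h) - F x) / h"
      using lip[of "x + h" x] h(1) by (cases "h > 0") (auto simp: pos_le_divide_eq neg_le_divide_eq)
    with h have p: "0 < p + (K + 1)" by linarith
    have "N p q = {0..1} \<inter> (\<lambda>x. (x, 0)) -` osc1 g p q" by (auto simp: N_def)
    also have "\<dots> \<in> sets borel"
      by (intro sets.Int measurable_sets_borel[OF _ osc1_borel[OF contg]]) auto
    finally have N: "N p q \<in> sets borel" .
    show ?thesis
    proof (rule oscillation_null[OF monoG contG N _ p])
      show "p + (K + 1) < q + (K + 1)" using pq by simp
      show "N p q \<subseteq> {0..1}" by (auto simp: N_def)
      fix x d :: real assume x: "x \<in> N p q" "0 < d"
      then have "\<exists>h. h \<noteq> 0 \<and> \<bar>h\<bar> < d \<and> (F (x + h) - F x) / h < p"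
        "\<exists>h. h \<noteq> 0 \<and> \<bar>h\<bar> < d \<and> q < (F (x + h) - F x) / h"
        unfolding N_def osc1_iff g_def by auto
      then show "\<exists>h. h \<noteq> 0 \<and> \<bar>h\<bar> < d \<and> (G (x + h) - G x) / h < p + (K + 1)"
        "\<exists>h. h \<noteq> 0 \<and> \<bar>h\<bar> < d \<and> q + (K + 1) < (G (x + h) - G x) / h"
        using slope by (metis add_less_cancel_right)+
    qed
  qed simp
  then have "(\<Union>p\<in>\<rat>. \<Union>q\<in>{q\<in>\<rat>. p < q}. N p q) \<in> null_sets lborel"
    by (intro null_sets_UN' countable_rat) (auto intro: countable_subset[OF _ countable_rat])
  then have "AE x in lborel. x \<notin> (\<Union>p\<in>\<rat>. \<Union>q\<in>{q\<in>\<rat>. p < q}. N p q)" by (rule AE_not_in)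
  then show ?thesis
  proof (rule AE_mp, intro AE_I2 impI)
    fix x assume *: "x \<notin> (\<Union>p\<in>\<rat>. \<Union>q\<in>{q\<in>\<rat>. p < q}. N p q)" "x \<in> {0..1}"
    then have "(x, 0) \<notin> nondiff1 g" unfolding nondiff1_eq[OF lipg] by (auto simp: N_def)
    then show "F differentiable at x" by (simp add: nondiff1_def g_def)
  qed
qed

text \<open>Lebesgue measure on the open unit interval, so that boundary points never have to be excluded from
  almost-everywhere statements.\<close>

definition U01 :: "real measure" where
  "U01 = restrict_space lborel {0<..<1}"

lemma space_U01: "space U01 = {0<..<1}"
  by (simp add: U01_def space_restrict_space)

lemma prob_space_U01: "prob_space U01"
  by (rule prob_spaceI) (simp add: space_U01, simp add: U01_def emeasure_restrict_space)

interpretation U01: prob_space U01 by (rule prob_space_U01)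
interpretation U01_pair: pair_prob_space U01 U01 ..

lemma integral_U01: "(\<integral>t. f t \<partial>U01) = (\<integral>t. indicator {0<..<1} t * f t \<partial>lborel)" for f :: "real \<Rightarrow> real"
  unfolding U01_def by (subst integral_restrict_space) auto

lemma LBINT_01: "(LBINT t=0..1. f t) = (\<integral>t. f t \<partial>U01)" for f :: "real \<Rightarrow> real"
  unfolding interval_lebesgue_integral_def zero_ereal_def one_ereal_def
  by (simp add: set_lebesgue_integral_def integral_U01)

lemma AE_U01: "(AE t in U01. P t) \<longleftrightarrow> (AE t in lborel. t \<in> {0<..<1} \<longrightarrow> P t)"
  unfolding U01_def by (subst AE_restrict_space_iff) auto

lemma measurable_U01: "f \<in> borel_measurable borel \<Longrightarrow> f \<in> borel_measurable U01"
  unfolding U01_def by (intro measurable_restrict_space1) simp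

definition clamp01 :: "real \<Rightarrow> real" where "clamp01 x = max 0 (min 1 x)"

lemma clamp01_mem: "clamp01 x \<in> {0..1}" "0 \<le> clamp01 x" "clamp01 x \<le> 1"
  and clamp01_id: "x \<in> {0..1} \<Longrightarrow> clamp01 x = x"
  and clamp01_lip: "\<bar>clamp01 x - clamp01 y\<bar> \<le> \<bar>x - y\<bar>"
  by (auto simp: clamp01_def)

lemma eventually_clamp01: "x \<in> {0<..<1} \<Longrightarrow> \<forall>\<^sub>F s in nhds x. clamp01 s = s"
  using eventually_nhds_in_open[of "{0<..<1}" x]
  by (auto elim!: eventually_mono simp: clamp01_def)

lemma deriv_bounded_by_lipschitz:
  fixes F :: "real \<Rightarrow> real"
  assumes lip: "\<And>x x'. x \<in> {0..1} \<Longrightarrow> x' \<in> {0..1} \<Longrightarrow> \<bar>F x - F x'\<bar> \<le> K * \<bar>x - x'\<bar>"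
    and t: "t \<in> {0<..<1}" and d: "F differentiable at t"
  shows "\<bar>deriv F t\<bar> \<le> K"
proof -
  have "((\<lambda>h. (F (t + h) - F t) / h) \<longlongrightarrow> deriv F t) (at 0)"
    using d by (simp add: DERIV_deriv_iff_real_differentiable DERIV_def[symmetric])
  then have "((\<lambda>h. \<bar>(F (t + h) - F t) / h\<bar>) \<longlongrightarrow> \<bar>deriv F t\<bar>) (at 0)" by (rule tendsto_rabs)
  moreover have "\<forall>\<^sub>F h in at 0. \<bar>(F (t + h) - F t) / h\<bar> \<le> K"
    unfolding eventually_at
  proof (intro exI[of _ "min t (1 - t)"] conjI ballI impI)
    fix h :: real assume h: "h \<noteq> 0 \<and> dist h 0 < min t (1 - t)"
    then have "\<bar>F (t + h) - F t\<bar> \<le> K * \<bar>h\<bar>"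
      using lip[of "t + h" t] t by (auto simp: dist_real_def abs_less_iff)
    then show "\<bar>(F (t + h) - F t) / h\<bar> \<le> K" using h by (simp add: divide_simps)
  qed (use t in auto)
  ultimately show ?thesis by (rule tendsto_upperbound) simp
qed

text \<open>Almost everywhere differentiability, measurability of the derivative and the fundamental theorem of
  calculus for a function that is Lipschitz on the closed unit interval. The last part is dominated convergence
  for the difference quotients: their integrals are differences of difference quotients of an antiderivative
  \<open>H\<close> of the function, and these converge to values of the function.\<close>

lemma lipschitz_unit_interval:
  fixes F :: "real \<Rightarrow> real"
  assumes lip: "\<And>x x'. x \<in> {0..1} \<Longrightarrow> x' \<in> {0..1} \<Longrightarrow> \<bar>F x - F x'\<bar> \<le> K * \<bar>x - x'\<bar>"
  shows "AE t in U01. F differentiable at t"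
    and "deriv F \<in> borel_measurable U01"
    and "x \<in> {0..1} \<Longrightarrow> (\<integral>t. indicator {..x} t * deriv F t \<partial>U01) = F x - F 0"
proof -
  have K: "K \<ge> 0" using lip[of 0 1] by simp
  define G where "G x = F (clamp01 x)" for x
  have lipG: "\<bar>G x - G x'\<bar> \<le> K * \<bar>x - x'\<bar>" for x x'
    unfolding G_def
    by (rule order_trans[OF lip[OF clamp01_mem(1) clamp01_mem(1)]]) (intro mult_left_mono clamp01_lip K)
  have contG: "continuous_on UNIV G"
    by (rule lipschitz_on_continuous_on[of K]) (use lipG K in \<open>auto simp: lipschitz_on_def dist_real_def\<close>)
  have ev: "\<forall>\<^sub>F s in nhds t. G s = F s" if "t \<in> {0<..<1}" for t
    using eventually_clamp01[OF that] by eventually_elim (simp add: G_def)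
  have diff: "G differentiable at t \<longleftrightarrow> F differentiable at t" if "t \<in> {0<..<1}" for t
    using DERIV_cong_ev[OF refl ev[OF that] refl] by (simp add: real_differentiable_def)
  have deriv: "deriv G t = deriv F t" if "t \<in> {0<..<1}" for t
    using ev[OF that] by (intro deriv_cong_ev) auto
  have aeG: "AE t in U01. G differentiable at t"
    using lipschitz_AE_differentiable[OF lipG] unfolding AE_U01 by eventually_elim auto
  show ae: "AE t in U01. F differentiable at t"
    using aeG AE_space[of U01] by eventually_elim (simp add: space_U01 diff)
  define g :: "real \<times> real \<Rightarrow> real" where "g = (\<lambda>z. G (fst z))"
  have contg: "continuous_on UNIV g"
    unfolding g_def by (intro continuous_on_compose2[OF contG] continuous_intros) auto
  have "pd1 g \<in> borel_measurable borel"
    by (rule pd1_borel[OF contg, of K]) (use lipG in \<open>simp add: g_def\<close>)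
  then have "(\<lambda>t. pd1 g (t, 0)) \<in> borel_measurable borel"
    by (rule measurable_compose[rotated]) simp
  moreover have "(\<lambda>t. pd1 g (t, 0)) = deriv G" by (simp add: pd1_def g_def)
  ultimately have "deriv G \<in> borel_measurable borel" by simp
  then have mG: "deriv G \<in> borel_measurable U01" by (rule measurable_U01)
  show mF: "deriv F \<in> borel_measurable U01"
    using mG by (rule measurable_cong[THEN iffD1, rotated]) (auto simp: space_U01 deriv)
  assume x: "x \<in> {0..1}"
  \<comment> \<open>The wide interval leaves room for the increments beyond the unit interval; \<open>G\<close> is constant there.\<close>
  obtain H where H': "\<And>t. t \<in> {-1..3} \<Longrightarrow> (H has_vector_derivative G t) (at t within {-1..3})"
    using antiderivative_continuous[of "-1" 3 G] continuous_on_subset[OF contG] by blast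
  have H: "DERIV H t :> G t" if "t \<in> {-1<..<3}" for t
    using H'[of t] that at_within_Icc_at[of "-1" t 3]
    by (auto simp: has_real_derivative_iff_has_vector_derivative)
  define u where "u n t = (G (t + 1 / Suc n) - G t) / (1 / Suc n)" for n :: nat and t
  have u_lim: "(\<lambda>n. u n t) \<longlonglongrightarrow> deriv G t" if "G differentiable at t" for t
    unfolding u_def using that
    by (intro difference_quotients_converge) (simp add: DERIV_deriv_iff_real_differentiable)
  have contu: "continuous_on UNIV (u n)" for n
    unfolding u_def by (intro continuous_intros continuous_on_compose2[OF contG]) auto
  have ind: "(indicator {..x} :: real \<Rightarrow> real) \<in> borel_measurable U01"
    by (intro measurable_U01) simp
  have L1: "(\<lambda>n. \<integral>t. indicator {..x} t * u n t \<partial>U01) \<longlonglongrightarrow> (\<integral>t. indicator {..x} t * deriv G t \<partial>U01)"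
  proof (rule integral_dominated_convergence[where w = "\<lambda>_. K"])
    show "(\<lambda>t. indicator {..x} t * deriv G t) \<in> borel_measurable U01"
      by (intro borel_measurable_times mG ind)
    show "(\<lambda>t. indicator {..x} t * u n t) \<in> borel_measurable U01" for n
      by (intro borel_measurable_times ind measurable_U01[OF borel_measurable_continuous_onI[OF contu]])
    show "AE t in U01. (\<lambda>n. indicator {..x} t * u n t) \<longlonglongrightarrow> indicator {..x} t * deriv G t"
      using aeG by eventually_elim (intro tendsto_intros u_lim)
    have "\<bar>u n t\<bar> \<le> K" for n t
      using lipG[of "t + 1 / Suc n" t] by (simp add: u_def divide_simps abs_mult)
    then show "AE t in U01. norm (indicator {..x} t * u n t) \<le> K" for n
      using K by (auto simp: abs_mult split: split_indicator)
  qed simp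
  have eq: "(\<integral>t. indicator {..x} t * u n t \<partial>U01) =
      (H (x + 1 / Suc n) - H x) / (1 / Suc n) - (H (0 + 1 / Suc n) - H 0) / (1 / Suc n)" for n
  proof -
    let ?h = "1 / real (Suc n)"
    have h: "0 < ?h" "?h \<le> 1" by auto
    have "AE t in lborel. t \<notin> {0, x}"
      by (intro AE_not_in countable_imp_null_set_lborel) auto
    then have "AE t in lborel. indicator {0<..<1} t * (indicator {..x} t * u n t) = u n t * indicator {0..x} t"
      by eventually_elim (use x in \<open>auto split: split_indicator\<close>)
    then have "(\<integral>t. indicator {..x} t * u n t \<partial>U01) = (\<integral>t. u n t * indicator {0..x} t \<partial>lborel)"
      unfolding integral_U01
      by (intro integral_cong_AE borel_measurable_times borel_measurable_indicator)
         (auto intro!: borel_measurable_continuous_onI contu)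
    also have "\<dots> = (H (x + ?h) - H x) / ?h - (H (0 + ?h) - H 0) / ?h"
    proof (rule integral_FTC_Icc_real)
      fix t assume t: "0 \<le> t" "t \<le> x"
      have 1: "DERIV H (t + ?h) :> G (t + ?h)" "DERIV H t :> G t"
        by (rule H, use t x h in \<open>simp only: greaterThanLessThan_iff atLeastAtMost_iff; linarith\<close>)+
      show "DERIV (\<lambda>t. (H (t + ?h) - H t) / ?h) t :> u n t"
        unfolding u_def
        by (intro DERIV_cdivide DERIV_diff 1(2) DERIV_shift[THEN iffD1, OF 1(1)])
      show "isCont (u n) t" using contu by (simp add: continuous_on_eq_continuous_at)
    qed (use x in auto)
    finally show ?thesis .
  qed
  have quot: "(\<lambda>n. (H (t + 1 / Suc n) - H t) / (1 / Suc n)) \<longlonglongrightarrow> G t" if "t \<in> {0..1}" for t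
    using that by (intro difference_quotients_converge H) auto
  have L2: "(\<lambda>n. (H (x + 1 / Suc n) - H x) / (1 / Suc n) - (H (0 + 1 / Suc n) - H 0) / (1 / Suc n))
      \<longlonglongrightarrow> G x - G 0"
    by (intro tendsto_diff quot x) simp
  have "(\<integral>t. indicator {..x} t * deriv G t \<partial>U01) = G x - G 0"
    by (rule LIMSEQ_unique[OF L1[unfolded eq] L2])
  moreover have "(\<integral>t. indicator {..x} t * deriv G t \<partial>U01) = (\<integral>t. indicator {..x} t * deriv F t \<partial>U01)"
    by (rule Bochner_Integration.integral_cong) (auto simp: space_U01 deriv)
  ultimately show "(\<integral>t. indicator {..x} t * deriv F t \<partial>U01) = F x - F 0"
    using x by (simp add: G_def clamp01_id)
qed

section \<open>Bounded measurable functions on the unit interval\<close>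

text \<open>The test functions. Boundedness is demanded everywhere on the open interval, which partial
  derivatives satisfy because \<^const>\<open>deriv\<close> has a fixed default value.\<close>

definition bounded_measurable :: "(real \<Rightarrow> real) \<Rightarrow> bool" where
  "bounded_measurable c \<longleftrightarrow> c \<in> borel_measurable U01 \<and> (\<exists>K. \<forall>t\<in>{0<..<1}. \<bar>c t\<bar> \<le> K)"

lemma bounded_measurableI:
  "c \<in> borel_measurable U01 \<Longrightarrow> (\<And>t. t \<in> {0<..<1} \<Longrightarrow> \<bar>c t\<bar> \<le> K) \<Longrightarrow> bounded_measurable c"
  unfolding bounded_measurable_def by blast

lemma bounded_measurable_measurable: "bounded_measurable c \<Longrightarrow> c \<in> borel_measurable U01"
  by (simp add: bounded_measurable_def)

lemma bounded_measurableE: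
  assumes "bounded_measurable c"
  obtains K where "K \<ge> 0" "\<And>t. t \<in> {0<..<1} \<Longrightarrow> \<bar>c t\<bar> \<le> K"
proof -
  obtain K where K: "\<And>t. t \<in> {0<..<1} \<Longrightarrow> \<bar>c t\<bar> \<le> K"
    using assms unfolding bounded_measurable_def by blast
  have "K \<ge> 0" using K[of "1/2"] by simp
  then show thesis using K that by blast
qed

lemma bounded_measurable_integrable:
  assumes "bounded_measurable c" shows "integrable U01 c"
proof -
  obtain K where "\<And>t. t \<in> {0<..<1} \<Longrightarrow> \<bar>c t\<bar> \<le> K" using assms by (rule bounded_measurableE) (rule that, blast)
  then show ?thesis using assms
    by (intro U01.integrable_const_bound[of _ K] AE_I2) (auto simp: space_U01 bounded_measurable_def)
qed

lemma bounded_measurable_const: "bounded_measurable (\<lambda>_. k)"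
  by (rule bounded_measurableI[of _ "\<bar>k\<bar>"]) auto

lemma bounded_measurable_indicator: "B \<in> sets borel \<Longrightarrow> bounded_measurable (indicator B)"
  by (rule bounded_measurableI[of _ 1]) (auto intro!: measurable_U01 split: split_indicator)

lemma bounded_measurable_add:
  assumes "bounded_measurable c" "bounded_measurable d"
  shows "bounded_measurable (\<lambda>t. c t + d t)"
proof -
  obtain K where K: "\<And>t. t \<in> {0<..<1} \<Longrightarrow> \<bar>c t\<bar> \<le> K" using assms(1) by (rule bounded_measurableE) (rule that, blast)
  obtain L where L: "\<And>t. t \<in> {0<..<1} \<Longrightarrow> \<bar>d t\<bar> \<le> L" using assms(2) by (rule bounded_measurableE) (rule that, blast)
  have "\<bar>c t + d t\<bar> \<le> K + L" if "t \<in> {0<..<1}" for t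
    using K[OF that] L[OF that] by linarith
  then show ?thesis using assms
    by (intro bounded_measurableI[of _ "K + L"]) (auto simp: bounded_measurable_def)
qed

lemma bounded_measurable_mult:
  assumes "bounded_measurable c" "bounded_measurable d"
  shows "bounded_measurable (\<lambda>t. c t * d t)"
proof -
  obtain K where K: "K \<ge> 0" "\<And>t. t \<in> {0<..<1} \<Longrightarrow> \<bar>c t\<bar> \<le> K" using assms(1) by (rule bounded_measurableE) auto
  obtain L where L: "L \<ge> 0" "\<And>t. t \<in> {0<..<1} \<Longrightarrow> \<bar>d t\<bar> \<le> L" using assms(2) by (rule bounded_measurableE) auto
  have "\<bar>c t * d t\<bar> \<le> K * L" if "t \<in> {0<..<1}" for t
    unfolding abs_mult using K L that by (intro mult_mono) auto
  then show ?thesis using assms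
    by (intro bounded_measurableI[of _ "K * L"]) (auto simp: bounded_measurable_def)
qed

lemma bounded_measurable_cmult: "bounded_measurable c \<Longrightarrow> bounded_measurable (\<lambda>t. k * c t)"
  by (rule bounded_measurable_mult[OF bounded_measurable_const])

lemma bounded_measurable_diff:
  "bounded_measurable c \<Longrightarrow> bounded_measurable d \<Longrightarrow> bounded_measurable (\<lambda>t. c t - d t)"
  using bounded_measurable_add[OF _ bounded_measurable_cmult[of d "-1"]] by simp

lemma bounded_measurable_abs: "bounded_measurable c \<Longrightarrow> bounded_measurable (\<lambda>t. \<bar>c t\<bar>)"
  by (auto simp: bounded_measurable_def)

lemma bounded_measurable_pos_part:
  assumes "bounded_measurable c" shows "bounded_measurable (\<lambda>t. max 0 (c t))"
proof -
  obtain K where K: "K \<ge> 0" "\<And>t. t \<in> {0<..<1} \<Longrightarrow> \<bar>c t\<bar> \<le> K" using assms by (rule bounded_measurableE) auto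
  show ?thesis
    by (rule bounded_measurableI[of _ K]) (use assms K in \<open>fastforce simp: bounded_measurable_def\<close>)+
qed

text \<open>Dynkin's theorem for the generator of closed lower half-lines.\<close>

lemma borel_induct_atMost [consumes 1, case_names atMost compl empty union]:
  assumes "B \<in> sets (borel :: real measure)"
    and atMost: "\<And>x. P {..x}"
    and compl: "\<And>A. A \<in> sets borel \<Longrightarrow> P A \<Longrightarrow> P (UNIV - A)"
    and empty: "P {}"
    and "\<And>A. disjoint_family A \<Longrightarrow> (\<And>i::nat. A i \<in> sets borel) \<Longrightarrow> (\<And>i. P (A i)) \<Longrightarrow> P (\<Union>i. A i)"
  shows "P B"
proof -
  have sets: "sets (borel :: real measure) = sigma_sets UNIV (range atMost)"
    unfolding borel_eq_atMost by simp
  have "Int_stable (range (atMost :: real \<Rightarrow> _))" "range (atMost :: real \<Rightarrow> _) \<subseteq> Pow UNIV"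
    "B \<in> sigma_sets UNIV (range atMost)"
    using assms(1) sets by (auto simp: Int_stable_def)
  then show ?thesis
  proof (induction rule: sigma_sets_induct_disjoint)
    case (union A)
    then show ?case using sets by (intro assms(5)) auto
  qed (use sets in \<open>auto intro: atMost compl empty\<close>)
qed

text \<open>The extension principle behind the associativity of the star product, the uniqueness of densities
  and the probabilistic meaning of partial derivatives. Boundedness in \<open>L\<^sup>1\<close> makes the class
  of functions on which \<open>\<Theta>\<close> vanishes closed under dominated limits, so vanishing passes from
  initial intervals to Borel sets by Dynkin's theorem and then to all bounded measurable functions by simple
  approximation.\<close>

lemma L1_bounded_functional_eq_0:
  fixes \<Theta> :: "(real \<Rightarrow> real) \<Rightarrow> real"
  assumes add: "\<And>c d. bounded_measurable c \<Longrightarrow> bounded_measurable d \<Longrightarrow> \<Theta> (\<lambda>t. c t + d t) = \<Theta> c + \<Theta> d"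
    and scale: "\<And>c k. bounded_measurable c \<Longrightarrow> \<Theta> (\<lambda>t. k * c t) = k * \<Theta> c"
    and bound: "\<And>c. bounded_measurable c \<Longrightarrow> \<bar>\<Theta> c\<bar> \<le> K * (\<integral>t. \<bar>c t\<bar> \<partial>U01)"
    and initial: "\<And>x. x \<in> {0..1} \<Longrightarrow> \<Theta> (indicator {..x}) = 0"
    and c: "bounded_measurable c"
  shows "\<Theta> c = 0"
proof -
  have diff: "\<Theta> (\<lambda>t. c t - d t) = \<Theta> c - \<Theta> d" if "bounded_measurable c" "bounded_measurable d" for c d
    using add[OF that(1) bounded_measurable_cmult[OF that(2), of "-1"]] scale[OF that(2), of "-1"] by simp
  have cong: "\<Theta> c = \<Theta> d" if "bounded_measurable c" "bounded_measurable d" "\<And>t. t \<in> {0<..<1} \<Longrightarrow> c t = d t" for c d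
  proof -
    have "(\<integral>t. \<bar>c t - d t\<bar> \<partial>U01) = (\<integral>t. 0 \<partial>U01)"
      by (rule Bochner_Integration.integral_cong) (auto simp: space_U01 that)
    then show ?thesis using bound[OF bounded_measurable_diff[OF that(1,2)]] diff[OF that(1,2)] by simp
  qed
  have limit: "\<Theta> c = 0"
    if c: "bounded_measurable c" and u: "\<And>i. bounded_measurable (u i)" "\<And>i. \<Theta> (u i) = 0"
      and lim: "\<And>t. t \<in> {0<..<1} \<Longrightarrow> (\<lambda>i::nat. u i t) \<longlonglongrightarrow> c t"
      and dom: "\<And>i t. t \<in> {0<..<1} \<Longrightarrow> \<bar>u i t\<bar> \<le> L" for c u L
  proof -
    obtain L' where L': "\<And>t. t \<in> {0<..<1} \<Longrightarrow> \<bar>c t\<bar> \<le> L'" using c by (rule bounded_measurableE) (rule that, blast)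
    have "(\<lambda>i. \<integral>t. \<bar>c t - u i t\<bar> \<partial>U01) \<longlonglongrightarrow> (\<integral>t. 0 \<partial>U01)"
    proof (rule integral_dominated_convergence[where w = "\<lambda>_. L' + L"])
      show "AE t in U01. (\<lambda>i. \<bar>c t - u i t\<bar>) \<longlonglongrightarrow> 0"
      proof (rule AE_I2)
        fix t assume "t \<in> space U01"
        then have "(\<lambda>i. \<bar>c t - u i t\<bar>) \<longlonglongrightarrow> \<bar>c t - c t\<bar>"
          by (intro tendsto_intros lim) (simp add: space_U01)
        then show "(\<lambda>i. \<bar>c t - u i t\<bar>) \<longlonglongrightarrow> 0" by simp
      qed
      show "AE t in U01. norm \<bar>c t - u i t\<bar> \<le> L' + L" for i
      proof (rule AE_I2)
        fix t assume "t \<in> space U01"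
        then show "norm \<bar>c t - u i t\<bar> \<le> L' + L"
          using L'[of t] dom[of t i] by (simp add: space_U01)
      qed
    qed (auto intro!: bounded_measurable_measurable[OF bounded_measurable_abs]
        bounded_measurable_diff c u(1))
    then have "(\<lambda>i. K * (\<integral>t. \<bar>c t - u i t\<bar> \<partial>U01)) \<longlonglongrightarrow> K * 0"
      by (intro tendsto_intros) simp
    moreover have "\<bar>\<Theta> c\<bar> \<le> K * (\<integral>t. \<bar>c t - u i t\<bar> \<partial>U01)" for i
      using bound[OF bounded_measurable_diff[OF c u(1), of i]] diff[OF c u(1), of i] u(2)[of i] by simp
    ultimately have "\<bar>\<Theta> c\<bar> \<le> 0" by (intro LIMSEQ_le_const) auto
    then show ?thesis by simp
  qed
  have sets: "\<Theta> (indicator B) = 0" if "B \<in> sets borel" for B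
    using that
  proof (induction rule: borel_induct_atMost)
    case (atMost x)
    have "\<Theta> (indicator {..x}) = \<Theta> (indicator {..clamp01 x})"
      by (rule cong) (auto simp: bounded_measurable_indicator clamp01_def split: split_indicator)
    then show ?case using initial[OF clamp01_mem(1)] by simp
  next
    case (compl A)
    have "\<Theta> (indicator (UNIV - A)) = \<Theta> (\<lambda>t. indicator {..1} t - indicator A t)"
      by (rule cong) (use compl in \<open>auto intro!: bounded_measurable_diff bounded_measurable_indicator split: split_indicator\<close>)
    also have "\<dots> = 0" using compl initial[of 1] by (subst diff) (auto intro: bounded_measurable_indicator)
    finally show ?case .
  next
    case empty
    show ?case using scale[OF bounded_measurable_const, of 0 0] by (simp add: indicator_def)
  next
    case (union A)
    have fin: "\<Theta> (indicator (\<Union>i<n. A i)) = 0" for n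
    proof (induction n)
      case 0
      show ?case using scale[OF bounded_measurable_const, of 0 0] by (simp add: indicator_def)
    next
      case (Suc n)
      have "A i \<inter> A n = {}" if "i < n" for i
        using union(1) that by (simp add: disjoint_family_on_def)
      then have "disjnt (\<Union>i<n. A i) (A n)"
        by (auto simp: disjnt_def)
      then have "(indicator (\<Union>i<Suc n. A i) :: real \<Rightarrow> real) = (\<lambda>t. indicator (\<Union>i<n. A i) t + indicator (A n) t)"
        by (auto simp: fun_eq_iff lessThan_Suc disjnt_def split: split_indicator)
      then show ?case using Suc union by (simp add: add bounded_measurable_indicator)
    qed
    show ?case
    proof (rule limit[where u = "\<lambda>n. indicator (\<Union>i<n. A i)" and L = 1])
      show "(\<lambda>n. indicator (\<Union>i<n. A i) t) \<longlonglongrightarrow> (indicator (\<Union>i. A i) t :: real)" for t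
        by (rule LIMSEQ_indicator_UN)
    qed (use union fin in \<open>auto intro!: bounded_measurable_indicator split: split_indicator\<close>)
  qed
  have nonneg: "bounded_measurable u \<longrightarrow> \<Theta> u = 0"
    if u: "u \<in> borel_measurable U01" "\<And>t. 0 \<le> u t" for u
    using u
  proof (induction rule: borel_measurable_induct_real)
    case (set A)
    then obtain B where B: "B \<in> sets borel" "A = {0<..<1} \<inter> B"
      by (auto simp: U01_def sets_restrict_space)
    then have "A \<in> sets borel" by simp
    then show ?case using sets by simp
  next
    case (mult u k)
    show ?case
    proof (cases "k = 0")
      case True
      then show ?thesis using scale[OF bounded_measurable_const, of 0 0] by simp
    next
      case False
      show ?thesis
      proof
        assume "bounded_measurable (\<lambda>x. k * u x)"
        then have "bounded_measurable (\<lambda>x. (1 / k) * (k * u x))" by (rule bounded_measurable_cmult)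
        then have "bounded_measurable u" using False by simp
        then show "\<Theta> (\<lambda>x. k * u x) = 0" using mult scale by simp
      qed
    qed
  next
    case (add u v)
    show ?case
    proof
      assume "bounded_measurable (\<lambda>x. v x + u x)"
      then obtain L where L: "\<And>t. t \<in> {0<..<1} \<Longrightarrow> \<bar>v t + u t\<bar> \<le> L" by (rule bounded_measurableE) (rule that, blast)
      have "\<bar>u t\<bar> \<le> L" "\<bar>v t\<bar> \<le> L" if "t \<in> {0<..<1}" for t
        using L[OF that] add(2)[of t] add(5)[of t] that by (auto simp: space_U01)
      then have "bounded_measurable u" "bounded_measurable v"
        using \<open>u \<in> borel_measurable U01\<close> \<open>v \<in> borel_measurable U01\<close>
        by (blast intro: bounded_measurableI)+
      then show "\<Theta> (\<lambda>x. v x + u x) = 0" using add assms(1) by simp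
    qed
  next
    case (seq U)
    show ?case
    proof
      assume u: "bounded_measurable u"
      then obtain L where L: "\<And>t. t \<in> {0<..<1} \<Longrightarrow> \<bar>u t\<bar> \<le> L" by (rule bounded_measurableE) (rule that, blast)
      have Ub: "\<bar>U i t\<bar> \<le> L" if t: "t \<in> {0<..<1}" for i t
      proof -
        have "U i t \<le> u t"
        proof (rule incseq_le)
          show "incseq (\<lambda>i. U i t)" using \<open>incseq U\<close> by (auto simp: incseq_def le_fun_def)
          show "(\<lambda>i. U i t) \<longlonglongrightarrow> u t" using seq(4) t by (simp add: space_U01)
        qed
        then show ?thesis using L[OF t] seq(2)[of i t] t by (simp add: space_U01)
      qed
      then have "bounded_measurable (U i)" for i using seq(1) by (blast intro: bounded_measurableI)
      then show "\<Theta> u = 0" using seq Ub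
        by (intro limit[OF u, of U L]) (auto simp: space_U01)
    qed
  qed
  have "\<Theta> c = \<Theta> (\<lambda>t. max 0 (c t) - max 0 (- 1 * c t))"
    by (rule arg_cong[of _ _ \<Theta>]) auto
  also have "\<dots> = \<Theta> (\<lambda>t. max 0 (c t)) - \<Theta> (\<lambda>t. max 0 (- 1 * c t))"
    by (intro diff bounded_measurable_pos_part bounded_measurable_cmult c)
  also have "\<dots> = 0"
    using nonneg[of "\<lambda>t. max 0 (c t)"] nonneg[of "\<lambda>t. max 0 (- 1 * c t)"]
      bounded_measurable_pos_part[OF c] bounded_measurable_pos_part[OF bounded_measurable_cmult[OF c, of "-1"]]
    by (simp add: bounded_measurable_measurable)
  finally show ?thesis .
qed

lemma AE_eq_if_primitives_eq:
  assumes f: "bounded_measurable f" and g: "bounded_measurable g"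
    and eq: "\<And>x. x \<in> {0..1} \<Longrightarrow> (\<integral>t. indicator {..x} t * f t \<partial>U01) = (\<integral>t. indicator {..x} t * g t \<partial>U01)"
  shows "AE t in U01. f t = g t"
proof -
  let ?d = "\<lambda>t. f t - g t"
  have d: "bounded_measurable ?d" by (rule bounded_measurable_diff[OF f g])
  obtain K where K: "\<And>t. t \<in> {0<..<1} \<Longrightarrow> \<bar>?d t\<bar> \<le> K" using d by (rule bounded_measurableE) (rule that, blast)
  have int: "integrable U01 (\<lambda>t. c t * ?d t)" if "bounded_measurable c" for c
    by (intro bounded_measurable_integrable bounded_measurable_mult that d)
  have "(\<integral>t. ?d t * ?d t \<partial>U01) = 0"
  proof (rule L1_bounded_functional_eq_0[where \<Theta> = "\<lambda>c. \<integral>t. c t * ?d t \<partial>U01" and K = K])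
    fix c e :: "real \<Rightarrow> real" and k assume c: "bounded_measurable c"
    show "bounded_measurable e \<Longrightarrow> (\<integral>t. (c t + e t) * ?d t \<partial>U01) = (\<integral>t. c t * ?d t \<partial>U01) + (\<integral>t. e t * ?d t \<partial>U01)"
      using int[OF c] int[of e] by (subst Bochner_Integration.integral_add[symmetric]) (auto simp: distrib_right)
    show "(\<integral>t. k * c t * ?d t \<partial>U01) = k * (\<integral>t. c t * ?d t \<partial>U01)"
      by (simp add: mult.assoc)
    have "\<bar>\<integral>t. c t * ?d t \<partial>U01\<bar> \<le> (\<integral>t. \<bar>c t * ?d t\<bar> \<partial>U01)" by (rule integral_abs_bound)
    also have "\<dots> \<le> (\<integral>t. K * \<bar>c t\<bar> \<partial>U01)"
    proof (rule integral_mono)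
      show "integrable U01 (\<lambda>t. \<bar>c t * ?d t\<bar>)" "integrable U01 (\<lambda>t. K * \<bar>c t\<bar>)"
        using int[OF c] bounded_measurable_integrable[OF c] by auto
      fix t assume "t \<in> space U01"
      then have "\<bar>c t\<bar> * \<bar>?d t\<bar> \<le> \<bar>c t\<bar> * K" using K[of t] by (intro mult_left_mono) (auto simp: space_U01)
      then show "\<bar>c t * ?d t\<bar> \<le> K * \<bar>c t\<bar>" by (simp add: abs_mult mult.commute)
    qed
    finally show "\<bar>\<integral>t. c t * ?d t \<partial>U01\<bar> \<le> K * (\<integral>t. \<bar>c t\<bar> \<partial>U01)" by simp
  next
    fix x :: real assume x: "x \<in> {0..1}"
    have ind: "bounded_measurable (indicator {..x})" by (simp add: bounded_measurable_indicator)
    show "(\<integral>t. indicator {..x} t * ?d t \<partial>U01) = 0"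
      using eq[OF x] bounded_measurable_integrable[OF bounded_measurable_mult[OF ind f]]
        bounded_measurable_integrable[OF bounded_measurable_mult[OF ind g]]
      by (simp add: right_diff_distrib)
  qed (rule d)
  then have "AE t in U01. ?d t * ?d t = 0"
    using int[OF d] by (subst (asm) integral_nonneg_eq_0_iff_AE) auto
  then show ?thesis by eventually_elim simp
qed

section \<open>Copulas and their partial derivatives\<close>

text \<open>Transposition of the two arguments exchanges the two partial derivatives and reverses star products;
  it halves most of the arguments below.\<close>

definition flip :: "(real \<times> real \<Rightarrow> real) \<Rightarrow> real \<times> real \<Rightarrow> real" where
  "flip A = (\<lambda>(x, y). A (y, x))"

lemma flip_apply [simp]: "flip A (x, y) = A (y, x)"
  by (simp add: flip_def)

lemma flip_flip [simp]: "flip (flip A) = A"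
  by (auto simp: flip_def)

lemma pd1_flip: "pd1 (flip A) (x, y) = pd2 A (y, x)"
  and pd2_flip: "pd2 (flip A) (x, y) = pd1 A (y, x)"
  by (simp_all add: pd1_def pd2_def)

text \<open>Differences of copulas are not copulas, but they stay in this class, on which partial derivatives
  behave well.\<close>

definition square_lipschitz :: "real \<Rightarrow> (real \<times> real \<Rightarrow> real) \<Rightarrow> bool" where
  "square_lipschitz K A \<longleftrightarrow> (\<forall>x\<in>{0..1}. \<forall>x'\<in>{0..1}. \<forall>y\<in>{0..1}. \<forall>y'\<in>{0..1}.
     \<bar>A (x, y) - A (x', y')\<bar> \<le> K * (\<bar>x - x'\<bar> + \<bar>y - y'\<bar>))"

lemma square_lipschitzD:
  "square_lipschitz K A \<Longrightarrow> x \<in> {0..1} \<Longrightarrow> x' \<in> {0..1} \<Longrightarrow> y \<in> {0..1} \<Longrightarrow> y' \<in> {0..1} \<Longrightarrow>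
    \<bar>A (x, y) - A (x', y')\<bar> \<le> K * (\<bar>x - x'\<bar> + \<bar>y - y'\<bar>)"
  unfolding square_lipschitz_def by blast

lemma square_lipschitz_section:
  assumes "square_lipschitz K A" "y \<in> {0..1}" "x \<in> {0..1}" "x' \<in> {0..1}"
  shows "\<bar>A (x, y) - A (x', y)\<bar> \<le> K * \<bar>x - x'\<bar>"
  using square_lipschitzD[OF assms(1,3,4,2,2)] by simp

lemma square_lipschitz_flip: "square_lipschitz K A \<Longrightarrow> square_lipschitz K (flip A)"
  unfolding square_lipschitz_def flip_apply by (subst add.commute) blast

lemma square_lipschitz_diff:
  assumes "square_lipschitz K A" "square_lipschitz L B"
  shows "square_lipschitz (K + L) (\<lambda>p. A p - B p)"
  unfolding square_lipschitz_def
proof (intro ballI)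
  fix x x' y y' :: real assume *: "x \<in> {0..1}" "x' \<in> {0..1}" "y \<in> {0..1}" "y' \<in> {0..1}"
  then show "\<bar>A (x, y) - B (x, y) - (A (x', y') - B (x', y'))\<bar> \<le> (K + L) * (\<bar>x - x'\<bar> + \<bar>y - y'\<bar>)"
    using square_lipschitzD[OF assms(1) *] square_lipschitzD[OF assms(2) *]
    unfolding distrib_right by linarith
qed

text \<open>Where a section is not differentiable, \<^const>\<open>deriv\<close> takes this value.\<close>

definition deriv_default :: real where "deriv_default = (SOME D. False)"

lemma deriv_not_differentiable:
  fixes F :: "real \<Rightarrow> real"
  assumes "\<not> F differentiable at t" shows "deriv F t = deriv_default"
proof -
  have "\<not> (DERIV F t :> D)" for D using assms by (auto simp: real_differentiable_def)
  then show ?thesis by (simp add: deriv_def deriv_default_def)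
qed

context
  fixes K A assumes A: "square_lipschitz K A"
begin

lemma pd1_differentiable: "y \<in> {0..1} \<Longrightarrow> AE t in U01. (\<lambda>s. A (s, y)) differentiable at t"
  by (rule lipschitz_unit_interval(1)) (rule square_lipschitz_section[OF A])

lemma pd1_FTC: "y \<in> {0..1} \<Longrightarrow> x \<in> {0..1} \<Longrightarrow>
    (\<integral>t. indicator {..x} t * pd1 A (t, y) \<partial>U01) = A (x, y) - A (0, y)"
  using lipschitz_unit_interval(3)[OF square_lipschitz_section[OF A]] by (simp add: pd1_def)

lemma pd1_bound:
  assumes "t \<in> {0<..<1}" "y \<in> {0..1}"
  shows "\<bar>pd1 A (t, y)\<bar> \<le> max K \<bar>deriv_default\<bar>"
proof (cases "(\<lambda>s. A (s, y)) differentiable at t")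
  case True
  then have "\<bar>deriv (\<lambda>s. A (s, y)) t\<bar> \<le> K"
    by (intro deriv_bounded_by_lipschitz square_lipschitz_section[OF A] assms)
  then show ?thesis by (simp add: pd1_def)
next
  case False
  then show ?thesis by (simp add: pd1_def deriv_not_differentiable)
qed

lemma pd1_bounded_measurable: "y \<in> {0..1} \<Longrightarrow> bounded_measurable (\<lambda>t. pd1 A (t, y))"
proof (rule bounded_measurableI[OF _ pd1_bound])
  assume "y \<in> {0..1}"
  then show "(\<lambda>t. pd1 A (t, y)) \<in> borel_measurable U01"
    using lipschitz_unit_interval(2)[OF square_lipschitz_section[OF A]] by (simp add: pd1_def)
qed

text \<open>Joint measurability is needed for the double integral of the Sobolev norm. It is inherited from the
  extension of \<open>A\<close> to the plane that is constant beyond the square, and it turns the null sections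
  of the non-differentiability set into a null set by Fubini.\<close>

lemma pd1_joint:
  shows "pd1 A \<in> borel_measurable (U01 \<Otimes>\<^sub>M U01)"
    and "AE z in U01 \<Otimes>\<^sub>M U01. (\<lambda>s. A (s, snd z)) differentiable at (fst z)"
proof -
  have K: "K \<ge> 0" using square_lipschitzD[OF A, of 0 1 0 0] by simp
  define g where "g = (\<lambda>z. A (clamp01 (fst z), clamp01 (snd z)))"
  have lip: "\<bar>g (x, y) - g (x', y')\<bar> \<le> K * (\<bar>x - x'\<bar> + \<bar>y - y'\<bar>)" for x x' y y'
    unfolding g_def fst_conv snd_conv
    by (rule order_trans[OF square_lipschitzD[OF A]])
       (intro clamp01_mem mult_left_mono add_mono clamp01_lip K)+
  have cont: "continuous_on UNIV g"
  proof (rule lipschitz_on_continuous_on[of "2 * K"])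
    have "\<bar>g z - g z'\<bar> \<le> 2 * K * dist z z'" for z z'
    proof -
      obtain x y x' y' where z: "z = (x, y)" "z' = (x', y')" by (cases z, cases z') auto
      have "\<bar>x - x'\<bar> \<le> dist z z'" "\<bar>y - y'\<bar> \<le> dist z z'"
        using dist_fst_le[of z z'] dist_snd_le[of z z'] by (auto simp: z dist_real_def)
      then have "K * (\<bar>x - x'\<bar> + \<bar>y - y'\<bar>) \<le> K * (2 * dist z z')"
        by (intro mult_left_mono K) linarith
      then show ?thesis using lip[of x y x' y'] by (simp add: z)
    qed
    then show "(2 * K)-lipschitz_on UNIV g"
      using K by (auto simp: lipschitz_on_def dist_real_def)
  qed
  have lip1: "\<bar>g (x, y) - g (x', y)\<bar> \<le> K * \<bar>x - x'\<bar>" for x x' y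
    using lip[of x y x' y] by simp
  have sets: "f \<in> borel_measurable (U01 \<Otimes>\<^sub>M U01)" if "f \<in> borel_measurable borel" for f :: "real \<times> real \<Rightarrow> real"
  proof -
    have "(\<lambda>x. x) \<in> measurable U01 borel" by (rule measurable_U01) simp
    then have "(\<lambda>z. (fst z, snd z)) \<in> measurable (U01 \<Otimes>\<^sub>M U01) (borel \<Otimes>\<^sub>M borel)"
      by (intro measurable_Pair measurable_compose[OF measurable_fst] measurable_compose[OF measurable_snd])
    then have "(\<lambda>z. z) \<in> measurable (U01 \<Otimes>\<^sub>M U01) borel" by (simp add: borel_prod)
    then show ?thesis using measurable_compose that by blast
  qed
  have ev: "\<forall>\<^sub>F s in nhds t. g (s, y) = A (s, y)" if "t \<in> {0<..<1}" "y \<in> {0<..<1}" for t y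
    using eventually_clamp01[OF that(1)] by eventually_elim (use that in \<open>simp add: g_def clamp01_id\<close>)
  have eq: "pd1 g z = pd1 A z" if "z \<in> space (U01 \<Otimes>\<^sub>M U01)" for z
    using that unfolding space_pair_measure space_U01 pd1_def
    by (auto intro!: deriv_cong_ev ev)
  have diff_eq: "(\<lambda>s. A (s, snd z)) differentiable at (fst z) \<longleftrightarrow> z \<notin> nondiff1 g"
    if "z \<in> space (U01 \<Otimes>\<^sub>M U01)" for z
    using that DERIV_cong_ev[OF refl ev refl] unfolding space_pair_measure space_U01
    by (auto simp: nondiff1_def real_differentiable_def)
  have "pd1 g \<in> borel_measurable (U01 \<Otimes>\<^sub>M U01)"
    by (intro sets pd1_borel[OF cont lip1])
  then show "pd1 A \<in> borel_measurable (U01 \<Otimes>\<^sub>M U01)"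
    by (rule measurable_cong[THEN iffD1, rotated]) (rule eq)
  have "(indicator (nondiff1 g) :: _ \<Rightarrow> real) \<in> borel_measurable (U01 \<Otimes>\<^sub>M U01)"
    by (intro sets borel_measurable_indicator nondiff1_borel[OF cont lip1])
  then have pred: "Measurable.pred (U01 \<Otimes>\<^sub>M U01) (\<lambda>z. z \<notin> nondiff1 g)"
  proof -
    have "{z \<in> space (U01 \<Otimes>\<^sub>M U01). indicator (nondiff1 g) z = (0::real)} \<in> sets (U01 \<Otimes>\<^sub>M U01)"
      using \<open>(indicator (nondiff1 g) :: _ \<Rightarrow> real) \<in> borel_measurable (U01 \<Otimes>\<^sub>M U01)\<close> by measurable
    then show ?thesis by (simp add: pred_def indicator_eq_0_iff)
  qed
  have "AE y in U01. AE x in U01. (x, y) \<notin> nondiff1 g"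
  proof (rule AE_I2)
    fix y assume y: "y \<in> space U01"
    then have "y \<in> {0..1}" by (simp add: space_U01)
    from pd1_differentiable[OF this] AE_space[of U01]
    show "AE x in U01. (x, y) \<notin> nondiff1 g"
      by eventually_elim (use diff_eq y in \<open>auto simp: space_pair_measure\<close>)
  qed
  then have "AE z in U01 \<Otimes>\<^sub>M U01. z \<notin> nondiff1 g"
    using U01_pair.AE_commute[of "\<lambda>x y. (x, y) \<notin> nondiff1 g"] pred
    by (subst U01_pair.AE_pair_iff[of "\<lambda>x y. (x, y) \<notin> nondiff1 g", simplified, symmetric])
       (auto simp: pred_def)
  then show "AE z in U01 \<Otimes>\<^sub>M U01. (\<lambda>s. A (s, snd z)) differentiable at (fst z)"
    using AE_space[of "U01 \<Otimes>\<^sub>M U01"] by eventually_elim (simp add: diff_eq)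
qed

end

lemma pd1_cong:
  assumes "\<And>p. p \<in> unit_square \<Longrightarrow> A p = B p" and "t \<in> {0<..<1}" "y \<in> {0..1}"
  shows "pd1 A (t, y) = pd1 B (t, y)"
  unfolding pd1_def prod.case
  by (rule deriv_cong_ev[OF _ refl], rule eventually_mono[OF eventually_clamp01[OF assms(2)]])
     (metis assms(1,3) clamp01_mem(1) mem_Sigma_iff)

lemma pd2_cong:
  assumes "\<And>p. p \<in> unit_square \<Longrightarrow> A p = B p" and "t \<in> {0<..<1}" "x \<in> {0..1}"
  shows "pd2 A (x, t) = pd2 B (x, t)"
  using pd1_cong[of "flip A" "flip B" t x] assms by (auto simp: pd1_flip)

lemma star_prod_eq: "x \<in> {0..1} \<Longrightarrow> y \<in> {0..1} \<Longrightarrow>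
    star_prod A B (x, y) = (\<integral>t. pd2 A (x, t) * pd1 B (t, y) \<partial>U01)"
  by (simp add: star_prod_def LBINT_01)

lemma star_prod_outside: "p \<notin> unit_square \<Longrightarrow> star_prod A B p = undefined"
  by (simp add: star_prod_def)

lemma star_prod_cong:
  assumes "\<And>p. p \<in> unit_square \<Longrightarrow> A p = A' p" "\<And>p. p \<in> unit_square \<Longrightarrow> B p = B' p"
  shows "star_prod A B = star_prod A' B'"
proof
  fix p :: "real \<times> real"
  obtain x y where p: "p = (x, y)" by (cases p)
  show "star_prod A B p = star_prod A' B' p"
  proof (cases "p \<in> unit_square")
    case True
    then show ?thesis unfolding p using pd1_cong[OF assms(2)] pd2_cong[OF assms(1)]
      by (auto simp: star_prod_eq space_U01 intro!: Bochner_Integration.integral_cong)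
  qed (simp add: star_prod_outside)
qed

lemma star_prod_flip: "flip (star_prod A B) = star_prod (flip B) (flip A)"
proof
  fix p :: "real \<times> real"
  obtain x y where p: "p = (x, y)" by (cases p)
  show "flip (star_prod A B) p = star_prod (flip B) (flip A) p"
  proof (cases "p \<in> unit_square")
    case True
    then show ?thesis unfolding p
      by (auto simp: star_prod_eq pd1_flip pd2_flip mult.commute)
  next
    case False
    then show ?thesis unfolding p by (auto simp: star_prod_outside)
  qed
qed

lemma copulasI:
  assumes "C \<in> extensional unit_square"
    and "\<And>u. u \<in> {0..1} \<Longrightarrow> C (u, 0) = 0 \<and> C (u, 1) = u"
    and "\<And>v. v \<in> {0..1} \<Longrightarrow> C (0, v) = 0 \<and> C (1, v) = v"
    and "\<And>x u y v. x \<in> {0..1} \<Longrightarrow> u \<in> {0..1} \<Longrightarrow> y \<in> {0..1} \<Longrightarrow> v \<in> {0..1} \<Longrightarrow> x \<le> u \<Longrightarrow> y \<le> v \<Longrightarrow>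
        C (u, v) - C (u, y) - C (x, v) + C (x, y) \<ge> 0"
  shows "C \<in> copulas"
proof -
  have "C (u, v) \<in> {0..1}" if "u \<in> {0..1}" "v \<in> {0..1}" for u v
    using assms(4)[of 0 u 0 v] assms(4)[of 0 u v 1] assms(2)[of u] assms(3)[of 0] assms(3)[of v] assms(3)[of 1] that
    by auto
  then have "C \<in> unit_square \<rightarrow>\<^sub>E {0..1}"
    using assms(1) by (auto simp: PiE_def)
  then show ?thesis using assms unfolding copulas_def by blast
qed

context
  fixes C assumes C: "C \<in> copulas"
begin

lemma copula_extensional: "p \<notin> unit_square \<Longrightarrow> C p = undefined"
proof -
  assume "p \<notin> unit_square"
  moreover have "C \<in> unit_square \<rightarrow>\<^sub>E {0..1}" using C unfolding copulas_def by blast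
  ultimately show ?thesis by (rule PiE_arb[rotated])
qed

lemma copula_margins:
  assumes "u \<in> {0..1}"
  shows "C (u, 0) = 0" "C (u, 1) = u" "C (0, u) = 0" "C (1, u) = u"
  using C assms unfolding copulas_def by blast+

lemma copula_2_increasing: "x \<in> {0..1} \<Longrightarrow> u \<in> {0..1} \<Longrightarrow> y \<in> {0..1} \<Longrightarrow> v \<in> {0..1} \<Longrightarrow> x \<le> u \<Longrightarrow> y \<le> v \<Longrightarrow>
    C (u, v) - C (u, y) - C (x, v) + C (x, y) \<ge> 0"
  using C unfolding copulas_def by blast

lemma copula_mono1: "x \<in> {0..1} \<Longrightarrow> u \<in> {0..1} \<Longrightarrow> y \<in> {0..1} \<Longrightarrow> x \<le> u \<Longrightarrow> C (x, y) \<le> C (u, y)"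
  using copula_2_increasing[of x u 0 y] copula_margins(1)[of x] copula_margins(1)[of u] by auto

lemma flip_copula: "flip C \<in> copulas"
proof (rule copulasI)
  show "flip C \<in> extensional unit_square"
    unfolding extensional_def by (auto simp: copula_extensional)
qed (use copula_margins copula_2_increasing in \<open>auto simp: algebra_simps\<close>)

lemma copula_lip1:
  assumes "x \<in> {0..1}" "u \<in> {0..1}" "y \<in> {0..1}"
  shows "\<bar>C (u, y) - C (x, y)\<bar> \<le> \<bar>u - x\<bar>"
proof -
  have *: "0 \<le> C (u, y) - C (x, y) \<and> C (u, y) - C (x, y) \<le> u - x"
    if "x \<in> {0..1}" "u \<in> {0..1}" "x \<le> u" for x u
    using copula_2_increasing[of x u y 1] copula_mono1[of x u y] copula_margins(2)[of x] copula_margins(2)[of u] that assms(3)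
    by auto
  show ?thesis using *[of x u] *[of u x] assms by (cases "x \<le> u") auto
qed

end

lemma copula_square_lipschitz:
  assumes C: "C \<in> copulas" shows "square_lipschitz 1 C"
  unfolding square_lipschitz_def
proof (intro ballI)
  fix x x' y y' :: real assume *: "x \<in> {0..1}" "x' \<in> {0..1}" "y \<in> {0..1}" "y' \<in> {0..1}"
  then show "\<bar>C (x, y) - C (x', y')\<bar> \<le> 1 * (\<bar>x - x'\<bar> + \<bar>y - y'\<bar>)"
    using copula_lip1[OF C, of x' x y] copula_lip1[OF flip_copula[OF C], of y' y x'] by auto
qed

lemmas copula_pd1_bounded_measurable = pd1_bounded_measurable[OF copula_square_lipschitz]
lemmas copula_pd1_differentiable = pd1_differentiable[OF copula_square_lipschitz]

lemma copula_pd1_FTC: "C \<in> copulas \<Longrightarrow> y \<in> {0..1} \<Longrightarrow> x \<in> {0..1} \<Longrightarrow>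
    (\<integral>t. indicator {..x} t * pd1 C (t, y) \<partial>U01) = C (x, y)"
  using pd1_FTC[OF copula_square_lipschitz, of C y x] copula_margins(3)[of C y] by simp

lemma integral_U01_indicator_atMost_1: "(\<integral>t. indicator {..1} t * f t \<partial>U01) = (\<integral>t. f t \<partial>U01)" for f :: "real \<Rightarrow> real"
  by (rule Bochner_Integration.integral_cong) (auto simp: space_U01)

lemma copula_pd1_integral: "C \<in> copulas \<Longrightarrow> y \<in> {0..1} \<Longrightarrow> (\<integral>t. pd1 C (t, y) \<partial>U01) = y"
  using copula_pd1_FTC[of C y 1] copula_margins(4)[of C y] by (simp add: integral_U01_indicator_atMost_1)

lemma copula_pd2_bounded_measurable:
  "C \<in> copulas \<Longrightarrow> x \<in> {0..1} \<Longrightarrow> bounded_measurable (\<lambda>t. pd2 C (x, t))"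
  using copula_pd1_bounded_measurable[OF flip_copula] by (simp add: pd1_flip)

lemma deriv_nonneg_of_mono:
  fixes F :: "real \<Rightarrow> real"
  assumes "\<And>x u. x \<in> {0..1} \<Longrightarrow> u \<in> {0..1} \<Longrightarrow> x \<le> u \<Longrightarrow> F x \<le> F u"
    and t: "t \<in> {0<..<1}" and d: "F differentiable at t"
  shows "0 \<le> deriv F t"
proof -
  have "((\<lambda>h. (F (t + h) - F t) / h) \<longlongrightarrow> deriv F t) (at 0)"
    using d by (simp add: DERIV_deriv_iff_real_differentiable DERIV_def[symmetric])
  moreover have "\<forall>\<^sub>F h in at 0. 0 \<le> (F (t + h) - F t) / h"
    unfolding eventually_at
  proof (intro exI[of _ "min t (1 - t)"] conjI ballI impI)
    fix h :: real assume h: "h \<noteq> 0 \<and> dist h 0 < min t (1 - t)"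
    then show "0 \<le> (F (t + h) - F t) / h"
      using assms(1)[of t "t + h"] assms(1)[of "t + h" t] t
      by (cases "h > 0") (auto simp: dist_real_def abs_less_iff zero_le_divide_iff)
  qed (use t in auto)
  ultimately show ?thesis by (intro tendsto_lowerbound) auto
qed

text \<open>By 2-increasingness the difference of two horizontal sections is increasing, so its derivative is
  nonnegative.\<close>

lemma copula_pd1_mono:
  assumes C: "C \<in> copulas" and "y \<in> {0..1}" "v \<in> {0..1}" "y \<le> v"
  shows "AE t in U01. pd1 C (t, y) \<le> pd1 C (t, v)"
  using copula_pd1_differentiable[OF C assms(2)] copula_pd1_differentiable[OF C assms(3)] AE_space[of U01]
proof eventually_elim
  case (elim t)
  let ?F = "\<lambda>s. C (s, v) - C (s, y)"
  have "0 \<le> deriv ?F t"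
  proof (rule deriv_nonneg_of_mono)
    show "?F differentiable at t" using elim by (intro differentiable_diff)
    show "?F x \<le> ?F u" if "x \<in> {0..1}" "u \<in> {0..1}" "x \<le> u" for x u
      using copula_2_increasing[OF C that(1,2) assms(2,3) that(3) assms(4)] by simp
  qed (use elim in \<open>simp add: space_U01\<close>)
  also have "deriv ?F t = deriv (\<lambda>s. C (s, v)) t - deriv (\<lambda>s. C (s, y)) t"
    using elim by (intro deriv_diff) (auto simp: field_differentiable_def real_differentiable_def)
  finally show ?case by (simp add: pd1_def)
qed

lemma copula_pd1_range:
  assumes C: "C \<in> copulas" and "y \<in> {0..1}" "t \<in> {0<..<1}" "(\<lambda>s. C (s, y)) differentiable at t"
  shows "0 \<le> pd1 C (t, y)" "pd1 C (t, y) \<le> 1"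
proof -
  show "0 \<le> pd1 C (t, y)" unfolding pd1_def prod.case
    by (rule deriv_nonneg_of_mono) (use assms copula_mono1[OF C] in auto)
  have "\<bar>pd1 C (t, y)\<bar> \<le> 1" unfolding pd1_def prod.case
    by (rule deriv_bounded_by_lipschitz) (use assms copula_lip1[OF C] in auto)
  then show "pd1 C (t, y) \<le> 1" by simp
qed

lemma copula_pd1_AE_range:
  assumes C: "C \<in> copulas" and "y \<in> {0..1}"
  shows "AE t in U01. 0 \<le> pd1 C (t, y) \<and> pd1 C (t, y) \<le> 1"
  using copula_pd1_differentiable[OF assms] AE_space[of U01]
  by eventually_elim (auto simp: space_U01 intro!: copula_pd1_range[OF assms])

lemma copula_pd1_edges:
  assumes "C \<in> copulas" "t \<in> {0<..<1}" shows "pd1 C (t, 1) = 1" "pd1 C (t, 0) = 0"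
proof -
  have "pd1 C (t, 1) = deriv (\<lambda>s. s) t" unfolding pd1_def prod.case
    by (rule deriv_cong_ev[OF eventually_mono[OF eventually_clamp01[OF assms(2)]] refl])
       (metis assms(1) clamp01_mem(1) copula_margins(2))
  then show "pd1 C (t, 1) = 1" by simp
  have "pd1 C (t, 0) = deriv (\<lambda>s. 0) t" unfolding pd1_def prod.case
    by (rule deriv_cong_ev[OF eventually_mono[OF eventually_clamp01[OF assms(2)]] refl])
       (metis assms(1) clamp01_mem(1) copula_margins(1))
  then show "pd1 C (t, 0) = 0" by simp
qed

section \<open>The star product\<close>

text \<open>The Markov operator of a copula sends \<open>a\<close> to the derivative of its primitive \<open>s
  \<mapsto> \<integral> a(t) \<partial>\<^sub>1 B(t, s) dt\<close>. For random variables with copula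
  \<open>B\<close> this is the conditional expectation of \<open>a\<close> applied to the first variable, given
  the second one.\<close>

definition markov_primitive :: "(real \<times> real \<Rightarrow> real) \<Rightarrow> (real \<Rightarrow> real) \<Rightarrow> real \<Rightarrow> real" where
  "markov_primitive B a s = (\<integral>t. a t * pd1 B (t, s) \<partial>U01)"

definition markov :: "(real \<times> real \<Rightarrow> real) \<Rightarrow> (real \<Rightarrow> real) \<Rightarrow> real \<Rightarrow> real" where
  "markov B a = deriv (markov_primitive B a)"

lemma copula_pd1_product_integrable:
  "B \<in> copulas \<Longrightarrow> bounded_measurable a \<Longrightarrow> s \<in> {0..1} \<Longrightarrow> integrable U01 (\<lambda>t. a t * pd1 B (t, s))"
  by (intro bounded_measurable_integrable bounded_measurable_mult copula_pd1_bounded_measurable)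

context
  fixes B assumes B: "B \<in> copulas"
begin

lemma markov_primitive_add:
  "bounded_measurable a \<Longrightarrow> bounded_measurable b \<Longrightarrow> s \<in> {0..1} \<Longrightarrow>
    markov_primitive B (\<lambda>t. a t + b t) s = markov_primitive B a s + markov_primitive B b s"
  unfolding markov_primitive_def distrib_right
  by (intro Bochner_Integration.integral_add copula_pd1_product_integrable[OF B])

lemma markov_primitive_scale: "markov_primitive B (\<lambda>t. k * a t) s = k * markov_primitive B a s"
  by (simp add: markov_primitive_def mult.assoc)

text \<open>The increment of \<open>\<partial>\<^sub>1 B(t, _)\<close> is nonnegative and integrates to \<open>s
  - s'\<close>, so a bound on \<open>a\<close> is a Lipschitz constant for the primitive.\<close>

lemma markov_primitive_lipschitz_ordered:
  assumes a: "bounded_measurable a" and K: "\<And>t. t \<in> {0<..<1} \<Longrightarrow> \<bar>a t\<bar> \<le> K"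
    and s: "s' \<in> {0..1}" "s \<in> {0..1}" "s' \<le> s"
  shows "\<bar>markov_primitive B a s - markov_primitive B a s'\<bar> \<le> K * (s - s')"
proof -
  let ?p = "\<lambda>t. pd1 B (t, s) - pd1 B (t, s')"
  have p: "bounded_measurable ?p"
    by (intro bounded_measurable_diff copula_pd1_bounded_measurable B s)
  have int: "integrable U01 ?p" "integrable U01 (\<lambda>t. a t * ?p t)"
    by (intro bounded_measurable_integrable bounded_measurable_mult p a)+
  have "markov_primitive B a s - markov_primitive B a s' = (\<integral>t. a t * ?p t \<partial>U01)"
    unfolding markov_primitive_def right_diff_distrib
    by (intro Bochner_Integration.integral_diff[symmetric] copula_pd1_product_integrable[OF B] a s)
  also have "\<bar>\<dots>\<bar> \<le> (\<integral>t. \<bar>a t * ?p t\<bar> \<partial>U01)" by (rule integral_abs_bound)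
  also have "\<dots> \<le> (\<integral>t. K * ?p t \<partial>U01)"
  proof (rule integral_mono_AE)
    show "AE t in U01. \<bar>a t * ?p t\<bar> \<le> K * ?p t"
      using copula_pd1_mono[OF B s] AE_space[of U01]
    proof eventually_elim
      case (elim t)
      then have "\<bar>a t\<bar> * ?p t \<le> K * ?p t" using K[of t] by (intro mult_right_mono) (auto simp: space_U01)
      then show ?case using elim by (simp add: abs_mult)
    qed
  qed (use int in auto)
  also have "\<dots> = K * (s - s')"
    using copula_pd1_integral[OF B s(1)] copula_pd1_integral[OF B s(2)]
      bounded_measurable_integrable[OF copula_pd1_bounded_measurable[OF B s(1)]]
      bounded_measurable_integrable[OF copula_pd1_bounded_measurable[OF B s(2)]]
    by simp
  finally show ?thesis .
qed

lemma markov_primitive_lipschitz: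
  assumes a: "bounded_measurable a" and K: "\<And>t. t \<in> {0<..<1} \<Longrightarrow> \<bar>a t\<bar> \<le> K"
    and s: "s \<in> {0..1}" "s' \<in> {0..1}"
  shows "\<bar>markov_primitive B a s - markov_primitive B a s'\<bar> \<le> K * \<bar>s - s'\<bar>"
  using markov_primitive_lipschitz_ordered[OF a K s(2) s(1)] markov_primitive_lipschitz_ordered[OF a K s(1) s(2)]
  by (cases "s' \<le> s") (auto simp: abs_minus_commute)

lemma markov_differentiable:
  assumes "bounded_measurable a"
  shows "AE s in U01. markov_primitive B a differentiable at s"
proof -
  obtain K where K: "\<And>t. t \<in> {0<..<1} \<Longrightarrow> \<bar>a t\<bar> \<le> K" using assms by (rule bounded_measurableE) (rule that, blast)
  show ?thesis by (rule lipschitz_unit_interval(1)[OF markov_primitive_lipschitz[OF assms K]])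
qed

lemma markov_AE_bound:
  assumes "bounded_measurable a" and K: "\<And>t. t \<in> {0<..<1} \<Longrightarrow> \<bar>a t\<bar> \<le> K"
  shows "AE s in U01. \<bar>markov B a s\<bar> \<le> K"
  using markov_differentiable[OF assms(1)] AE_space[of U01]
  by eventually_elim
     (auto simp: markov_def space_U01 intro!: deriv_bounded_by_lipschitz markov_primitive_lipschitz[OF assms])

lemma markov_bounded_measurable:
  assumes a: "bounded_measurable a"
  shows "bounded_measurable (markov B a)"
proof -
  obtain K where K: "\<And>t. t \<in> {0<..<1} \<Longrightarrow> \<bar>a t\<bar> \<le> K" using a by (rule bounded_measurableE) (rule that, blast)
  note lip = markov_primitive_lipschitz[OF a K]
  show ?thesis
  proof (rule bounded_measurableI)
    show "markov B a \<in> borel_measurable U01"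
      unfolding markov_def by (rule lipschitz_unit_interval(2)[OF lip])
    fix s :: real assume "s \<in> {0<..<1}"
    then show "\<bar>markov B a s\<bar> \<le> max K \<bar>deriv_default\<bar>"
      using deriv_bounded_by_lipschitz[OF lip, of s] deriv_not_differentiable[of "markov_primitive B a" s]
      unfolding markov_def by (cases "markov_primitive B a differentiable at s") (fastforce simp: le_max_iff_disj)+
  qed
qed

lemma markov_FTC:
  assumes a: "bounded_measurable a" and y: "y \<in> {0..1}"
  shows "(\<integral>s. indicator {..y} s * markov B a s \<partial>U01) = markov_primitive B a y"
proof -
  obtain K where K: "\<And>t. t \<in> {0<..<1} \<Longrightarrow> \<bar>a t\<bar> \<le> K" using a by (rule bounded_measurableE) (rule that, blast)
  have "markov_primitive B a 0 = (\<integral>t. 0 \<partial>U01)"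
    unfolding markov_primitive_def
    by (rule Bochner_Integration.integral_cong) (auto simp: space_U01 copula_pd1_edges[OF B])
  then show ?thesis
    unfolding markov_def using lipschitz_unit_interval(3)[OF markov_primitive_lipschitz[OF a K] y] by simp
qed

lemma markov_add:
  assumes a: "bounded_measurable a" and b: "bounded_measurable b"
  shows "AE s in U01. markov B (\<lambda>t. a t + b t) s = markov B a s + markov B b s"
proof (rule AE_eq_if_primitives_eq)
  show "bounded_measurable (markov B (\<lambda>t. a t + b t))" "bounded_measurable (\<lambda>s. markov B a s + markov B b s)"
    by (intro markov_bounded_measurable bounded_measurable_add a b)+
  fix y :: real assume y: "y \<in> {0..1}"
  have int: "integrable U01 (\<lambda>s. indicator {..y} s * markov B c s)" if "bounded_measurable c" for c
    by (intro bounded_measurable_integrable bounded_measurable_mult bounded_measurable_indicator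
        markov_bounded_measurable that) simp
  show "(\<integral>s. indicator {..y} s * markov B (\<lambda>t. a t + b t) s \<partial>U01) =
      (\<integral>s. indicator {..y} s * (markov B a s + markov B b s) \<partial>U01)"
    unfolding distrib_left
    by (simp add: int a b markov_FTC[OF _ y] bounded_measurable_add markov_primitive_add[OF a b y])
qed

lemma markov_scale:
  assumes a: "bounded_measurable a"
  shows "AE s in U01. markov B (\<lambda>t. k * a t) s = k * markov B a s"
proof (rule AE_eq_if_primitives_eq)
  show "bounded_measurable (markov B (\<lambda>t. k * a t))" "bounded_measurable (\<lambda>s. k * markov B a s)"
    by (intro markov_bounded_measurable bounded_measurable_cmult a)+
  fix y :: real assume y: "y \<in> {0..1}"
  show "(\<integral>s. indicator {..y} s * markov B (\<lambda>t. k * a t) s \<partial>U01) =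
      (\<integral>s. indicator {..y} s * (k * markov B a s) \<partial>U01)"
    by (simp add: markov_FTC[OF _ y] a bounded_measurable_cmult markov_primitive_scale mult.left_commute)
qed

lemma markov_nonneg:
  assumes a: "bounded_measurable a" and nonneg: "\<And>t. 0 \<le> a t"
  shows "AE s in U01. 0 \<le> markov B a s"
  using markov_differentiable[OF a] AE_space[of U01]
proof eventually_elim
  case (elim s)
  show ?case unfolding markov_def
  proof (rule deriv_nonneg_of_mono)
    show "markov_primitive B a differentiable at s" "s \<in> {0<..<1}" using elim by (auto simp: space_U01)
    fix x u :: real assume xu: "x \<in> {0..1}" "u \<in> {0..1}" "x \<le> u"
    show "markov_primitive B a x \<le> markov_primitive B a u"
      unfolding markov_primitive_def
      by (rule integral_mono_AE[OF copula_pd1_product_integrable[OF B a xu(1)] copula_pd1_product_integrable[OF B a xu(2)]],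
          rule AE_mp[OF copula_pd1_mono[OF B xu]]) (auto intro: mult_left_mono nonneg)
  qed
qed

lemma markov_integral:
  assumes a: "bounded_measurable a"
  shows "(\<integral>s. markov B a s \<partial>U01) = (\<integral>t. a t \<partial>U01)"
proof -
  have "(\<integral>s. markov B a s \<partial>U01) = markov_primitive B a 1"
    using markov_FTC[OF a, of 1] by (simp add: integral_U01_indicator_atMost_1)
  also have "\<dots> = (\<integral>t. a t \<partial>U01)"
    unfolding markov_primitive_def
    by (rule Bochner_Integration.integral_cong) (auto simp: space_U01 copula_pd1_edges[OF B])
  finally show ?thesis .
qed

text \<open>A positive operator that preserves integrals contracts the \<open>L\<^sup>1\<close> norm; apply this
  to the positive and negative parts.\<close>

lemma markov_L1_contraction:
  assumes a: "bounded_measurable a"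
  shows "(\<integral>s. \<bar>markov B a s\<bar> \<partial>U01) \<le> (\<integral>t. \<bar>a t\<bar> \<partial>U01)"
proof -
  let ?p = "\<lambda>t. max 0 (a t)" and ?n = "\<lambda>t. max 0 (- 1 * a t)"
  have p: "bounded_measurable ?p" and n: "bounded_measurable ?n"
    by (intro bounded_measurable_pos_part bounded_measurable_cmult a)+
  have a_eq: "a = (\<lambda>t. ?p t + - 1 * ?n t)" by auto
  have int: "integrable U01 (markov B c)" "integrable U01 c" if "bounded_measurable c" for c
    using that by (auto intro: bounded_measurable_integrable markov_bounded_measurable)
  have pos: "AE s in U01. 0 \<le> markov B ?p s" "AE s in U01. 0 \<le> markov B ?n s"
    by (rule markov_nonneg[OF p], simp, rule markov_nonneg[OF n], simp)
  have "AE s in U01. markov B (\<lambda>t. ?p t + - 1 * ?n t) s = markov B ?p s + markov B (\<lambda>t. - 1 * ?n t) s"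
    by (intro markov_add p bounded_measurable_cmult n)
  then have "AE s in U01. \<bar>markov B a s\<bar> \<le> markov B ?p s + markov B ?n s"
    unfolding a_eq[symmetric]
    using markov_scale[OF n, of "- 1"] pos
    by eventually_elim auto
  then have "(\<integral>s. \<bar>markov B a s\<bar> \<partial>U01) \<le> (\<integral>s. markov B ?p s + markov B ?n s \<partial>U01)"
    by (intro integral_mono_AE) (use int p n a in auto)
  also have "\<dots> = (\<integral>t. ?p t + ?n t \<partial>U01)"
    using int[OF p] int[OF n] by (simp add: markov_integral[OF p] markov_integral[OF n, simplified])
  also have "(\<lambda>t. ?p t + ?n t) = (\<lambda>t. \<bar>a t\<bar>)" by auto
  finally show ?thesis .
qed

end

lemma bounded_measurable_integral_cong:
  "bounded_measurable f \<Longrightarrow> bounded_measurable g \<Longrightarrow> AE t in U01. f t = g t \<Longrightarrow>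
    (\<integral>t. f t \<partial>U01) = (\<integral>t. g t \<partial>U01)"
  by (rule integral_cong_AE) (simp_all add: bounded_measurable_measurable)

lemma integral_mult_bound:
  assumes c: "bounded_measurable c" and d: "bounded_measurable d" and K: "AE t in U01. \<bar>d t\<bar> \<le> K"
  shows "\<bar>\<integral>t. c t * d t \<partial>U01\<bar> \<le> K * (\<integral>t. \<bar>c t\<bar> \<partial>U01)"
proof -
  have "\<bar>\<integral>t. c t * d t \<partial>U01\<bar> \<le> (\<integral>t. \<bar>c t * d t\<bar> \<partial>U01)" by (rule integral_abs_bound)
  also have "\<dots> \<le> (\<integral>t. K * \<bar>c t\<bar> \<partial>U01)"
  proof (rule integral_mono_AE)
    show "integrable U01 (\<lambda>t. \<bar>c t * d t\<bar>)" "integrable U01 (\<lambda>t. K * \<bar>c t\<bar>)"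
      using c d by (auto intro!: bounded_measurable_integrable bounded_measurable_abs bounded_measurable_mult bounded_measurable_cmult)
    show "AE t in U01. \<bar>c t * d t\<bar> \<le> K * \<bar>c t\<bar>"
      using K
    proof eventually_elim
      case (elim t)
      then have "\<bar>c t\<bar> * \<bar>d t\<bar> \<le> \<bar>c t\<bar> * K" by (intro mult_left_mono) auto
      then show ?case by (simp add: abs_mult mult.commute)
    qed
  qed
  finally show ?thesis by simp
qed

text \<open>The operators of \<open>B\<close> and of its transpose are adjoint. For \<open>c\<close> the
  indicator of an initial interval this is the fundamental theorem of calculus, since the transposed operator
  then gives \<open>\<partial>\<^sub>1 B(_, y)\<close>; both sides are bounded by a multiple of the
  \<open>L\<^sup>1\<close> norm of \<open>c\<close>, the right-hand side by the contraction property, so the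
  extension principle applies.\<close>

lemma markov_duality:
  assumes B: "B \<in> copulas" and a: "bounded_measurable a" and c: "bounded_measurable c"
  shows "(\<integral>s. c s * markov B a s \<partial>U01) = (\<integral>t. markov (flip B) c t * a t \<partial>U01)"
proof -
  note B' = flip_copula[OF B]
  obtain K where K: "\<And>t. t \<in> {0<..<1} \<Longrightarrow> \<bar>a t\<bar> \<le> K" using a by (rule bounded_measurableE) (rule that, blast)
  have Ta: "bounded_measurable (markov B a)" by (rule markov_bounded_measurable[OF B a])
  have Tc: "bounded_measurable (markov (flip B) c)" if "bounded_measurable c" for c
    by (rule markov_bounded_measurable[OF B' that])
  have int: "integrable U01 (\<lambda>s. c s * markov B a s)" "integrable U01 (\<lambda>t. markov (flip B) c t * a t)"
    if "bounded_measurable c" for c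
    by (intro bounded_measurable_integrable bounded_measurable_mult that Ta Tc a)+
  define \<Theta> where "\<Theta> c = (\<integral>s. c s * markov B a s \<partial>U01) - (\<integral>t. markov (flip B) c t * a t \<partial>U01)" for c
  have "\<Theta> c = 0"
  proof (rule L1_bounded_functional_eq_0[where \<Theta> = \<Theta> and K = "K + K"])
    fix c d :: "real \<Rightarrow> real" and k assume c: "bounded_measurable c"
    show "\<Theta> (\<lambda>t. c t + d t) = \<Theta> c + \<Theta> d" if d: "bounded_measurable d"
    proof -
      have "(\<integral>t. markov (flip B) (\<lambda>t. c t + d t) t * a t \<partial>U01) =
          (\<integral>t. markov (flip B) c t * a t + markov (flip B) d t * a t \<partial>U01)"
      proof (rule bounded_measurable_integral_cong)
        show "AE t in U01. markov (flip B) (\<lambda>t. c t + d t) t * a t =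
            markov (flip B) c t * a t + markov (flip B) d t * a t"
          using markov_add[OF B' c d] by eventually_elim (simp add: distrib_right)
      qed (intro bounded_measurable_add bounded_measurable_mult Tc c d a)+
      then show ?thesis unfolding \<Theta>_def distrib_right using int[OF c] int[OF d] by simp
    qed
    show "\<Theta> (\<lambda>t. k * c t) = k * \<Theta> c"
    proof -
      have "(\<integral>t. markov (flip B) (\<lambda>t. k * c t) t * a t \<partial>U01) = (\<integral>t. k * (markov (flip B) c t * a t) \<partial>U01)"
      proof (rule bounded_measurable_integral_cong)
        show "AE t in U01. markov (flip B) (\<lambda>t. k * c t) t * a t = k * (markov (flip B) c t * a t)"
          using markov_scale[OF B' c, where k = k] by eventually_elim (simp add: mult.assoc)
      qed (intro bounded_measurable_mult bounded_measurable_const Tc c a)+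
      then show ?thesis unfolding \<Theta>_def mult.assoc by (simp add: right_diff_distrib)
    qed
    have "\<bar>\<integral>s. c s * markov B a s \<partial>U01\<bar> \<le> K * (\<integral>t. \<bar>c t\<bar> \<partial>U01)"
      by (rule integral_mult_bound[OF c Ta markov_AE_bound[OF B a K]])
    moreover have "\<bar>\<integral>t. markov (flip B) c t * a t \<partial>U01\<bar> \<le> K * (\<integral>t. \<bar>markov (flip B) c t\<bar> \<partial>U01)"
      by (rule integral_mult_bound[OF Tc[OF c] a]) (rule AE_I2, simp add: K space_U01)
    moreover have "K * (\<integral>t. \<bar>markov (flip B) c t\<bar> \<partial>U01) \<le> K * (\<integral>t. \<bar>c t\<bar> \<partial>U01)"
      using K[of "1/2"] by (intro mult_left_mono markov_L1_contraction[OF B' c]) auto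
    ultimately show "\<bar>\<Theta> c\<bar> \<le> (K + K) * (\<integral>t. \<bar>c t\<bar> \<partial>U01)" unfolding \<Theta>_def distrib_right by linarith
  next
    fix y :: real assume y: "y \<in> {0..1}"
    have "markov (flip B) (indicator {..y}) t = pd1 B (t, y)" if t: "t \<in> {0<..<1}" for t
    proof -
      have "markov_primitive (flip B) (indicator {..y}) t = B (t, y)" if "t \<in> {0..1}" for t
        using copula_pd1_FTC[OF B' that y] by (simp add: markov_primitive_def)
      then show ?thesis unfolding markov_def pd1_def prod.case
        by (intro deriv_cong_ev[OF eventually_mono[OF eventually_clamp01[OF t]] refl])
           (metis clamp01_mem(1))
    qed
    then have "(\<integral>t. markov (flip B) (indicator {..y}) t * a t \<partial>U01) = markov_primitive B a y"
      unfolding markov_primitive_def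
      by (intro Bochner_Integration.integral_cong) (auto simp: space_U01)
    then show "\<Theta> (indicator {..y}) = 0"
      unfolding \<Theta>_def by (simp add: markov_FTC[OF B a y])
  qed (rule c)
  then show ?thesis by (simp add: \<Theta>_def)
qed

lemma star_prod_eq_markov_primitive:
  "x \<in> {0..1} \<Longrightarrow> y \<in> {0..1} \<Longrightarrow> star_prod A B (x, y) = markov_primitive B (\<lambda>t. pd2 A (x, t)) y"
  by (simp add: star_prod_eq markov_primitive_def)

lemma pd2_star_prod:
  assumes "x \<in> {0..1}" "s \<in> {0<..<1}"
  shows "pd2 (star_prod A B) (x, s) = markov B (\<lambda>t. pd2 A (x, t)) s"
proof -
  have "\<forall>\<^sub>F t in nhds s. star_prod A B (x, t) = markov_primitive B (\<lambda>t. pd2 A (x, t)) t"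
    using eventually_clamp01[OF assms(2)]
  proof eventually_elim
    case (elim t)
    then have "t \<in> {0..1}" by (metis clamp01_mem(1))
    then show ?case by (rule star_prod_eq_markov_primitive[OF assms(1)])
  qed
  then have "deriv (\<lambda>t. star_prod A B (x, t)) s = deriv (markov_primitive B (\<lambda>t. pd2 A (x, t))) s"
    by (rule deriv_cong_ev) simp
  then show ?thesis by (simp add: pd2_def[of "star_prod A B"] markov_def)
qed

lemma pd1_star_prod:
  assumes "y \<in> {0..1}" "t \<in> {0<..<1}"
  shows "pd1 (star_prod A B) (t, y) = markov (flip A) (\<lambda>s. pd1 B (s, y)) t"
proof -
  have "pd1 (star_prod A B) (t, y) = pd2 (flip (star_prod A B)) (y, t)" by (simp add: pd2_flip)
  also have "\<dots> = markov (flip A) (\<lambda>s. pd2 (flip B) (y, s)) t"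
    unfolding star_prod_flip by (rule pd2_star_prod[OF assms])
  finally show ?thesis by (simp add: pd2_flip)
qed

text \<open>The derivatives of the inner products are values of Markov operators, and moving the operator of the
  middle factor from one side to the other is exactly duality.\<close>

lemma star_prod_assoc:
  assumes A: "A \<in> copulas" and B: "B \<in> copulas" and C: "C \<in> copulas"
  shows "star_prod (star_prod A B) C = star_prod A (star_prod B C)"
proof
  fix p :: "real \<times> real"
  obtain x y where p: "p = (x, y)" by (cases p)
  show "star_prod (star_prod A B) C p = star_prod A (star_prod B C) p"
  proof (cases "p \<in> unit_square")
    case True
    then have x: "x \<in> {0..1}" and y: "y \<in> {0..1}" by (auto simp: p)
    have "star_prod (star_prod A B) C (x, y) = (\<integral>s. pd1 C (s, y) * markov B (\<lambda>t. pd2 A (x, t)) s \<partial>U01)"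
      unfolding star_prod_eq[OF x y]
      by (rule Bochner_Integration.integral_cong) (auto simp: space_U01 pd2_star_prod[OF x])
    also have "\<dots> = (\<integral>t. markov (flip B) (\<lambda>s. pd1 C (s, y)) t * pd2 A (x, t) \<partial>U01)"
      by (intro markov_duality B copula_pd2_bounded_measurable copula_pd1_bounded_measurable A C x y)
    also have "\<dots> = star_prod A (star_prod B C) (x, y)"
      unfolding star_prod_eq[OF x y]
      by (rule Bochner_Integration.integral_cong) (auto simp: space_U01 pd1_star_prod[OF y])
    finally show ?thesis by (simp add: p)
  qed (simp add: star_prod_outside)
qed

lemma star_prod_margins:
  assumes A: "A \<in> copulas" and B: "B \<in> copulas" and x: "x \<in> {0..1}"
  shows "star_prod A B (x, 0) = 0" "star_prod A B (x, 1) = x"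
proof -
  have "star_prod A B (x, 0) = (\<integral>t. 0 \<partial>U01)"
    using x by (simp only: star_prod_eq atLeastAtMost_iff order.refl zero_le_one)
      (rule Bochner_Integration.integral_cong, auto simp: space_U01 copula_pd1_edges[OF B])
  then show "star_prod A B (x, 0) = 0" by simp
  have "star_prod A B (x, 1) = (\<integral>t. pd1 (flip A) (t, x) \<partial>U01)"
    using x by (simp only: star_prod_eq atLeastAtMost_iff order.refl zero_le_one)
      (rule Bochner_Integration.integral_cong, auto simp: space_U01 copula_pd1_edges[OF B] pd1_flip)
  then show "star_prod A B (x, 1) = x"
    by (simp add: copula_pd1_integral[OF flip_copula[OF A] x])
qed

text \<open>The increment of the product over a rectangle is the integral of a product of two increments of
  slopes, both nonnegative.\<close>

lemma star_prod_copula: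
  assumes A: "A \<in> copulas" and B: "B \<in> copulas"
  shows "star_prod A B \<in> copulas"
proof (rule copulasI)
  show "star_prod A B \<in> extensional unit_square" by (simp add: star_prod_def)
  show "star_prod A B (u, 0) = 0 \<and> star_prod A B (u, 1) = u" if "u \<in> {0..1}" for u
    using star_prod_margins[OF A B that] by simp
  show "star_prod A B (0, v) = 0 \<and> star_prod A B (1, v) = v" if "v \<in> {0..1}" for v
    using star_prod_margins[OF flip_copula[OF B] flip_copula[OF A] that]
    by (simp add: star_prod_flip[symmetric])
  fix x u y v :: real
  assume *: "x \<in> {0..1}" "u \<in> {0..1}" "y \<in> {0..1}" "v \<in> {0..1}" "x \<le> u" "y \<le> v"
  have int: "integrable U01 (\<lambda>t. pd2 A (x, t) * pd1 B (t, y))" if "x \<in> {0..1}" "y \<in> {0..1}" for x y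
    by (intro bounded_measurable_integrable bounded_measurable_mult copula_pd2_bounded_measurable
        copula_pd1_bounded_measurable A B that)
  have "star_prod A B (u, v) - star_prod A B (u, y) - star_prod A B (x, v) + star_prod A B (x, y) =
      (\<integral>t. (pd2 A (u, t) - pd2 A (x, t)) * (pd1 B (t, v) - pd1 B (t, y)) \<partial>U01)"
    using * by (simp add: star_prod_eq left_diff_distrib right_diff_distrib int)
  also have "\<dots> \<ge> 0"
  proof (rule integral_nonneg_AE)
    show "AE t in U01. 0 \<le> (pd2 A (u, t) - pd2 A (x, t)) * (pd1 B (t, v) - pd1 B (t, y))"
      using copula_pd1_mono[OF B *(3,4,6)] copula_pd1_mono[OF flip_copula[OF A] *(1,2,5)]
      by eventually_elim (simp add: pd1_flip)
  qed
  finally show "star_prod A B (u, v) - star_prod A B (u, y) - star_prod A B (x, v) + star_prod A B (x, y) \<ge> 0" .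
qed

lemma flip_min_copula: "flip min_copula = min_copula"
  by (auto simp: fun_eq_iff min_copula_def min.commute restrict_def)

lemma min_copula_copula: "min_copula \<in> copulas"
  by (rule copulasI) (auto simp: min_copula_def)

text \<open>The slope \<open>\<partial>\<^sub>1 M(_, y)\<close> is the indicator of the initial interval up to
  \<open>y\<close>.\<close>

lemma star_prod_min_right:
  assumes A: "A \<in> copulas" shows "star_prod A min_copula = A"
proof
  fix p :: "real \<times> real"
  obtain x y where p: "p = (x, y)" by (cases p)
  show "star_prod A min_copula p = A p"
  proof (cases "p \<in> unit_square")
    case True
    then have x: "x \<in> {0..1}" and y: "y \<in> {0..1}" by (auto simp: p)
    have "AE t in U01. indicator {..y} t = pd1 min_copula (t, y)"
    proof (rule AE_eq_if_primitives_eq)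
      fix u :: real assume u: "u \<in> {0..1}"
      have "(\<integral>t. indicator {..u} t * indicator {..y} t \<partial>U01) = (\<integral>t. indicator {..min u y} t * (indicator {..1} t :: real) \<partial>U01)"
        by (rule Bochner_Integration.integral_cong) (auto simp: space_U01 split: split_indicator)
      also have "\<dots> = (\<integral>t. indicator {..min u y} t * pd1 min_copula (t, 1) \<partial>U01)"
        by (rule Bochner_Integration.integral_cong)
           (auto simp: space_U01 copula_pd1_edges[OF min_copula_copula] split: split_indicator)
      also have "\<dots> = (\<integral>t. indicator {..u} t * pd1 min_copula (t, y) \<partial>U01)"
      proof -
        have "min u y \<in> {0..1}" using u y by (auto simp: min_def)
        then have "(\<integral>t. indicator {..min u y} t * pd1 min_copula (t, 1) \<partial>U01) = min_copula (min u y, 1)"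
          by (intro copula_pd1_FTC min_copula_copula) auto
        moreover have "(\<integral>t. indicator {..u} t * pd1 min_copula (t, y) \<partial>U01) = min_copula (u, y)"
          by (intro copula_pd1_FTC min_copula_copula u y)
        ultimately show ?thesis using u y by (auto simp: min_copula_def min_def)
      qed
      finally show "(\<integral>t. indicator {..u} t * indicator {..y} t \<partial>U01) = (\<integral>t. indicator {..u} t * pd1 min_copula (t, y) \<partial>U01)" .
    qed (auto intro!: bounded_measurable_indicator copula_pd1_bounded_measurable min_copula_copula simp: y[simplified])
    then have ae: "AE t in U01. pd1 (flip A) (t, x) * pd1 min_copula (t, y) = indicator {..y} t * pd1 (flip A) (t, x)"
      by eventually_elim simp
    have "star_prod A min_copula (x, y) = (\<integral>t. indicator {..y} t * pd1 (flip A) (t, x) \<partial>U01)"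
      unfolding star_prod_eq[OF x y] pd1_flip[symmetric]
      by (rule bounded_measurable_integral_cong[OF _ _ ae])
         (intro bounded_measurable_mult copula_pd1_bounded_measurable bounded_measurable_indicator
          min_copula_copula flip_copula A x y; simp)+
    also have "\<dots> = A (x, y)" using copula_pd1_FTC[OF flip_copula[OF A] x y] by simp
    finally show ?thesis by (simp add: p)
  qed (simp add: star_prod_outside copula_extensional[OF A])
qed

lemma star_prod_min_left:
  assumes A: "A \<in> copulas" shows "star_prod min_copula A = A"
proof -
  have "flip (star_prod (flip A) min_copula) = A" by (simp add: star_prod_min_right flip_copula A)
  then show ?thesis by (simp add: star_prod_flip flip_min_copula)
qed

lemma inv_copulas_copula: "U \<in> inv_copulas \<Longrightarrow> U \<in> copulas"
  by (simp add: inv_copulas_def)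

lemma min_copula_inv: "min_copula \<in> inv_copulas"
  unfolding inv_copulas_def using star_prod_min_left min_copula_copula by blast

lemma flip_inv_copula:
  assumes "U \<in> inv_copulas" shows "flip U \<in> inv_copulas"
proof -
  obtain D where "U \<in> copulas" "D \<in> copulas" "star_prod U D = min_copula" "star_prod D U = min_copula"
    using assms unfolding inv_copulas_def by blast
  then show ?thesis unfolding inv_copulas_def
    by (auto intro!: flip_copula bexI[of _ "flip D"] simp: star_prod_flip[symmetric] flip_min_copula)
qed

lemma star_prod_inv_copula:
  assumes "U \<in> inv_copulas" "V \<in> inv_copulas" shows "star_prod U V \<in> inv_copulas"
proof -
  obtain D where U: "U \<in> copulas" and D: "D \<in> copulas" "star_prod U D = min_copula" "star_prod D U = min_copula"
    using assms(1) unfolding inv_copulas_def by blast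
  obtain E where V: "V \<in> copulas" and E: "E \<in> copulas" "star_prod V E = min_copula" "star_prod E V = min_copula"
    using assms(2) unfolding inv_copulas_def by blast
  have VED: "star_prod V (star_prod E D) = D"
    using star_prod_assoc[OF V E(1) D(1)] E(2) star_prod_min_left[OF D(1)] by simp
  have DUV: "star_prod D (star_prod U V) = V"
    using star_prod_assoc[OF D(1) U V] D(3) star_prod_min_left[OF V] by simp
  have "star_prod (star_prod U V) (star_prod E D) = min_copula"
    by (simp add: star_prod_assoc U V D(1) E(1) star_prod_copula VED D(2))
  moreover have "star_prod (star_prod E D) (star_prod U V) = min_copula"
    by (simp add: star_prod_assoc U V D(1) E(1) star_prod_copula DUV E(3))
  ultimately show ?thesis unfolding inv_copulas_def
    by (auto intro!: star_prod_copula U V D E bexI[of _ "star_prod E D"])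
qed

section \<open>The Sobolev norm on differences of copulas\<close>

lemma pd2_eq_pd1_flip: "pd2 A z = pd1 (flip A) (snd z, fst z)"
  by (cases z) (simp add: pd1_flip)

context
  fixes K A assumes A: "square_lipschitz K A"
begin

lemma pd2_joint: "pd2 A \<in> borel_measurable (U01 \<Otimes>\<^sub>M U01)"
proof -
  have "(\<lambda>z. pd1 (flip A) (snd z, fst z)) \<in> borel_measurable (U01 \<Otimes>\<^sub>M U01)"
    by (intro measurable_compose[OF _ pd1_joint(1)[OF square_lipschitz_flip[OF A]]] measurable_Pair
        measurable_fst measurable_snd)
  then show ?thesis by (simp add: pd2_eq_pd1_flip[abs_def])
qed

lemma pd_integrable:
  shows "integrable (U01 \<Otimes>\<^sub>M U01) (\<lambda>z. (pd1 A z)\<^sup>2)"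
    and "integrable (U01 \<Otimes>\<^sub>M U01) (\<lambda>z. (pd2 A z)\<^sup>2)"
proof -
  have *: "(pd1 B z)\<^sup>2 \<le> (max K \<bar>deriv_default\<bar>)\<^sup>2"
    if "square_lipschitz K B" "fst z \<in> {0<..<1}" "snd z \<in> {0<..<1}" for B z
  proof -
    have "\<bar>pd1 B z\<bar> \<le> max K \<bar>deriv_default\<bar>"
      using pd1_bound[OF that(1,2), of "snd z"] that(3) by simp
    then have "\<bar>pd1 B z\<bar>\<^sup>2 \<le> (max K \<bar>deriv_default\<bar>)\<^sup>2" by (intro power_mono) auto
    then show ?thesis by simp
  qed
  show "integrable (U01 \<Otimes>\<^sub>M U01) (\<lambda>z. (pd1 A z)\<^sup>2)"
    by (rule U01_pair.integrable_const_bound[of _ "(max K \<bar>deriv_default\<bar>)\<^sup>2"])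
       (auto intro!: AE_I2 * A pd1_joint[OF A] borel_measurable_power simp: space_pair_measure space_U01)
  show "integrable (U01 \<Otimes>\<^sub>M U01) (\<lambda>z. (pd2 A z)\<^sup>2)"
  proof (rule U01_pair.integrable_const_bound[of _ "(max K \<bar>deriv_default\<bar>)\<^sup>2"])
    show "(\<lambda>z. (pd2 A z)\<^sup>2) \<in> borel_measurable (U01 \<Otimes>\<^sub>M U01)"
      by (intro borel_measurable_power pd2_joint)
    show "AE z in U01 \<Otimes>\<^sub>M U01. norm ((pd2 A z)\<^sup>2) \<le> (max K \<bar>deriv_default\<bar>)\<^sup>2"
      unfolding pd2_eq_pd1_flip
      by (rule AE_I2) (auto intro!: * square_lipschitz_flip A simp: space_pair_measure space_U01)
  qed
qed

lemma sobolev_norm_eq: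
  "sobolev_norm A = sqrt (\<integral>z. (pd1 A z)\<^sup>2 + (pd2 A z)\<^sup>2 \<partial>(U01 \<Otimes>\<^sub>M U01))"
proof -
  have "integrable (U01 \<Otimes>\<^sub>M U01) (\<lambda>z. (pd1 A z)\<^sup>2 + (pd2 A z)\<^sup>2)"
    by (intro Bochner_Integration.integrable_add pd_integrable)
  then have "integrable (U01 \<Otimes>\<^sub>M U01) (\<lambda>(x, y). (pd1 A (x, y))\<^sup>2 + (pd2 A (x, y))\<^sup>2)"
    by (simp add: case_prod_beta')
  from U01_pair.integral_snd[OF this]
  show ?thesis unfolding sobolev_norm_def LBINT_01 by (simp add: case_prod_beta')
qed

end

lemma sobolev_norm_cong:
  assumes "\<And>p. p \<in> unit_square \<Longrightarrow> A p = B p"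
  shows "sobolev_norm A = sobolev_norm B"
proof -
  have "(\<integral>y. (\<integral>x. (pd1 A (x, y))\<^sup>2 + (pd2 A (x, y))\<^sup>2 \<partial>U01) \<partial>U01) =
      (\<integral>y. (\<integral>x. (pd1 B (x, y))\<^sup>2 + (pd2 B (x, y))\<^sup>2 \<partial>U01) \<partial>U01)"
  proof (rule Bochner_Integration.integral_cong[OF refl], rule Bochner_Integration.integral_cong[OF refl])
    fix x y :: real assume "y \<in> space U01" "x \<in> space U01"
    then show "(pd1 A (x, y))\<^sup>2 + (pd2 A (x, y))\<^sup>2 = (pd1 B (x, y))\<^sup>2 + (pd2 B (x, y))\<^sup>2"
      using pd1_cong[OF assms, where t = x and y = y] pd2_cong[OF assms, where t = y and x = x] by (simp add: space_U01)
  qed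
  then show ?thesis unfolding sobolev_norm_def LBINT_01 by simp
qed

text \<open>The dependence measure and its continuity only involve norms of differences of two copulas, so the
  Sobolev norm enters as a metric on copulas.\<close>

definition sobolev_dist :: "(real \<times> real \<Rightarrow> real) \<Rightarrow> (real \<times> real \<Rightarrow> real) \<Rightarrow> real" where
  "sobolev_dist P Q = sobolev_norm (\<lambda>p. P p - Q p)"

text \<open>One of the two summands of the squared Sobolev distance; the other one is obtained by
  transposition.\<close>

definition slope_energy :: "(real \<times> real \<Rightarrow> real) \<Rightarrow> (real \<times> real \<Rightarrow> real) \<Rightarrow> real" where
  "slope_energy P Q = (\<integral>z. (pd1 P z - pd1 Q z)\<^sup>2 \<partial>(U01 \<Otimes>\<^sub>M U01))"

lemma pd1_diff:
  fixes P Q :: "real \<times> real \<Rightarrow> real"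
  assumes "(\<lambda>s. P (s, y)) differentiable at t" "(\<lambda>s. Q (s, y)) differentiable at t"
  shows "pd1 (\<lambda>p. P p - Q p) (t, y) = pd1 P (t, y) - pd1 Q (t, y)"
  using assms unfolding pd1_def prod.case
  by (intro deriv_diff) (auto simp: field_differentiable_def real_differentiable_def)

context
  fixes P Q assumes P: "P \<in> copulas" and Q: "Q \<in> copulas"
begin

lemma copula_diff_lipschitz: "square_lipschitz 2 (\<lambda>p. P p - Q p)"
  using square_lipschitz_diff[OF copula_square_lipschitz[OF P] copula_square_lipschitz[OF Q]] by simp

lemma pd1_diff_AE:
  "AE z in U01 \<Otimes>\<^sub>M U01. pd1 (\<lambda>p. P p - Q p) z = pd1 P z - pd1 Q z"
  using pd1_joint(2)[OF copula_square_lipschitz[OF P]] pd1_joint(2)[OF copula_square_lipschitz[OF Q]]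
proof eventually_elim
  case (elim z)
  then show ?case using pd1_diff[of P "snd z" "fst z" Q] by simp
qed

lemma slope_energy_integrable: "integrable (U01 \<Otimes>\<^sub>M U01) (\<lambda>z. (pd1 P z - pd1 Q z)\<^sup>2)"
proof (rule integrable_cong_AE_imp[OF pd_integrable(1)[OF copula_diff_lipschitz]])
  show "(\<lambda>z. (pd1 P z - pd1 Q z)\<^sup>2) \<in> borel_measurable (U01 \<Otimes>\<^sub>M U01)"
    by (intro borel_measurable_power borel_measurable_diff pd1_joint[OF copula_square_lipschitz] P Q)
  show "AE z in U01 \<Otimes>\<^sub>M U01. (pd1 (\<lambda>p. P p - Q p) z)\<^sup>2 = (pd1 P z - pd1 Q z)\<^sup>2"
    using pd1_diff_AE by eventually_elim simp
qed

lemma slope_energy_nonneg: "0 \<le> slope_energy P Q"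
  unfolding slope_energy_def by simp

lemma pd1_diff_energy: "(\<integral>z. (pd1 (\<lambda>p. P p - Q p) z)\<^sup>2 \<partial>(U01 \<Otimes>\<^sub>M U01)) = slope_energy P Q"
  unfolding slope_energy_def
  by (rule integral_cong_AE)
     (use pd1_diff_AE in \<open>auto intro!: borel_measurable_power borel_measurable_diff
        pd1_joint(1)[OF copula_square_lipschitz] pd1_joint(1)[OF copula_diff_lipschitz] P Q
        elim: eventually_mono\<close>)

end

lemma sobolev_dist_eq:
  assumes P: "P \<in> copulas" and Q: "Q \<in> copulas"
  shows "sobolev_dist P Q = sqrt (slope_energy P Q + slope_energy (flip P) (flip Q))"
proof -
  let ?D = "\<lambda>p. P p - Q p"
  note lip = copula_diff_lipschitz[OF P Q]
  have "(\<integral>z. (pd2 ?D z)\<^sup>2 \<partial>(U01 \<Otimes>\<^sub>M U01)) = (\<integral>(x, y). (pd1 (flip ?D) (y, x))\<^sup>2 \<partial>(U01 \<Otimes>\<^sub>M U01))"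
    by (simp add: pd2_eq_pd1_flip case_prod_beta')
  also have "\<dots> = (\<integral>z. (pd1 (flip ?D) z)\<^sup>2 \<partial>(U01 \<Otimes>\<^sub>M U01))"
    by (intro U01_pair.integral_product_swap borel_measurable_power pd1_joint(1)[OF square_lipschitz_flip[OF lip]])
  also have "flip ?D = (\<lambda>p. flip P p - flip Q p)" by (auto simp: flip_def)
  also have "(\<integral>z. (pd1 (\<lambda>p. flip P p - flip Q p) z)\<^sup>2 \<partial>(U01 \<Otimes>\<^sub>M U01)) = slope_energy (flip P) (flip Q)"
    by (rule pd1_diff_energy[OF flip_copula[OF P] flip_copula[OF Q]])
  finally show ?thesis
    unfolding sobolev_dist_def sobolev_norm_eq[OF lip]
    by (simp add: pd1_diff_energy[OF P Q] pd_integrable[OF lip])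
qed

lemma sobolev_dist_nonneg: "P \<in> copulas \<Longrightarrow> Q \<in> copulas \<Longrightarrow> 0 \<le> sobolev_dist P Q"
  by (simp add: sobolev_dist_eq slope_energy_nonneg flip_copula)

lemma sobolev_dist_flip:
  "P \<in> copulas \<Longrightarrow> Q \<in> copulas \<Longrightarrow> sobolev_dist (flip P) (flip Q) = sobolev_dist P Q"
  by (simp add: sobolev_dist_eq flip_copula add.commute)

lemma sobolev_dist_commute: "P \<in> copulas \<Longrightarrow> Q \<in> copulas \<Longrightarrow> sobolev_dist P Q = sobolev_dist Q P"
  by (simp add: sobolev_dist_eq slope_energy_def power2_commute)

text \<open>Minkowski's inequality is reduced to a family of weighted estimates that can be integrated: the
  optimal weights are the two norms, and adding \<open>e / 2\<close> avoids dividing by 0.\<close>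

lemma sqrt_triangle_from_weights:
  fixes f g h :: real
  assumes fg: "0 \<le> f" "0 \<le> g"
    and w: "\<And>a b. a > 0 \<Longrightarrow> b > 0 \<Longrightarrow> h \<le> (a + b) * (f / a + g / b)"
  shows "sqrt h \<le> sqrt f + sqrt g"
proof (rule field_le_epsilon)
  fix e :: real assume e: "e > 0"
  define a b where "a = sqrt f + e / 2" and "b = sqrt g + e / 2"
  have ab: "a > 0" "b > 0" using fg e by (auto simp: a_def b_def add_nonneg_pos)
  have "f / a \<le> a"
  proof -
    have "f = (sqrt f)\<^sup>2" using fg by simp
    also have "\<dots> \<le> a\<^sup>2" using fg e by (intro power_mono) (auto simp: a_def)
    finally show ?thesis using ab by (simp add: divide_le_eq power2_eq_square)
  qed
  moreover have "g / b \<le> b"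
  proof -
    have "g = (sqrt g)\<^sup>2" using fg by simp
    also have "\<dots> \<le> b\<^sup>2" using fg e by (intro power_mono) (auto simp: b_def)
    finally show ?thesis using ab by (simp add: divide_le_eq power2_eq_square)
  qed
  ultimately have "(a + b) * (f / a + g / b) \<le> (a + b) * (a + b)"
    using ab by (intro mult_left_mono) auto
  then have "h \<le> (a + b)\<^sup>2" using w[OF ab] by (simp add: power2_eq_square)
  then have "sqrt h \<le> a + b" using ab by (intro real_le_lsqrt) auto
  then show "sqrt h \<le> sqrt f + sqrt g + e" by (simp add: a_def b_def)
qed

lemma square_add_weighted:
  fixes x y a b :: real
  assumes "a > 0" "b > 0"
  shows "(x + y)\<^sup>2 \<le> (a + b) * (x\<^sup>2 / a + y\<^sup>2 / b)"
proof -
  have "(a + b) * (x\<^sup>2 / a + y\<^sup>2 / b) - (x + y)\<^sup>2 = (b * x - a * y)\<^sup>2 / (a * b)"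
    using assms by (simp add: field_simps power2_eq_square)
  moreover have "\<dots> \<ge> 0" using assms by simp
  ultimately show ?thesis by linarith
qed

lemma slope_energy_weighted:
  assumes P: "P \<in> copulas" and Q: "Q \<in> copulas" and R: "R \<in> copulas" and ab: "a > 0" "b > 0"
  shows "slope_energy P R \<le> (a + b) * (slope_energy P Q / a + slope_energy Q R / b)"
proof -
  let ?f = "\<lambda>z. (pd1 P z - pd1 Q z)\<^sup>2" and ?g = "\<lambda>z. (pd1 Q z - pd1 R z)\<^sup>2"
  have "slope_energy P R \<le> (\<integral>z. (a + b) * (?f z / a + ?g z / b) \<partial>(U01 \<Otimes>\<^sub>M U01))"
    unfolding slope_energy_def
  proof (rule integral_mono)
    show "integrable (U01 \<Otimes>\<^sub>M U01) (\<lambda>z. (a + b) * (?f z / a + ?g z / b))"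
      using slope_energy_integrable[OF P Q] slope_energy_integrable[OF Q R] by simp
    show "(pd1 P z - pd1 R z)\<^sup>2 \<le> (a + b) * (?f z / a + ?g z / b)" for z
      using square_add_weighted[OF ab, of "pd1 P z - pd1 Q z" "pd1 Q z - pd1 R z"] by simp
  qed (rule slope_energy_integrable[OF P R])
  then show ?thesis
    using slope_energy_integrable[OF P Q] slope_energy_integrable[OF Q R] by (simp add: slope_energy_def)
qed

text \<open>Pointwise, a square of a sum has the weighted bound for every choice of positive weights, and this
  bound survives integration.\<close>

lemma sobolev_dist_triangle:
  assumes P: "P \<in> copulas" and Q: "Q \<in> copulas" and R: "R \<in> copulas"
  shows "sobolev_dist P R \<le> sobolev_dist P Q + sobolev_dist Q R"
  unfolding sobolev_dist_eq[OF P R] sobolev_dist_eq[OF P Q] sobolev_dist_eq[OF Q R]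
proof (rule sqrt_triangle_from_weights)
  fix a b :: real assume ab: "a > 0" "b > 0"
  show "slope_energy P R + slope_energy (flip P) (flip R) \<le>
      (a + b) * ((slope_energy P Q + slope_energy (flip P) (flip Q)) / a +
        (slope_energy Q R + slope_energy (flip Q) (flip R)) / b)"
    using slope_energy_weighted[OF P Q R ab]
      slope_energy_weighted[OF flip_copula[OF P] flip_copula[OF Q] flip_copula[OF R] ab]
    by (simp add: add_divide_distrib distrib_left)
qed (use P Q R in \<open>simp_all add: slope_energy_nonneg flip_copula\<close>)

lemma slope_energy_le_1:
  assumes P: "P \<in> copulas" and Q: "Q \<in> copulas"
  shows "slope_energy P Q \<le> 1"
proof -
  have "slope_energy P Q \<le> (\<integral>z. 1 \<partial>(U01 \<Otimes>\<^sub>M U01))"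
    unfolding slope_energy_def
  proof (rule integral_mono_AE[OF slope_energy_integrable[OF P Q]])
    show "AE z in U01 \<Otimes>\<^sub>M U01. (pd1 P z - pd1 Q z)\<^sup>2 \<le> 1"
      using pd1_joint(2)[OF copula_square_lipschitz[OF P]] pd1_joint(2)[OF copula_square_lipschitz[OF Q]]
        AE_space[of "U01 \<Otimes>\<^sub>M U01"]
    proof eventually_elim
      case (elim z)
      then have z: "snd z \<in> {0..1}" "fst z \<in> {0<..<1}" by (auto simp: space_pair_measure space_U01)
      have "\<bar>pd1 P z - pd1 Q z\<bar> \<le> 1"
        using copula_pd1_range[OF P z elim(1)] copula_pd1_range[OF Q z elim(2)] by simp
      then show ?case by (simp add: abs_square_le_1)
    qed
  qed simp
  then show ?thesis by (simp add: U01_pair.prob_space)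
qed

lemma sobolev_dist_bound:
  "P \<in> copulas \<Longrightarrow> Q \<in> copulas \<Longrightarrow> sobolev_dist P Q \<le> sqrt 2"
  using slope_energy_le_1[of P Q] slope_energy_le_1[of "flip P" "flip Q"]
  by (simp add: sobolev_dist_eq flip_copula)

lemma prod_copula_copula: "prod_copula \<in> copulas"
proof (rule copulasI)
  fix x u y v :: real
  assume *: "x \<in> {0..1}" "u \<in> {0..1}" "y \<in> {0..1}" "v \<in> {0..1}" "x \<le> u" "y \<le> v"
  have "0 \<le> (u - x) * (v - y)" using * by simp
  then show "prod_copula (u, v) - prod_copula (u, y) - prod_copula (x, v) + prod_copula (x, y) \<ge> 0"
    using * by (simp add: prod_copula_def algebra_simps)
qed (auto simp: prod_copula_def)

lemma flip_prod_copula: "flip prod_copula = prod_copula"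
  by (auto simp: fun_eq_iff prod_copula_def mult.commute restrict_def)

lemma pd1_prod_copula:
  assumes "t \<in> {0<..<1}" "y \<in> {0..1}" shows "pd1 prod_copula (t, y) = y"
proof -
  have "pd1 prod_copula (t, y) = pd1 (\<lambda>(x, y). x * y) (t, y)"
    by (rule pd1_cong) (use assms in \<open>auto simp: prod_copula_def\<close>)
  also have "\<dots> = y" unfolding pd1_def by (simp add: mult.commute)
  finally show ?thesis .
qed

lemma star_prod_prod_copula_right:
  assumes A: "A \<in> copulas" shows "star_prod A prod_copula = prod_copula"
proof
  fix p :: "real \<times> real"
  obtain x y where p: "p = (x, y)" by (cases p)
  show "star_prod A prod_copula p = prod_copula p"
  proof (cases "p \<in> unit_square")
    case True
    then have x: "x \<in> {0..1}" and y: "y \<in> {0..1}" by (auto simp: p)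
    have "star_prod A prod_copula (x, y) = (\<integral>t. pd1 (flip A) (t, x) * y \<partial>U01)"
      unfolding star_prod_eq[OF x y]
      by (rule Bochner_Integration.integral_cong) (auto simp: space_U01 pd1_prod_copula[OF _ y] pd1_flip)
    then show ?thesis using x y
      by (simp add: p copula_pd1_integral[OF flip_copula[OF A] x]) (simp add: prod_copula_def)
  qed (simp add: star_prod_outside copula_extensional[OF prod_copula_copula])
qed

lemma star_prod_prod_copula_left:
  assumes A: "A \<in> copulas" shows "star_prod prod_copula A = prod_copula"
proof -
  have "flip (star_prod (flip A) prod_copula) = prod_copula"
    by (simp add: star_prod_prod_copula_right flip_copula A flip_prod_copula)
  then show ?thesis by (simp add: star_prod_flip flip_prod_copula)
qed

lemma integral_U01_power: "(\<integral>t. t ^ n \<partial>U01) = 1 / Suc n"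
proof -
  have "(\<integral>t. t ^ n \<partial>U01) = (\<integral>t. t ^ n * indicator {0..1} t \<partial>lborel)"
  proof -
    have "AE t in lborel. t \<notin> {0, 1::real}"
      by (intro AE_not_in countable_imp_null_set_lborel) auto
    then have "AE t::real in lborel. indicator {0<..<1} t * t ^ n = t ^ n * indicator {0..1} t"
      by eventually_elim (auto split: split_indicator)
    then show ?thesis unfolding integral_U01
      by (intro integral_cong_AE) auto
  qed
  also have "\<dots> = 1 ^ Suc n / Suc n - 0 ^ Suc n / Suc n"
  proof (rule integral_FTC_Icc_real)
    fix t :: real
    show "DERIV (\<lambda>t. t ^ Suc n / real (Suc n)) t :> t ^ n"
      using DERIV_cdivide[OF DERIV_pow[of "Suc n" t], of "real (Suc n)"] by simp
  qed auto
  finally show ?thesis by simp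
qed

lemma power_bounded_measurable: "bounded_measurable (\<lambda>t. t ^ n)"
  by (rule bounded_measurableI[of _ 1]) (auto intro!: measurable_U01 simp: power_le_one_iff abs_le_iff power_le_one)

lemma slope_energy_prod_eq:
  assumes C: "C \<in> copulas"
  shows "integrable U01 (\<lambda>y. \<integral>t. (pd1 C (t, y) - y)\<^sup>2 \<partial>U01)"
    and "slope_energy C prod_copula = (\<integral>y. (\<integral>t. (pd1 C (t, y) - y)\<^sup>2 \<partial>U01) \<partial>U01)"
proof -
  let ?f = "\<lambda>t y. (pd1 C (t, y) - pd1 prod_copula (t, y))\<^sup>2"
  have int: "integrable (U01 \<Otimes>\<^sub>M U01) (\<lambda>(t, y). ?f t y)"
    using slope_energy_integrable[OF C prod_copula_copula] by (simp add: case_prod_beta')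
  have eq: "(\<integral>t. ?f t y \<partial>U01) = (\<integral>t. (pd1 C (t, y) - y)\<^sup>2 \<partial>U01)" if "y \<in> space U01" for y
    using that by (intro Bochner_Integration.integral_cong) (auto simp: space_U01 pd1_prod_copula)
  show "integrable U01 (\<lambda>y. \<integral>t. (pd1 C (t, y) - y)\<^sup>2 \<partial>U01)"
    using U01_pair.integrable_snd[OF int] by (rule Bochner_Integration.integrable_cong[THEN iffD1, rotated 2]) (simp_all add: eq)
  have "slope_energy C prod_copula = (\<integral>y. (\<integral>t. ?f t y \<partial>U01) \<partial>U01)"
    using U01_pair.integral_snd[OF int] by (simp add: slope_energy_def case_prod_beta')
  also have "\<dots> = (\<integral>y. (\<integral>t. (pd1 C (t, y) - y)\<^sup>2 \<partial>U01) \<partial>U01)"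
    by (rule Bochner_Integration.integral_cong) (simp_all add: eq)
  finally show "slope_energy C prod_copula = (\<integral>y. (\<integral>t. (pd1 C (t, y) - y)\<^sup>2 \<partial>U01) \<partial>U01)" .
qed

text \<open>A slope lies between 0 and 1, so its square is at most itself, and its integral over a horizontal
  line at height \<open>y\<close> is \<open>y\<close>; the bound is the integral of \<open>y -
  y\<^sup>2\<close>.\<close>

lemma slope_energy_prod_upper:
  assumes C: "C \<in> copulas"
  shows "slope_energy C prod_copula \<le> 1 / 6"
proof -
  have "(\<integral>t. (pd1 C (t, y) - y)\<^sup>2 \<partial>U01) \<le> y - y\<^sup>2" if "y \<in> space U01" for y
  proof -
    have y: "y \<in> {0..1}" using that by (simp add: space_U01)
    note bm = copula_pd1_bounded_measurable[OF C y]
    have "(\<integral>t. (pd1 C (t, y) - y)\<^sup>2 \<partial>U01) \<le> (\<integral>t. (1 - 2 * y) * pd1 C (t, y) + y\<^sup>2 \<partial>U01)"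
    proof (rule integral_mono_AE)
      show "integrable U01 (\<lambda>t. (pd1 C (t, y) - y)\<^sup>2)" unfolding power2_eq_square
        by (intro bounded_measurable_integrable bounded_measurable_mult bounded_measurable_diff bm bounded_measurable_const)
      show "integrable U01 (\<lambda>t. (1 - 2 * y) * pd1 C (t, y) + y\<^sup>2)"
        using bounded_measurable_integrable[OF bm] by simp
      show "AE t in U01. (pd1 C (t, y) - y)\<^sup>2 \<le> (1 - 2 * y) * pd1 C (t, y) + y\<^sup>2"
        using copula_pd1_AE_range[OF C y]
      proof eventually_elim
        case (elim t)
        then have "pd1 C (t, y) * pd1 C (t, y) \<le> 1 * pd1 C (t, y)" by (intro mult_right_mono) auto
        then show ?case by (simp add: power2_eq_square algebra_simps)
      qed
    qed
    also have "\<dots> = y - y\<^sup>2"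
      using bounded_measurable_integrable[OF bm] copula_pd1_integral[OF C y]
      by (simp add: U01.prob_space power2_eq_square algebra_simps)
    finally show ?thesis .
  qed
  then have "slope_energy C prod_copula \<le> (\<integral>y. y ^ 1 - y ^ 2 \<partial>U01)"
    unfolding slope_energy_prod_eq(2)[OF C]
    by (intro integral_mono slope_energy_prod_eq(1) C bounded_measurable_integrable
        bounded_measurable_diff power_bounded_measurable) simp
  also have "\<dots> = 1 / 6"
    using bounded_measurable_integrable[OF power_bounded_measurable, of 1] bounded_measurable_integrable[OF power_bounded_measurable, of 2]
    by (subst Bochner_Integration.integral_diff) (simp_all only: integral_U01_power, simp)
  finally show ?thesis .
qed

text \<open>A lower bound from the diagonal alone: with \<open>p\<^sup>2 \<ge> 2 p - 1\<close> for \<open>t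
  \<le> y\<close> and \<open>p\<^sup>2 \<ge> 0\<close> for \<open>t > y\<close>, the integral of the squared
  slope along the line at height \<open>y\<close> is at least \<open>2 C(y, y) - y\<close>.\<close>

lemma slope_energy_prod_lower:
  assumes C: "C \<in> copulas" and diag: "\<And>y. y \<in> {0<..<1} \<Longrightarrow> y - e \<le> C (y, y)"
  shows "1 / 6 - 2 * e \<le> slope_energy C prod_copula"
proof -
  have "y - 2 * e - y\<^sup>2 \<le> (\<integral>t. (pd1 C (t, y) - y)\<^sup>2 \<partial>U01)" if "y \<in> space U01" for y
  proof -
    have y: "y \<in> {0..1}" "y \<in> {0<..<1}" using that by (auto simp: space_U01)
    note bm = copula_pd1_bounded_measurable[OF C y(1)]
    have ind: "bounded_measurable (indicator {..y})" by (simp add: bounded_measurable_indicator)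
    have ind_int: "(\<integral>t. indicator {..y} t \<partial>U01) = y"
    proof -
      have "(\<integral>t. indicator {..y} t * pd1 prod_copula (t, 1) \<partial>U01) = prod_copula (y, 1)"
        using y by (intro copula_pd1_FTC prod_copula_copula) auto
      moreover have "(\<integral>t. indicator {..y} t * pd1 prod_copula (t, 1) \<partial>U01) = (\<integral>t. indicator {..y} t \<partial>U01)"
        by (rule Bochner_Integration.integral_cong) (auto simp: space_U01 pd1_prod_copula)
      ultimately show ?thesis using y by (simp add: prod_copula_def)
    qed
    let ?p = "\<lambda>t. pd1 C (t, y)"
    have int: "integrable U01 ?p" "integrable U01 (indicator {..y} :: real \<Rightarrow> real)" "integrable U01 (\<lambda>t. indicator {..y} t * ?p t)"
      by (intro bounded_measurable_integrable bounded_measurable_mult ind bm)+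
    have "y - 2 * e - y\<^sup>2 \<le> 2 * C (y, y) - y - y\<^sup>2" using diag[OF y(2)] by simp
    also have "\<dots> = (\<integral>t. 2 * (indicator {..y} t * ?p t) - indicator {..y} t - 2 * y * ?p t + y\<^sup>2 \<partial>U01)"
      using int copula_pd1_FTC[OF C y(1) y(1)] copula_pd1_integral[OF C y(1)] ind_int
      by (simp add: U01.prob_space power2_eq_square)
    also have "\<dots> \<le> (\<integral>t. (?p t - y)\<^sup>2 \<partial>U01)"
    proof (rule integral_mono)
      show "integrable U01 (\<lambda>t. 2 * (indicator {..y} t * ?p t) - indicator {..y} t - 2 * y * ?p t + y\<^sup>2)"
        using int by simp
      show "integrable U01 (\<lambda>t. (?p t - y)\<^sup>2)" unfolding power2_eq_square
        by (intro bounded_measurable_integrable bounded_measurable_mult bounded_measurable_diff bm bounded_measurable_const)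
      fix t
      have "0 \<le> (?p t - 1)\<^sup>2" "0 \<le> (?p t)\<^sup>2" by simp_all
      then show "2 * (indicator {..y} t * ?p t) - indicator {..y} t - 2 * y * ?p t + y\<^sup>2 \<le> (?p t - y)\<^sup>2"
        by (cases "t \<le> y") (simp_all add: power2_eq_square algebra_simps)
    qed
    finally show ?thesis .
  qed
  then have "(\<integral>y. y ^ 1 - 2 * e - y ^ 2 \<partial>U01) \<le> slope_energy C prod_copula"
    unfolding slope_energy_prod_eq(2)[OF C]
    by (intro integral_mono slope_energy_prod_eq(1) C bounded_measurable_integrable
        bounded_measurable_diff power_bounded_measurable bounded_measurable_const) simp
  moreover have "(\<integral>y. y ^ 1 - 2 * e - y ^ 2 \<partial>U01) = 1 / 6 - 2 * e"
    using bounded_measurable_integrable[OF power_bounded_measurable, of 1]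
      bounded_measurable_integrable[OF power_bounded_measurable, of 2]
      integral_U01_power[of 1] integral_U01_power[of 2]
    by (simp add: U01.prob_space)
  ultimately show ?thesis by simp
qed

lemma sobolev_dist_prod_upper:
  assumes C: "C \<in> copulas" shows "sobolev_dist C prod_copula \<le> sqrt (1 / 3)"
  using slope_energy_prod_upper[OF C] slope_energy_prod_upper[OF flip_copula[OF C]]
  by (simp add: sobolev_dist_eq[OF C prod_copula_copula] flip_prod_copula)

lemma sobolev_dist_prod_lower:
  assumes C: "C \<in> copulas" and diag: "\<And>y. y \<in> {0<..<1} \<Longrightarrow> y - e \<le> C (y, y)"
  shows "sqrt (1 / 3 - 4 * e) \<le> sobolev_dist C prod_copula"
  using slope_energy_prod_lower[OF C diag] slope_energy_prod_lower[OF flip_copula[OF C], of e] diag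
  by (simp add: sobolev_dist_eq[OF C prod_copula_copula] flip_prod_copula)

text \<open>Almost every horizontal section agrees with that of the product copula, because its slope does; by
  continuity every section does.\<close>

lemma sobolev_dist_prod_eq_0:
  assumes C: "C \<in> copulas" and zero: "sobolev_dist C prod_copula = 0"
  shows "C = prod_copula"
proof
  fix p :: "real \<times> real"
  obtain x y where p: "p = (x, y)" by (cases p)
  show "C p = prod_copula p"
  proof (cases "p \<in> unit_square")
    case True
    then have x: "x \<in> {0..1}" and y: "y \<in> {0..1}" by (auto simp: p)
    have "slope_energy C prod_copula = 0"
      using zero slope_energy_nonneg[OF C prod_copula_copula]
        slope_energy_nonneg[OF flip_copula[OF C] flip_copula[OF prod_copula_copula]]
      by (simp add: sobolev_dist_eq[OF C prod_copula_copula])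
    then have "AE u in U01. (\<integral>t. (pd1 C (t, u) - u)\<^sup>2 \<partial>U01) = 0"
      unfolding slope_energy_prod_eq(2)[OF C]
      by (subst (asm) integral_nonneg_eq_0_iff_AE[OF slope_energy_prod_eq(1)[OF C]]) auto
    then have "AE u in U01. C (x, u) = x * u"
      using AE_space[of U01]
    proof eventually_elim
      case (elim u)
      then have u: "u \<in> {0..1}" by (simp add: space_U01)
      note bm = copula_pd1_bounded_measurable[OF C u]
      have "integrable U01 (\<lambda>t. (pd1 C (t, u) - u)\<^sup>2)" unfolding power2_eq_square
        by (intro bounded_measurable_integrable bounded_measurable_mult bounded_measurable_diff bm bounded_measurable_const)
      then have "AE t in U01. (pd1 C (t, u) - u)\<^sup>2 = 0"
        using elim(1) by (subst (asm) integral_nonneg_eq_0_iff_AE) auto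
      then have ae: "AE t in U01. indicator {..x} t * pd1 C (t, u) = indicator {..x} t * pd1 prod_copula (t, u)"
        using AE_space[of U01] by eventually_elim (use u in \<open>simp add: space_U01 pd1_prod_copula\<close>)
      have "(\<integral>t. indicator {..x} t * pd1 C (t, u) \<partial>U01) = (\<integral>t. indicator {..x} t * pd1 prod_copula (t, u) \<partial>U01)"
        by (rule bounded_measurable_integral_cong[OF _ _ ae])
           (intro bounded_measurable_mult copula_pd1_bounded_measurable bounded_measurable_indicator
              prod_copula_copula C u; simp)+
      then show ?case using x u
        by (simp add: copula_pd1_FTC[OF C u x] copula_pd1_FTC[OF prod_copula_copula u x]) (simp add: prod_copula_def)
    qed
    then have "AE u in lebesgue. u \<in> {0<..<1} \<longrightarrow> u \<in> {u \<in> {0..1}. C (x, u) = x * u}"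
      unfolding AE_U01 AE_completion_iff by eventually_elim auto
    moreover have "closed {u \<in> {0..1}. C (x, u) = x * u}"
    proof -
      have "continuous_on {0..1} (\<lambda>u. C (x, u))"
        by (rule lipschitz_on_continuous_on[of 1])
           (use copula_lip1[OF flip_copula[OF C] _ _ x] in \<open>auto simp: lipschitz_on_def dist_real_def\<close>)
      then have "closed {u \<in> {0..1}. C (x, u) - x * u = 0}"
        by (intro continuous_closed_preimage_constant continuous_intros) auto
      then show ?thesis by simp
    qed
    ultimately have "C (x, u) = x * u" if "u \<in> {0<..<1}" for u
      using mem_closed_if_AE_lebesgue_open[of "{0<..<1}" "{u \<in> {0..1}. C (x, u) = x * u}" u] that by auto
    then have "C (x, y) = x * y"
      using y copula_margins(1,2)[OF C x] by (cases "y = 0 \<or> y = 1") (auto simp: less_le)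
    then show ?thesis using x y by (simp add: p prod_copula_def)
  qed (simp add: copula_extensional[OF prod_copula_copula] copula_extensional[OF C])
qed

section \<open>The star norm on differences of copulas\<close>

definition star_dist :: "(real \<times> real \<Rightarrow> real) \<Rightarrow> (real \<times> real \<Rightarrow> real) \<Rightarrow> real" where
  "star_dist P Q = star_norm (\<lambda>p. P p - Q p)"

lemma inv_conjugate_copula:
  "U \<in> inv_copulas \<Longrightarrow> V \<in> inv_copulas \<Longrightarrow> P \<in> copulas \<Longrightarrow> star_prod (star_prod U P) V \<in> copulas"
  by (simp add: star_prod_copula inv_copulas_copula)

text \<open>At points where only the difference of two sections is differentiable the slope of the difference is
  not the difference of the slopes, but such points form a null set.\<close>

lemma star_prod_diff_right:
  assumes U: "U \<in> copulas" and P: "P \<in> copulas" and Q: "Q \<in> copulas" and p: "p \<in> unit_square"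
  shows "star_prod U (\<lambda>p. P p - Q p) p = star_prod U P p - star_prod U Q p"
proof -
  obtain x y where xy: "p = (x, y)" by (cases p)
  then have x: "x \<in> {0..1}" and y: "y \<in> {0..1}" using p by auto
  note lip = copula_diff_lipschitz[OF P Q]
  have ae: "AE t in U01. pd2 U (x, t) * pd1 (\<lambda>p. P p - Q p) (t, y) =
      pd2 U (x, t) * pd1 P (t, y) - pd2 U (x, t) * pd1 Q (t, y)"
    using copula_pd1_differentiable[OF P y] copula_pd1_differentiable[OF Q y]
    by eventually_elim (simp add: pd1_diff right_diff_distrib)
  have bm: "bounded_measurable (\<lambda>t. pd2 U (x, t) * pd1 R (t, y))" if "R \<in> copulas" for R
    by (intro bounded_measurable_mult copula_pd2_bounded_measurable copula_pd1_bounded_measurable U that x y)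
  have "(\<integral>t. pd2 U (x, t) * pd1 (\<lambda>p. P p - Q p) (t, y) \<partial>U01) =
      (\<integral>t. pd2 U (x, t) * pd1 P (t, y) - pd2 U (x, t) * pd1 Q (t, y) \<partial>U01)"
    by (rule bounded_measurable_integral_cong[OF _ _ ae])
       (intro bounded_measurable_mult bounded_measurable_diff copula_pd2_bounded_measurable
        pd1_bounded_measurable[OF lip] copula_pd1_bounded_measurable U P Q x y)+
  then show ?thesis unfolding xy star_prod_eq[OF x y]
    by (simp add: bounded_measurable_integrable bm P Q)
qed

lemma star_prod_diff_left:
  assumes V: "V \<in> copulas" and P: "P \<in> copulas" and Q: "Q \<in> copulas" and p: "p \<in> unit_square"
  shows "star_prod (\<lambda>p. P p - Q p) V p = star_prod P V p - star_prod Q V p"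
proof -
  obtain x y where xy: "p = (x, y)" by (cases p)
  have tr: "flip (\<lambda>p. P p - Q p) = (\<lambda>p. flip P p - flip Q p)" by (auto simp: flip_def)
  have sw: "star_prod A V (x, y) = star_prod (flip V) (flip A) (y, x)" for A
    by (simp add: star_prod_flip[symmetric])
  show ?thesis unfolding xy sw tr
    by (rule star_prod_diff_right) (use assms xy in \<open>auto intro: flip_copula\<close>)
qed

lemma sobolev_norm_star_prod_diff:
  assumes "U \<in> copulas" "V \<in> copulas" "P \<in> copulas" "Q \<in> copulas"
  shows "sobolev_norm (star_prod (star_prod U (\<lambda>p. P p - Q p)) V) =
    sobolev_dist (star_prod (star_prod U P) V) (star_prod (star_prod U Q) V)"
proof -
  have "star_prod (star_prod U (\<lambda>p. P p - Q p)) V = star_prod (\<lambda>p. star_prod U P p - star_prod U Q p) V"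
    by (rule star_prod_cong) (simp_all add: star_prod_diff_right assms)
  then show ?thesis unfolding sobolev_dist_def
    by (intro sobolev_norm_cong) (simp add: star_prod_diff_left star_prod_copula assms)
qed

context
  fixes P Q assumes P: "P \<in> copulas" and Q: "Q \<in> copulas"
begin

lemma star_dist_eq:
  "star_dist P Q = (SUP (U, V) \<in> inv_copulas \<times> inv_copulas.
     sobolev_dist (star_prod (star_prod U P) V) (star_prod (star_prod U Q) V))"
  unfolding star_dist_def star_norm_def
  by (rule SUP_cong) (auto simp: sobolev_norm_star_prod_diff inv_copulas_copula P Q)

lemma star_dist_upper:
  assumes "U \<in> inv_copulas" "V \<in> inv_copulas"
  shows "sobolev_dist (star_prod (star_prod U P) V) (star_prod (star_prod U Q) V) \<le> star_dist P Q"
proof -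
  have "bdd_above ((\<lambda>(U, V). sobolev_dist (star_prod (star_prod U P) V) (star_prod (star_prod U Q) V)) `
      (inv_copulas \<times> inv_copulas))"
    by (rule bdd_aboveI2[where M = "sqrt 2"])
       (auto intro!: sobolev_dist_bound inv_conjugate_copula P Q)
  then show ?thesis unfolding star_dist_eq
    using cSUP_upper[of "(U, V)" "inv_copulas \<times> inv_copulas"
        "\<lambda>(U, V). sobolev_dist (star_prod (star_prod U P) V) (star_prod (star_prod U Q) V)"] assms by auto
qed

lemma star_dist_least:
  assumes "\<And>U V. U \<in> inv_copulas \<Longrightarrow> V \<in> inv_copulas \<Longrightarrow>
      sobolev_dist (star_prod (star_prod U P) V) (star_prod (star_prod U Q) V) \<le> c"
  shows "star_dist P Q \<le> c"
  unfolding star_dist_eq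
  by (rule cSUP_least) (use assms min_copula_inv in auto)

lemma sobolev_dist_le_star_dist: "sobolev_dist P Q \<le> star_dist P Q"
  using star_dist_upper[OF min_copula_inv min_copula_inv]
  by (simp add: star_prod_min_left star_prod_min_right P Q)

lemma star_dist_nonneg: "0 \<le> star_dist P Q"
  using sobolev_dist_nonneg[OF P Q] sobolev_dist_le_star_dist by linarith

end

text \<open>The invertible copulas are closed under products, so the supremum for the conjugated pair runs over
  a subset of the values for the original pair.\<close>

lemma star_dist_inv_le:
  assumes P: "P \<in> copulas" and Q: "Q \<in> copulas" and U: "U \<in> inv_copulas" and V: "V \<in> inv_copulas"
  shows "star_dist (star_prod (star_prod U P) V) (star_prod (star_prod U Q) V) \<le> star_dist P Q"
proof (rule star_dist_least)
  note [simp] = U V P Q inv_copulas_copula star_prod_copula star_prod_assoc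
  show "star_prod (star_prod U P) V \<in> copulas" "star_prod (star_prod U Q) V \<in> copulas" by simp_all
  fix U' V' assume [simp]: "U' \<in> inv_copulas" "V' \<in> inv_copulas"
  show "sobolev_dist (star_prod (star_prod U' (star_prod (star_prod U P) V)) V')
      (star_prod (star_prod U' (star_prod (star_prod U Q) V)) V') \<le> star_dist P Q"
    using star_dist_upper[OF P Q star_prod_inv_copula[of U' U] star_prod_inv_copula[of V V']]
    by simp
qed

lemma star_dist_triangle:
  assumes P: "P \<in> copulas" and Q: "Q \<in> copulas" and R: "R \<in> copulas"
  shows "star_dist P R \<le> star_dist P Q + star_dist Q R"
proof (rule star_dist_least[OF P R])
  fix U V assume UV: "U \<in> inv_copulas" "V \<in> inv_copulas"
  let ?c = "\<lambda>A. star_prod (star_prod U A) V"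
  have "sobolev_dist (?c P) (?c R) \<le> sobolev_dist (?c P) (?c Q) + sobolev_dist (?c Q) (?c R)"
    by (intro sobolev_dist_triangle star_prod_copula inv_copulas_copula UV P Q R)
  then show "sobolev_dist (?c P) (?c R) \<le> star_dist P Q + star_dist Q R"
    using star_dist_upper[OF P Q UV] star_dist_upper[OF Q R UV] by linarith
qed

lemma star_dist_commute:
  assumes P: "P \<in> copulas" and Q: "Q \<in> copulas"
  shows "star_dist P Q = star_dist Q P"
  unfolding star_dist_eq[OF P Q] star_dist_eq[OF Q P]
  by (rule SUP_cong) (auto intro!: sobolev_dist_commute inv_conjugate_copula P Q)

lemma star_dist_flip:
  assumes P: "P \<in> copulas" and Q: "Q \<in> copulas"
  shows "star_dist (flip P) (flip Q) = star_dist P Q"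
proof -
  have le: "star_dist (flip P) (flip Q) \<le> star_dist P Q" if P: "P \<in> copulas" and Q: "Q \<in> copulas" for P Q
  proof (rule star_dist_least)
    fix U V assume UV: "U \<in> inv_copulas" "V \<in> inv_copulas"
    have "star_prod (star_prod U (flip A)) V = flip (star_prod (star_prod (flip V) A) (flip U))"
      if "A \<in> copulas" for A
      using that by (simp add: star_prod_flip star_prod_assoc flip_copula inv_copulas_copula UV)
    then show "sobolev_dist (star_prod (star_prod U (flip P)) V) (star_prod (star_prod U (flip Q)) V) \<le> star_dist P Q"
      using star_dist_upper[OF P Q flip_inv_copula[OF UV(2)] flip_inv_copula[OF UV(1)]]
      by (simp add: P Q sobolev_dist_flip star_prod_copula flip_copula inv_copulas_copula UV)
  qed (intro flip_copula P Q)+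
  show ?thesis using le[OF P Q] le[OF flip_copula[OF P] flip_copula[OF Q]] by simp
qed

lemma star_prod_prod_copula_inv:
  "U \<in> inv_copulas \<Longrightarrow> V \<in> inv_copulas \<Longrightarrow> star_prod (star_prod U prod_copula) V = prod_copula"
  by (simp add: star_prod_prod_copula_left star_prod_prod_copula_right inv_copulas_copula)

text \<open>The product copula absorbs every factor, so every conjugate of \<open>C\<close> is just another
  copula compared with it.\<close>

lemma star_dist_prod_upper:
  assumes C: "C \<in> copulas" shows "star_dist C prod_copula \<le> sqrt (1 / 3)"
  by (rule star_dist_least[OF C prod_copula_copula])
     (auto simp: star_prod_prod_copula_inv intro!: sobolev_dist_prod_upper inv_conjugate_copula C)

lemma star_dist_prod_eq_0_iff:
  assumes C: "C \<in> copulas" shows "star_dist C prod_copula = 0 \<longleftrightarrow> C = prod_copula"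
proof
  assume "star_dist C prod_copula = 0"
  then have "sobolev_dist C prod_copula = 0"
    using sobolev_dist_le_star_dist[OF C prod_copula_copula] sobolev_dist_nonneg[OF C prod_copula_copula] by simp
  then show "C = prod_copula" by (rule sobolev_dist_prod_eq_0[OF C])
next
  note \<Pi> = prod_copula_copula
  assume "C = prod_copula"
  moreover have "star_dist prod_copula prod_copula \<le> 0"
    by (rule star_dist_least[OF \<Pi> \<Pi>])
       (simp add: star_prod_prod_copula_inv sobolev_dist_eq[OF \<Pi> \<Pi>] slope_energy_def flip_prod_copula)
  ultimately show "star_dist C prod_copula = 0" using star_dist_nonneg[OF \<Pi> \<Pi>] by simp
qed

section \<open>Ranks of random variables and their copulas\<close>

text \<open>The probability integral transform of a random variable.\<close>

definition rank_rv :: "'a measure \<Rightarrow> ('a \<Rightarrow> real) \<Rightarrow> 'a \<Rightarrow> real" where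
  "rank_rv M X \<omega> = cdf (distr M borel X) (X \<omega>)"

text \<open>A weak form of complete dependence of \<open>Z\<close> on \<open>Y\<close>: every half-line event of
  \<open>Z\<close> is almost surely an event of \<open>Y\<close>. In this form \<open>Z\<close> can be recovered
  from an injective image of itself one half-line at a time.\<close>

definition determines :: "'a measure \<Rightarrow> ('a \<Rightarrow> real) \<Rightarrow> ('a \<Rightarrow> real) \<Rightarrow> bool" where
  "determines M Y Z \<longleftrightarrow> (\<forall>z. \<exists>S\<in>sets borel. AE \<omega> in M. Z \<omega> \<le> z \<longleftrightarrow> Y \<omega> \<in> S)"

context prob_space
begin

lemma continuous_rv_measurable: "continuous_rv M X \<Longrightarrow> X \<in> borel_measurable M"
  by (simp add: continuous_rv_def)

lemma continuous_rv_iff: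
  "continuous_rv M X \<longleftrightarrow> X \<in> borel_measurable M \<and> (\<forall>c. prob {\<omega> \<in> space M. X \<omega> = c} = 0)"
proof (cases "X \<in> borel_measurable M")
  case True
  interpret D: real_distribution "distr M borel X" by (rule real_distribution_distr) (rule True)
  have "measure (distr M borel X) {c} = prob {\<omega> \<in> space M. X \<omega> = c}" for c
    using True by (subst measure_distr) (auto intro: arg_cong[where f = prob])
  then show ?thesis
    using True D.isCont_cdf by (auto simp: continuous_rv_def continuous_on_eq_continuous_at)
qed (simp add: continuous_rv_def)

context
  fixes X assumes X: "continuous_rv M X"
begin

lemma cdf_eq_prob: "cdf (distr M borel X) x = prob {\<omega> \<in> space M. X \<omega> \<le> x}"
  using X unfolding cdf_def
  by (subst measure_distr) (auto simp: continuous_rv_def intro: arg_cong[where f = prob])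

lemma cdf_mono: "x \<le> y \<Longrightarrow> cdf (distr M borel X) x \<le> cdf (distr M borel X) y"
  unfolding cdf_eq_prob using X by (intro finite_measure_mono) (auto simp: continuous_rv_def)

lemma cdf_range: "cdf (distr M borel X) x \<in> {0..1}"
  unfolding cdf_eq_prob by simp

lemma rank_range: "rank_rv M X \<omega> \<in> {0..1}"
  unfolding rank_rv_def by (rule cdf_range)

lemma cdf_borel: "cdf (distr M borel X) \<in> borel_measurable borel"
  using X by (intro borel_measurable_continuous_onI) (simp add: continuous_rv_def)

lemma rank_measurable: "rank_rv M X \<in> borel_measurable M"
  unfolding rank_rv_def[abs_def]
  by (rule measurable_compose[OF _ cdf_borel]) (use X in \<open>simp add: continuous_rv_def\<close>)

lemma cdf_attains:
  assumes u: "u \<in> {0<..<1}" obtains x where "cdf (distr M borel X) x = u"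
proof -
  let ?F = "cdf (distr M borel X)"
  interpret D: real_distribution "distr M borel X"
    by (rule real_distribution_distr) (use X in \<open>simp add: continuous_rv_def\<close>)
  have "\<forall>\<^sub>F x in at_bot. ?F x < u"
    by (rule order_tendstoD[OF D.cdf_lim_at_bot]) (use u in simp)
  then obtain a where a: "?F a < u" using eventually_happens'[OF trivial_limit_at_bot_linorder] by blast
  have "\<forall>\<^sub>F x in at_top. u < ?F x"
    by (rule order_tendstoD[OF D.cdf_lim_at_top_prob]) (use u in simp)
  then obtain b where b: "u < ?F b" using eventually_happens'[OF trivial_limit_at_top_linorder] by blast
  have "a \<le> b" using a b cdf_mono[of b a] by linarith
  have "\<exists>x\<ge>a. x \<le> b \<and> ?F x = u"
    by (rule IVT') (use a b \<open>a \<le> b\<close> X in \<open>auto simp: continuous_rv_def intro: continuous_on_subset\<close>)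
  then show thesis using that by blast
qed

lemma rank_uniform:
  assumes u: "u \<in> {0..1}" shows "prob {\<omega> \<in> space M. rank_rv M X \<omega> \<le> u} = u"
proof (rule antisym)
  note [measurable] = continuous_rv_measurable[OF X] rank_measurable
  let ?F = "cdf (distr M borel X)"
  show "u \<le> prob {\<omega> \<in> space M. rank_rv M X \<omega> \<le> u}"
  proof (cases "u = 0 \<or> u = 1")
    case True
    have "{\<omega> \<in> space M. rank_rv M X \<omega> \<le> 1} = space M" using rank_range by auto
    then show ?thesis using True by (auto simp: prob_space)
  next
    case False
    then have "u \<in> {0<..<1}" using u by auto
    then obtain x where x: "?F x = u" by (rule cdf_attains)
    have "u = prob {\<omega> \<in> space M. X \<omega> \<le> x}" using x cdf_eq_prob by simp
    also have "\<dots> \<le> prob {\<omega> \<in> space M. rank_rv M X \<omega> \<le> u}"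
    proof (rule finite_measure_mono)
      show "{\<omega> \<in> space M. X \<omega> \<le> x} \<subseteq> {\<omega> \<in> space M. rank_rv M X \<omega> \<le> u}"
        using cdf_mono x by (auto simp: rank_rv_def)
    qed measurable
    finally show ?thesis .
  qed
  show "prob {\<omega> \<in> space M. rank_rv M X \<omega> \<le> u} \<le> u"
  proof (cases "u = 1")
    case False
    then have "u < 1" using u by simp
    show ?thesis
    proof (rule dense_ge_bounded[OF \<open>u < 1\<close>])
      fix w :: real assume w: "u < w" "w < 1"
      then obtain x where x: "?F x = w" using u by (meson atLeastAtMost_iff cdf_attains greaterThanLessThan_iff order.strict_trans1)
      have "prob {\<omega> \<in> space M. rank_rv M X \<omega> \<le> u} \<le> prob {\<omega> \<in> space M. X \<omega> \<le> x}"
      proof (intro finite_measure_mono subsetI)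
        fix \<omega> assume "\<omega> \<in> {\<omega> \<in> space M. rank_rv M X \<omega> \<le> u}"
        then have "\<omega> \<in> space M" "?F (X \<omega>) < ?F x" using x w by (auto simp: rank_rv_def)
        then show "\<omega> \<in> {\<omega> \<in> space M. X \<omega> \<le> x}" using cdf_mono[of x "X \<omega>"] by (cases "X \<omega> \<le> x") auto
      qed measurable
      then show "prob {\<omega> \<in> space M. rank_rv M X \<omega> \<le> u} \<le> w" using x cdf_eq_prob by simp
    qed
  qed simp
qed

text \<open>One event contains the other, and both have the probability given by the distribution
  function.\<close>

lemma AE_le_iff_rank_le: "AE \<omega> in M. X \<omega> \<le> x \<longleftrightarrow> rank_rv M X \<omega> \<le> cdf (distr M borel X) x"
proof -
  note [measurable] = continuous_rv_measurable[OF X] rank_measurable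
  let ?A = "{\<omega> \<in> space M. X \<omega> \<le> x}" and ?B = "{\<omega> \<in> space M. rank_rv M X \<omega> \<le> cdf (distr M borel X) x}"
  have sub: "?A \<subseteq> ?B" using cdf_mono by (auto simp: rank_rv_def)
  have "prob (?B - ?A) = prob ?B - prob ?A" by (rule finite_measure_Diff) (use sub in auto)
  also have "\<dots> = 0" using rank_uniform[OF cdf_range] cdf_eq_prob by simp
  finally have "?B - ?A \<in> null_sets M" by (auto simp: emeasure_eq_measure null_sets_def)
  then have "AE \<omega> in M. \<omega> \<notin> ?B - ?A" by (rule AE_not_in)
  then show ?thesis using AE_space by eventually_elim (use sub in auto)
qed

lemma distr_rank: "distr M borel (rank_rv M X) = distr U01 borel (\<lambda>t. t)"
proof (rule cdf_unique)
  note [measurable] = rank_measurable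
  have m: "(\<lambda>t. t) \<in> borel_measurable U01" by (rule measurable_U01) simp
  show "real_distribution (distr M borel (rank_rv M X))" by (rule real_distribution_distr) measurable
  show "real_distribution (distr U01 borel (\<lambda>t. t))" by (rule U01.real_distribution_distr) (rule m)
  show "cdf (distr M borel (rank_rv M X)) = cdf (distr U01 borel (\<lambda>t. t))"
  proof
    fix x
    have 1: "cdf (distr M borel (rank_rv M X)) x = prob {\<omega> \<in> space M. rank_rv M X \<omega> \<le> x}"
      unfolding cdf_def by (subst measure_distr) (auto intro: arg_cong[where f = prob])
    have 2: "cdf (distr U01 borel (\<lambda>t. t)) x = measure U01 {t \<in> space U01. t \<le> x}"
      unfolding cdf_def by (subst measure_distr[OF m]) (auto intro: arg_cong[where f = "measure U01"])
    have "(\<integral>t. indicator {..clamp01 x} t * pd1 prod_copula (t, 1) \<partial>U01) = prod_copula (clamp01 x, 1)"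
      by (intro copula_pd1_FTC prod_copula_copula clamp01_mem) simp
    moreover have "(\<integral>t. indicator {..clamp01 x} t * pd1 prod_copula (t, 1) \<partial>U01) =
        (\<integral>t. indicator {t \<in> space U01. t \<le> x} t \<partial>U01)"
      by (rule Bochner_Integration.integral_cong)
         (auto simp: space_U01 pd1_prod_copula clamp01_def split: split_indicator)
    moreover have "{t \<in> space U01. t \<le> x} \<inter> space U01 = {t \<in> space U01. t \<le> x}" by auto
    ultimately have "measure U01 {t \<in> space U01. t \<le> x} = clamp01 x"
      using clamp01_mem[of x] by (simp add: prod_copula_def)
    moreover have "prob {\<omega> \<in> space M. rank_rv M X \<omega> \<le> x} = clamp01 x"
    proof -
      consider "x < 0" | "x \<in> {0..1}" | "x > 1" by fastforce
      then show ?thesis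
      proof cases
        case 1
        have "\<not> rank_rv M X \<omega> \<le> x" for \<omega> using rank_range[of \<omega>] 1 by simp
        then show ?thesis using 1 by (simp add: clamp01_def)
      next
        case 2
        then show ?thesis using rank_uniform by (simp add: clamp01_id)
      next
        case 3
        have "rank_rv M X \<omega> \<le> x" for \<omega> using rank_range[of \<omega>] 3 by simp
        then show ?thesis using 3 by (simp add: clamp01_def prob_space)
      qed
    qed
    ultimately show "cdf (distr M borel (rank_rv M X)) x = cdf (distr U01 borel (\<lambda>t. t)) x"
      using 1 2 by simp
  qed
qed

lemma AE_rank_interior: "AE \<omega> in M. rank_rv M X \<omega> \<in> {0<..<1}"
proof -
  have m: "(\<lambda>t. t) \<in> borel_measurable U01" by (rule measurable_U01) simp
  have "AE t in distr U01 borel (\<lambda>t. t). t \<in> {0<..<1::real}"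
    using AE_space[of U01] by (subst AE_distr_iff[OF m]) (auto simp: space_U01)
  then have "AE t in distr M borel (rank_rv M X). t \<in> {0<..<1}" by (simp only: distr_rank)
  then show ?thesis by (rule AE_distrD[OF rank_measurable])
qed

lemma expectation_rank:
  fixes g :: "real \<Rightarrow> real"
  assumes g: "g \<in> borel_measurable borel"
  shows "expectation (\<lambda>\<omega>. g (rank_rv M X \<omega>)) = (\<integral>t. g t \<partial>U01)"
proof -
  have m: "(\<lambda>t. t) \<in> borel_measurable U01" by (rule measurable_U01) simp
  have "expectation (\<lambda>\<omega>. g (rank_rv M X \<omega>)) = integral\<^sup>L (distr M borel (rank_rv M X)) g"
    by (rule integral_distr[symmetric, OF rank_measurable g])
  also have "\<dots> = (\<integral>t. g t \<partial>U01)"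
    unfolding distr_rank by (rule integral_distr[OF m g])
  finally show ?thesis .
qed

end

text \<open>The distribution function of the pair of ranks; it turns out to be the copula of the two
  variables.\<close>

definition rank_copula :: "('a \<Rightarrow> real) \<Rightarrow> ('a \<Rightarrow> real) \<Rightarrow> real \<times> real \<Rightarrow> real" where
  "rank_copula X Y = (\<lambda>(u, v)\<in>unit_square. prob {\<omega> \<in> space M. rank_rv M X \<omega> \<le> u \<and> rank_rv M Y \<omega> \<le> v})"

lemma rank_copula_eq:
  "u \<in> {0..1} \<Longrightarrow> v \<in> {0..1} \<Longrightarrow>
    rank_copula X Y (u, v) = prob {\<omega> \<in> space M. rank_rv M X \<omega> \<le> u \<and> rank_rv M Y \<omega> \<le> v}"
  by (simp add: rank_copula_def)

lemma flip_rank_copula: "flip (rank_copula X Y) = rank_copula Y X"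
  by (auto simp: fun_eq_iff rank_copula_def restrict_def conj_commute)

context
  fixes X Y assumes X: "continuous_rv M X" and Y: "continuous_rv M Y"
begin

lemma rank_copula_copula: "rank_copula X Y \<in> copulas"
proof (rule copulasI)
  note [measurable] = rank_measurable[OF X] rank_measurable[OF Y]
  let ?U = "rank_rv M X" and ?V = "rank_rv M Y"
  show "rank_copula X Y \<in> extensional unit_square" by (simp add: rank_copula_def)
  fix u :: real assume u: "u \<in> {0..1}"
  have "prob {\<omega> \<in> space M. ?U \<omega> \<le> u \<and> ?V \<omega> \<le> 0} \<le> prob {\<omega> \<in> space M. ?V \<omega> \<le> 0}"
    by (intro finite_measure_mono) auto
  then have "prob {\<omega> \<in> space M. ?U \<omega> \<le> u \<and> ?V \<omega> \<le> 0} = 0"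
    using rank_uniform[OF Y, of 0] measure_nonneg[of M "{\<omega> \<in> space M. ?U \<omega> \<le> u \<and> ?V \<omega> \<le> 0}"] by simp
  moreover have "{\<omega> \<in> space M. ?U \<omega> \<le> u \<and> ?V \<omega> \<le> 1} = {\<omega> \<in> space M. ?U \<omega> \<le> u}"
    using rank_range[OF Y] by auto
  ultimately show "rank_copula X Y (u, 0) = 0 \<and> rank_copula X Y (u, 1) = u"
    using u rank_uniform[OF X u] by (simp add: rank_copula_eq)
  have "prob {\<omega> \<in> space M. ?U \<omega> \<le> 0 \<and> ?V \<omega> \<le> u} \<le> prob {\<omega> \<in> space M. ?U \<omega> \<le> 0}"
    by (intro finite_measure_mono) auto
  then have "prob {\<omega> \<in> space M. ?U \<omega> \<le> 0 \<and> ?V \<omega> \<le> u} = 0"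
    using rank_uniform[OF X, of 0] measure_nonneg[of M "{\<omega> \<in> space M. ?U \<omega> \<le> 0 \<and> ?V \<omega> \<le> u}"] by simp
  moreover have "{\<omega> \<in> space M. ?U \<omega> \<le> 1 \<and> ?V \<omega> \<le> u} = {\<omega> \<in> space M. ?V \<omega> \<le> u}"
    using rank_range[OF X] by auto
  ultimately show "rank_copula X Y (0, u) = 0 \<and> rank_copula X Y (1, u) = u"
    using u rank_uniform[OF Y u] by (simp add: rank_copula_eq)
next
  note [measurable] = rank_measurable[OF X] rank_measurable[OF Y]
  let ?U = "rank_rv M X" and ?V = "rank_rv M Y"
  fix x u y v :: real
  assume *: "x \<in> {0..1}" "u \<in> {0..1}" "y \<in> {0..1}" "v \<in> {0..1}" "x \<le> u" "y \<le> v"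
  let ?E = "\<lambda>u v. {\<omega> \<in> space M. ?U \<omega> \<le> u \<and> ?V \<omega> \<le> v}"
  have diff: "prob (?E u b) - prob (?E x b) = prob (?E u b - ?E x b)" for b
    using * by (intro finite_measure_Diff[symmetric]) auto
  have "prob (?E u y - ?E x y) \<le> prob (?E u v - ?E x v)"
    using * by (intro finite_measure_mono) auto
  then show "rank_copula X Y (u, v) - rank_copula X Y (u, y) - rank_copula X Y (x, v) + rank_copula X Y (x, y) \<ge> 0"
    using * diff[of v] diff[of y] by (simp only: rank_copula_eq)
qed

lemma joint_cdf_eq_rank_copula:
  "joint_cdf M X Y x y = rank_copula X Y (cdf (distr M borel X) x, cdf (distr M borel Y) y)"
proof -
  have [measurable]: "X \<in> borel_measurable M" "Y \<in> borel_measurable M"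
    using X Y by (auto simp: continuous_rv_def)
  note [measurable] = rank_measurable[OF X] rank_measurable[OF Y]
  have "AE \<omega> in M. (X \<omega> \<le> x \<and> Y \<omega> \<le> y) \<longleftrightarrow>
      (rank_rv M X \<omega> \<le> cdf (distr M borel X) x \<and> rank_rv M Y \<omega> \<le> cdf (distr M borel Y) y)"
    using AE_le_iff_rank_le[OF X, of x] AE_le_iff_rank_le[OF Y, of y] by eventually_elim blast
  then have "prob {\<omega> \<in> space M. X \<omega> \<le> x \<and> Y \<omega> \<le> y} =
     prob {\<omega> \<in> space M. rank_rv M X \<omega> \<le> cdf (distr M borel X) x \<and> rank_rv M Y \<omega> \<le> cdf (distr M borel Y) y}"
    by (intro finite_measure_eq_AE) auto
  then show ?thesis unfolding joint_cdf_def by (simp only: rank_copula_eq[OF cdf_range[OF X] cdf_range[OF Y]])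
qed

text \<open>Continuous distribution functions attain every value strictly between 0 and 1, so the joint
  distribution function fixes a copula in the interior; on the boundary all copulas agree.\<close>

lemma copula_of_unique:
  assumes C: "C \<in> copulas"
    and eq: "\<And>x y. joint_cdf M X Y x y = C (cdf (distr M borel X) x, cdf (distr M borel Y) y)"
  shows "C = rank_copula X Y"
proof
  note R = rank_copula_copula
  fix p :: "real \<times> real"
  obtain u v where p: "p = (u, v)" by (cases p)
  show "C p = rank_copula X Y p"
  proof (cases "p \<in> unit_square")
    case True
    then have uv: "u \<in> {0..1}" "v \<in> {0..1}" by (auto simp: p)
    consider "u = 0" | "u = 1" | "v = 0" | "v = 1" | "u \<in> {0<..<1}" "v \<in> {0<..<1}"
      using uv by fastforce
    then show ?thesis
    proof cases
      case 5
      obtain x where "cdf (distr M borel X) x = u" using cdf_attains[OF X 5(1)] .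
      moreover obtain y where "cdf (distr M borel Y) y = v" using cdf_attains[OF Y 5(2)] .
      ultimately show ?thesis using eq[of x y] joint_cdf_eq_rank_copula[of x y] by (simp add: p)
    qed (use copula_margins[OF C uv(1)] copula_margins[OF C uv(2)] copula_margins[OF R uv(1)] copula_margins[OF R uv(2)]
        in \<open>auto simp: p\<close>)
  qed (simp add: copula_extensional[OF C] copula_extensional[OF R])
qed

lemma copula_of_eq: "copula_of M X Y = rank_copula X Y"
  unfolding copula_of_def
  by (rule the_equality) (use rank_copula_copula joint_cdf_eq_rank_copula copula_of_unique in blast)+

text \<open>The slope \<open>\<partial>\<^sub>1 C(_, v)\<close> is the conditional probability that the second
  rank is at most \<open>v\<close> given the first rank. On initial intervals this is the fundamental theorem of
  calculus, and the extension principle gives it for all Borel sets.\<close>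

lemma integral_pd1_rank_copula:
  assumes S: "S \<in> sets borel" and v: "v \<in> {0..1}"
  shows "(\<integral>t. indicator S t * pd1 (rank_copula X Y) (t, v) \<partial>U01) =
    prob {\<omega> \<in> space M. rank_rv M X \<omega> \<in> S \<and> rank_rv M Y \<omega> \<le> v}"
proof -
  note [measurable] = rank_measurable[OF X] rank_measurable[OF Y]
  let ?U = "rank_rv M X" and ?V = "rank_rv M Y" and ?C = "rank_copula X Y"
  note C = rank_copula_copula
  \<comment> \<open>Test functions are only controlled on the open interval, where ranks almost surely lie.\<close>
  define J :: "real \<Rightarrow> real" where "J = indicator {0<..<1}"
  have [measurable]: "J \<in> borel_measurable borel" unfolding J_def by simp
  have Jc: "(\<lambda>t. J t * c t) \<in> borel_measurable borel" if "bounded_measurable c" for c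
    using bounded_measurable_measurable[OF that] unfolding U01_def J_def
    by (subst (asm) borel_measurable_restrict_space_iff) (auto simp: mult.commute)
  have Jc_bound: "\<exists>L. \<forall>t. \<bar>J t * c t\<bar> \<le> L" if bm: "bounded_measurable c" for c
  proof -
    obtain L where "L \<ge> 0" "\<And>t. t \<in> {0<..<1} \<Longrightarrow> \<bar>c t\<bar> \<le> L" using bm by (rule bounded_measurableE) (rule that)
    then show ?thesis by (intro exI[of _ L]) (auto simp: J_def split: split_indicator)
  qed
  define E where "E c = expectation (\<lambda>\<omega>. J (?U \<omega>) * c (?U \<omega>) * indicator {\<omega> \<in> space M. ?V \<omega> \<le> v} \<omega>)" for c
  have E_int: "integrable M (\<lambda>\<omega>. J (?U \<omega>) * c (?U \<omega>) * indicator {\<omega> \<in> space M. ?V \<omega> \<le> v} \<omega>)"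
    if c: "bounded_measurable c" for c
  proof -
    obtain L where L: "\<And>t. \<bar>J t * c t\<bar> \<le> L" using Jc_bound[OF c] by blast
    have "(\<lambda>\<omega>. J (?U \<omega>) * c (?U \<omega>)) \<in> borel_measurable M"
      using measurable_compose[OF rank_measurable[OF X] Jc[OF c]] .
    moreover have "\<bar>J t * c t * indicator A w\<bar> \<le> L" for t A and w :: 'a
      using L[of t] by (auto split: split_indicator)
    ultimately show ?thesis by (intro integrable_const_bound[of _ L]) auto
  qed
  define \<Theta> where "\<Theta> c = (\<integral>t. c t * pd1 ?C (t, v) \<partial>U01) - E c" for c
  have I_int: "integrable U01 (\<lambda>t. c t * pd1 ?C (t, v))" if "bounded_measurable c" for c
    by (rule copula_pd1_product_integrable[OF C that v])
  have E_indicator: "E (indicator T) = prob {\<omega> \<in> space M. ?U \<omega> \<in> T \<and> ?V \<omega> \<le> v}"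
    if T [measurable]: "T \<in> sets borel" for T
  proof -
    have "E (indicator T) = expectation (indicator {\<omega> \<in> space M. ?U \<omega> \<in> T \<and> ?V \<omega> \<le> v})"
      unfolding E_def
    proof (rule integral_cong_AE)
      show "AE \<omega> in M. J (?U \<omega>) * indicator T (?U \<omega>) * indicator {\<omega> \<in> space M. ?V \<omega> \<le> v} \<omega> =
          indicator {\<omega> \<in> space M. ?U \<omega> \<in> T \<and> ?V \<omega> \<le> v} \<omega>"
        using AE_rank_interior[OF X] AE_space by eventually_elim (auto simp: J_def split: split_indicator)
    qed measurable
    then show ?thesis by simp
  qed
  have "\<Theta> (indicator S) = 0"
  proof (rule L1_bounded_functional_eq_0[where \<Theta> = \<Theta> and K = "1 + 1"])
    fix c d :: "real \<Rightarrow> real" and k assume c: "bounded_measurable c"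
    show "\<Theta> (\<lambda>t. c t + d t) = \<Theta> c + \<Theta> d" if d: "bounded_measurable d"
      unfolding \<Theta>_def E_def distrib_left distrib_right using I_int[OF c] I_int[OF d] E_int[OF c] E_int[OF d] by simp
    show "\<Theta> (\<lambda>t. k * c t) = k * \<Theta> c"
      unfolding \<Theta>_def E_def by (simp add: mult.assoc mult.left_commute[of _ k] right_diff_distrib)
    have "\<bar>\<integral>t. c t * pd1 ?C (t, v) \<partial>U01\<bar> \<le> 1 * (\<integral>t. \<bar>c t\<bar> \<partial>U01)"
    proof (rule integral_mult_bound[OF c copula_pd1_bounded_measurable[OF C v]])
      show "AE t in U01. \<bar>pd1 ?C (t, v)\<bar> \<le> 1" using copula_pd1_AE_range[OF C v] by eventually_elim auto
    qed
    moreover have "\<bar>E c\<bar> \<le> 1 * (\<integral>t. \<bar>c t\<bar> \<partial>U01)"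
    proof -
      have Jm: "(\<lambda>t. \<bar>J t * c t\<bar>) \<in> borel_measurable borel"
        by (intro borel_measurable_abs Jc c)
      have "\<bar>E c\<bar> \<le> expectation (\<lambda>\<omega>. \<bar>J (?U \<omega>) * c (?U \<omega>) * indicator {\<omega> \<in> space M. ?V \<omega> \<le> v} \<omega>\<bar>)"
        unfolding E_def by (rule integral_abs_bound)
      also have "\<dots> \<le> expectation (\<lambda>\<omega>. \<bar>J (?U \<omega>) * c (?U \<omega>)\<bar>)"
      proof (rule integral_mono)
        show "integrable M (\<lambda>\<omega>. \<bar>J (?U \<omega>) * c (?U \<omega>) * indicator {\<omega> \<in> space M. ?V \<omega> \<le> v} \<omega>\<bar>)"
          using E_int[OF c] by simp
        obtain L where L: "\<And>t. \<bar>J t * c t\<bar> \<le> L" using Jc_bound[OF c] by blast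
        show "integrable M (\<lambda>\<omega>. \<bar>J (?U \<omega>) * c (?U \<omega>)\<bar>)"
          using measurable_compose[OF rank_measurable[OF X] Jm] L
          by (intro integrable_const_bound[of _ L]) auto
      qed (auto split: split_indicator)
      also have "\<dots> = (\<integral>t. \<bar>J t * c t\<bar> \<partial>U01)" by (rule expectation_rank[OF X Jm])
      also have "\<dots> = (\<integral>t. \<bar>c t\<bar> \<partial>U01)"
        by (rule Bochner_Integration.integral_cong) (auto simp: space_U01 J_def)
      finally show ?thesis by simp
    qed
    ultimately show "\<bar>\<Theta> c\<bar> \<le> (1 + 1) * (\<integral>t. \<bar>c t\<bar> \<partial>U01)"
      unfolding \<Theta>_def distrib_right by linarith
  next
    fix x :: real assume x: "x \<in> {0..1}"
    show "\<Theta> (indicator {..x}) = 0"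
      using copula_pd1_FTC[OF C v x] by (simp add: \<Theta>_def E_indicator rank_copula_eq[OF x v])
  qed (simp add: bounded_measurable_indicator S)
  then show ?thesis by (simp add: \<Theta>_def E_indicator[OF S])
qed

end

lemma integral_indicator_rank:
  assumes X: "continuous_rv M X" and S: "S \<in> sets borel"
  shows "(\<integral>t. indicator S t \<partial>U01) = prob {\<omega> \<in> space M. rank_rv M X \<omega> \<in> S}"
proof -
  note [measurable] = rank_measurable[OF X] S
  have "(\<integral>t. indicator S t \<partial>U01) = expectation (\<lambda>\<omega>. indicator S (rank_rv M X \<omega>) :: real)"
    by (rule expectation_rank[OF X, symmetric]) simp
  also have "\<dots> = expectation (indicator {\<omega> \<in> space M. rank_rv M X \<omega> \<in> S} :: _ \<Rightarrow> real)"
    by (rule Bochner_Integration.integral_cong) (auto split: split_indicator)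
  finally show ?thesis by simp
qed

lemma rank_event_of_event:
  assumes Y: "continuous_rv M Y" and S: "S \<in> sets borel"
  shows "\<exists>T\<in>sets borel. AE \<omega> in M. Y \<omega> \<in> S \<longleftrightarrow> rank_rv M Y \<omega> \<in> T"
  using S
proof (induction rule: borel_induct_atMost)
  case (atMost y)
  show ?case using AE_le_iff_rank_le[OF Y, of y]
    by (intro bexI[of _ "{..cdf (distr M borel Y) y}"]) auto
next
  case (compl A)
  then obtain T where T: "T \<in> sets borel" "AE \<omega> in M. Y \<omega> \<in> A \<longleftrightarrow> rank_rv M Y \<omega> \<in> T" by blast
  have "AE \<omega> in M. Y \<omega> \<in> UNIV - A \<longleftrightarrow> rank_rv M Y \<omega> \<in> UNIV - T"
    using T(2) by eventually_elim auto
  moreover have "UNIV - T \<in> sets borel" using T(1) by (metis sets.compl_sets space_borel)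
  ultimately show ?case by blast
next
  case empty
  show ?case by (intro bexI[of _ "{}"]) auto
next
  case (union A)
  then obtain T where T: "\<And>i. T i \<in> sets borel" "\<And>i. AE \<omega> in M. Y \<omega> \<in> A i \<longleftrightarrow> rank_rv M Y \<omega> \<in> T i" by metis
  have "AE \<omega> in M. \<forall>i. Y \<omega> \<in> A i \<longleftrightarrow> rank_rv M Y \<omega> \<in> T i" using T(2) by (simp add: AE_all_countable)
  then have "AE \<omega> in M. Y \<omega> \<in> (\<Union>i. A i) \<longleftrightarrow> rank_rv M Y \<omega> \<in> (\<Union>i. T i)" by eventually_elim auto
  moreover have "(\<Union>i. T i) \<in> sets borel" using T(1) by auto
  ultimately show ?case by blast
qed

text \<open>At a level strictly between 0 and 1 the event on the rank scale is almost surely a half-line event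
  of the original variable; at the levels 0 and 1 it is trivial.\<close>

lemma determines_rank:
  assumes Y: "continuous_rv M Y" and Z: "continuous_rv M Z" and det: "determines M Y Z" and z: "z \<in> {0..1}"
  shows "\<exists>T\<in>sets borel. AE \<omega> in M. rank_rv M Z \<omega> \<le> z \<longleftrightarrow> rank_rv M Y \<omega> \<in> T"
proof -
  consider "z = 0" | "z = 1" | "z \<in> {0<..<1}" using z by fastforce
  then show ?thesis
  proof cases
    case 1
    have "AE \<omega> in M. rank_rv M Z \<omega> \<le> z \<longleftrightarrow> rank_rv M Y \<omega> \<in> {}"
      using AE_rank_interior[OF Z] by eventually_elim (use 1 in auto)
    then show ?thesis by (rule bexI[where x = "{}"]) simp
  next
    case 2
    then have "AE \<omega> in M. rank_rv M Z \<omega> \<le> z \<longleftrightarrow> rank_rv M Y \<omega> \<in> UNIV"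
      using rank_range[OF Z] by auto
    then show ?thesis by (rule bexI[where x = UNIV]) simp
  next
    case 3
    then obtain w where w: "cdf (distr M borel Z) w = z" by (rule cdf_attains[OF Z])
    obtain S where S: "S \<in> sets borel" "AE \<omega> in M. Z \<omega> \<le> w \<longleftrightarrow> Y \<omega> \<in> S"
      using det unfolding determines_def by blast
    obtain T where T: "T \<in> sets borel" "AE \<omega> in M. Y \<omega> \<in> S \<longleftrightarrow> rank_rv M Y \<omega> \<in> T"
      using rank_event_of_event[OF Y S(1)] by blast
    have "AE \<omega> in M. rank_rv M Z \<omega> \<le> z \<longleftrightarrow> rank_rv M Y \<omega> \<in> T"
      using AE_le_iff_rank_le[OF Z, of w] S(2) T(2) by eventually_elim (simp add: w)
    then show ?thesis by (rule bexI[where x = T]) (rule T(1))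
  qed
qed

text \<open>The star product of copulas composes the random variables as if \<open>X\<close> and
  \<open>Z\<close> were conditionally independent given \<open>Y\<close>. This is automatic when
  \<open>Y\<close> determines \<open>Z\<close>: then \<open>\<partial>\<^sub>1\<close> of the second factor is
  the indicator of an event of \<open>Y\<close>, and integrating \<open>\<partial>\<^sub>2\<close> of the first
  factor over that event gives the joint probability.\<close>

lemma star_prod_rank_copula:
  assumes X: "continuous_rv M X" and Y: "continuous_rv M Y" and Z: "continuous_rv M Z"
    and det: "determines M Y Z"
  shows "star_prod (rank_copula X Y) (rank_copula Y Z) = rank_copula X Z"
proof
  note [measurable] = rank_measurable[OF X] rank_measurable[OF Y] rank_measurable[OF Z]
  fix p :: "real \<times> real"
  obtain x z where p: "p = (x, z)" by (cases p)
  show "star_prod (rank_copula X Y) (rank_copula Y Z) p = rank_copula X Z p"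
  proof (cases "p \<in> unit_square")
    case True
    then have x: "x \<in> {0..1}" and z: "z \<in> {0..1}" by (auto simp: p)
    obtain T where T [measurable]: "T \<in> sets borel"
      and ae: "AE \<omega> in M. rank_rv M Z \<omega> \<le> z \<longleftrightarrow> rank_rv M Y \<omega> \<in> T"
      using determines_rank[OF Y Z det z] by blast
    note bm = bounded_measurable_indicator[OF T] copula_pd1_bounded_measurable[OF rank_copula_copula[OF Y Z] z]
      copula_pd1_bounded_measurable[OF rank_copula_copula[OF Y X] x]
    have slope: "AE t in U01. indicator T t = pd1 (rank_copula Y Z) (t, z)"
    proof (rule AE_eq_if_primitives_eq[OF bm(1,2)])
      fix a :: real assume a: "a \<in> {0..1}"
      have "(\<integral>t. indicator {..a} t * indicator T t \<partial>U01) = (\<integral>t. (indicator ({..a} \<inter> T) t :: real) \<partial>U01)"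
        by (rule Bochner_Integration.integral_cong) (auto split: split_indicator)
      also have "\<dots> = prob {\<omega> \<in> space M. rank_rv M Y \<omega> \<in> {..a} \<inter> T}"
        by (rule integral_indicator_rank[OF Y]) simp
      also have "\<dots> = prob {\<omega> \<in> space M. rank_rv M Y \<omega> \<le> a \<and> rank_rv M Z \<omega> \<le> z}"
      proof (rule finite_measure_eq_AE)
        show "AE \<omega> in M. (\<omega> \<in> {\<omega> \<in> space M. rank_rv M Y \<omega> \<in> {..a} \<inter> T}) =
            (\<omega> \<in> {\<omega> \<in> space M. rank_rv M Y \<omega> \<le> a \<and> rank_rv M Z \<omega> \<le> z})"
          using ae by eventually_elim auto
      qed measurable
      also have "\<dots> = (\<integral>t. indicator {..a} t * pd1 (rank_copula Y Z) (t, z) \<partial>U01)"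
        by (simp only: copula_pd1_FTC[OF rank_copula_copula[OF Y Z] z a] rank_copula_eq[OF a z])
      finally show "(\<integral>t. indicator {..a} t * indicator T t \<partial>U01) =
          (\<integral>t. indicator {..a} t * pd1 (rank_copula Y Z) (t, z) \<partial>U01)" .
    qed
    have "star_prod (rank_copula X Y) (rank_copula Y Z) (x, z) =
        (\<integral>t. pd1 (rank_copula Y X) (t, x) * pd1 (rank_copula Y Z) (t, z) \<partial>U01)"
      unfolding star_prod_eq[OF x z] by (simp add: flip_rank_copula[of Y X, symmetric] pd2_flip)
    also have "\<dots> = (\<integral>t. indicator T t * pd1 (rank_copula Y X) (t, x) \<partial>U01)"
    proof (rule bounded_measurable_integral_cong)
      show "AE t in U01. pd1 (rank_copula Y X) (t, x) * pd1 (rank_copula Y Z) (t, z) =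
          indicator T t * pd1 (rank_copula Y X) (t, x)"
        using slope by eventually_elim simp
    qed (intro bounded_measurable_mult bm)+
    also have "\<dots> = prob {\<omega> \<in> space M. rank_rv M Y \<omega> \<in> T \<and> rank_rv M X \<omega> \<le> x}"
      by (rule integral_pd1_rank_copula[OF Y X T x])
    also have "\<dots> = prob {\<omega> \<in> space M. rank_rv M X \<omega> \<le> x \<and> rank_rv M Z \<omega> \<le> z}"
    proof (rule finite_measure_eq_AE)
      show "AE \<omega> in M. (\<omega> \<in> {\<omega> \<in> space M. rank_rv M Y \<omega> \<in> T \<and> rank_rv M X \<omega> \<le> x}) =
          (\<omega> \<in> {\<omega> \<in> space M. rank_rv M X \<omega> \<le> x \<and> rank_rv M Z \<omega> \<le> z})"
        using ae by eventually_elim auto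
    qed measurable
    finally show ?thesis by (simp only: p rank_copula_eq[OF x z])
  qed (simp add: star_prod_outside copula_extensional[OF rank_copula_copula[OF X Z]])
qed

lemma star_prod_rank_copula_left:
  assumes X: "continuous_rv M X" and Y: "continuous_rv M Y" and Z: "continuous_rv M Z"
    and det: "determines M Y X"
  shows "star_prod (rank_copula X Y) (rank_copula Y Z) = rank_copula X Z"
proof -
  have "flip (star_prod (rank_copula Z Y) (rank_copula Y X)) = flip (rank_copula Z X)"
    by (simp only: star_prod_rank_copula[OF Z Y X det])
  then show ?thesis by (simp add: star_prod_flip flip_rank_copula)
qed

lemma rank_copula_self:
  assumes X: "continuous_rv M X" shows "rank_copula X X = min_copula"
proof
  fix p :: "real \<times> real"
  obtain u v where p: "p = (u, v)" by (cases p)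
  show "rank_copula X X p = min_copula p"
  proof (cases "p \<in> unit_square")
    case True
    then have uv: "u \<in> {0..1}" "v \<in> {0..1}" by (auto simp: p)
    have "{\<omega> \<in> space M. rank_rv M X \<omega> \<le> u \<and> rank_rv M X \<omega> \<le> v} = {\<omega> \<in> space M. rank_rv M X \<omega> \<le> min u v}"
      by auto
    moreover have "min u v \<in> {0..1}" using uv by (auto simp: min_def)
    ultimately show ?thesis using uv rank_uniform[OF X] by (simp only: p rank_copula_eq) (simp add: min_copula_def)
  qed (simp add: copula_extensional[OF rank_copula_copula[OF X X]] copula_extensional[OF min_copula_copula])
qed

lemma rank_copula_invertible:
  assumes X: "continuous_rv M X" and Y: "continuous_rv M Y" and det: "determines M X Y" "determines M Y X"
  shows "rank_copula X Y \<in> inv_copulas"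
  unfolding inv_copulas_def
  using star_prod_rank_copula[OF X Y X det(2)] star_prod_rank_copula[OF Y X Y det(1)]
    rank_copula_copula[OF X Y] rank_copula_copula[OF Y X] rank_copula_self[OF X] rank_copula_self[OF Y]
  by auto

text \<open>Replacing both variables by equivalent ones multiplies the copula on both sides by invertible
  copulas, which the product copula absorbs.\<close>

lemma star_dist_determines_le:
  assumes X: "continuous_rv M X" and X': "continuous_rv M X'" and Y: "continuous_rv M Y" and Y': "continuous_rv M Y'"
    and "determines M X X'" "determines M X' X" "determines M Y Y'" "determines M Y' Y"
  shows "star_dist (rank_copula X' Y') prod_copula \<le> star_dist (rank_copula X Y) prod_copula"
proof -
  have inv: "rank_copula X' X \<in> inv_copulas" "rank_copula Y Y' \<in> inv_copulas"
    by (intro rank_copula_invertible assms)+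
  have "rank_copula X' Y' = star_prod (star_prod (rank_copula X' X) (rank_copula X Y)) (rank_copula Y Y')"
    by (simp add: star_prod_rank_copula_left[OF X' X Y assms(5)] star_prod_rank_copula[OF X' Y Y' assms(7)])
  moreover have "star_prod (star_prod (rank_copula X' X) prod_copula) (rank_copula Y Y') = prod_copula"
    by (rule star_prod_prod_copula_inv[OF inv])
  ultimately show ?thesis
    using star_dist_inv_le[OF rank_copula_copula[OF X Y] prod_copula_copula inv] by simp
qed

lemma omega_star_eq:
  "continuous_rv M X \<Longrightarrow> continuous_rv M Y \<Longrightarrow>
    omega_star M X Y = sqrt 3 * star_dist (rank_copula X Y) prod_copula"
  by (simp add: omega_star_def star_dist_def copula_of_eq)

lemma continuous_rv_injective_image:
  assumes X: "continuous_rv M X" and f: "f \<in> borel_measurable borel" "inj f"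
  shows "continuous_rv M (\<lambda>\<omega>. f (X \<omega>))"
  unfolding continuous_rv_iff
proof (intro conjI allI)
  have [measurable]: "X \<in> borel_measurable M" using X by (simp add: continuous_rv_iff)
  note [measurable] = f(1)
  show "(\<lambda>\<omega>. f (X \<omega>)) \<in> borel_measurable M" by measurable
  fix c
  show "prob {\<omega> \<in> space M. f (X \<omega>) = c} = 0"
  proof (cases "c \<in> range f")
    case True
    then obtain x where "c = f x" by blast
    then have "{\<omega> \<in> space M. f (X \<omega>) = c} = {\<omega> \<in> space M. X \<omega> = x}" using f(2) by (auto dest: injD)
    then show ?thesis using X by (simp add: continuous_rv_iff)
  next
    case False
    then have "{\<omega> \<in> space M. f (X \<omega>) = c} = {}" by auto
    then show ?thesis by (simp only: measure_empty)
  qed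
qed

lemma determines_image:
  assumes X: "X \<in> borel_measurable M" and f: "f \<in> borel_measurable borel"
  shows "determines M X (\<lambda>\<omega>. f (X \<omega>))"
  unfolding determines_def
proof
  fix z
  have "f -` {..z} \<in> sets borel" by (rule measurable_sets_borel[OF f]) simp
  then show "\<exists>S\<in>sets borel. AE \<omega> in M. f (X \<omega>) \<le> z \<longleftrightarrow> X \<omega> \<in> S"
    by (intro bexI[of _ "f -` {..z}"]) auto
qed

text \<open>An injective Borel function has an inverse that is Borel up to a null set. The graph of
  \<open>f\<close> over a half-line is exhausted up to a null set by compact sets; their projections to the
  second axis are compact, and injectivity means that no information is lost in projecting.\<close>

lemma injective_image_determines:
  assumes X [measurable]: "X \<in> borel_measurable M" and f [measurable]: "f \<in> borel_measurable borel" and inj: "inj f"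
  shows "determines M (\<lambda>\<omega>. f (X \<omega>)) X"
  unfolding determines_def
proof
  fix x
  define N where "N = distr M borel (\<lambda>\<omega>. (X \<omega>, f (X \<omega>)))"
  define G where "G = {z :: real \<times> real. snd z = f (fst z) \<and> fst z \<le> x}"
  have pair: "(\<lambda>\<omega>. (X \<omega>, f (X \<omega>))) \<in> borel_measurable M" by measurable
  have G: "G \<in> sets borel"
  proof -
    have "{z \<in> space (borel \<Otimes>\<^sub>M borel :: (real \<times> real) measure). snd z = f (fst z) \<and> fst z \<le> x} \<in> sets (borel \<Otimes>\<^sub>M borel)"
      by measurable
    then show ?thesis unfolding borel_prod by (simp add: G_def)
  qed
  interpret N: prob_space N unfolding N_def by (rule prob_space_distr[OF pair])
  let ?K = "{K. K \<subseteq> G \<and> compact K}"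
  have reg: "emeasure N G = Sup (emeasure N ` ?K)"
    by (rule inner_regular) (use G N.emeasure_finite in \<open>auto simp: N_def\<close>)
  have "emeasure N ` ?K \<noteq> {}" by auto
  from ennreal_Sup_countable_SUP[OF this] obtain g :: "nat \<Rightarrow> ennreal"
    where "incseq g" and g: "range g \<subseteq> emeasure N ` ?K" "Sup (emeasure N ` ?K) = (SUP i. g i)" by blast
  have "\<exists>K. K \<subseteq> G \<and> compact K \<and> g i = emeasure N K" for i
  proof -
    have "g i \<in> emeasure N ` ?K" using g(1) by (rule subsetD) (rule rangeI)
    then show ?thesis by auto
  qed
  then obtain K where "\<forall>i. K i \<subseteq> G \<and> compact (K i) \<and> g i = emeasure N (K i)" by metis
  then have K: "\<And>i. K i \<subseteq> G" "\<And>i. compact (K i)" "\<And>i. g i = emeasure N (K i)" by simp_all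
  define L where "L = (\<Union>i. K i)"
  have sets_N: "sets N = sets borel" by (simp add: N_def)
  have K_sets: "K i \<in> sets borel" for i using K(2) by (intro borel_compact)
  have L: "L \<in> sets borel" "L \<subseteq> G" using K(1) K_sets by (auto simp: L_def)
  have "emeasure N G \<le> emeasure N L"
    unfolding reg g(2) K(3) by (intro SUP_least emeasure_mono) (use L in \<open>auto simp: L_def sets_N\<close>)
  then have "emeasure N (G - L) = 0"
    using L G N.emeasure_finite emeasure_mono[OF L(2), of N]
    by (subst emeasure_Diff) (auto simp: sets_N)
  then have "G - L \<in> null_sets N" using G L by (auto simp: sets_N null_sets_def)
  then have "AE z in distr M borel (\<lambda>\<omega>. (X \<omega>, f (X \<omega>))). z \<notin> G - L" unfolding N_def by (rule AE_not_in)
  then have ae: "AE \<omega> in M. (X \<omega>, f (X \<omega>)) \<notin> G - L" by (rule AE_distrD[OF pair])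
  define S where "S = (\<Union>i. snd ` K i)"
  have "compact (snd ` K i)" for i using K(2) by (intro compact_continuous_image continuous_intros)
  then have "S \<in> sets borel" unfolding S_def by (auto intro: borel_compact)
  moreover have "AE \<omega> in M. X \<omega> \<le> x \<longleftrightarrow> f (X \<omega>) \<in> S"
    using ae
  proof eventually_elim
    case (elim \<omega>)
    show ?case
    proof
      assume "X \<omega> \<le> x"
      then have "(X \<omega>, f (X \<omega>)) \<in> L" using elim by (simp add: G_def)
      then show "f (X \<omega>) \<in> S" unfolding L_def S_def by force
    next
      assume "f (X \<omega>) \<in> S"
      then obtain i z where z: "z \<in> K i" "snd z = f (X \<omega>)" unfolding S_def by force
      then have "f (fst z) = f (X \<omega>)" "fst z \<le> x" using K(1)[of i] by (auto simp: G_def)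
      then show "X \<omega> \<le> x" by (simp add: inj_eq[OF inj])
    qed
  qed
  ultimately show "\<exists>S\<in>sets borel. AE \<omega> in M. X \<omega> \<le> x \<longleftrightarrow> f (X \<omega>) \<in> S" by blast
qed

end

section \<open>Properties of the dependence measure\<close>

context prob_space
begin

lemma determines_self: "X \<in> borel_measurable M \<Longrightarrow> determines M X X"
  using determines_image[of X "\<lambda>x. x"] by simp

text \<open>If \<open>Y = h(X)\<close>, then \<open>X\<close> can be replaced by equivalent variables that are
  close to \<open>Y\<close> in rank. Let \<open>\<phi>\<close> take \<open>x\<close> to the number of the
  interval of length \<open>1 / N\<close> that contains the rank of \<open>h(x)\<close>, plus an injective
  function of \<open>x\<close> with values in the open unit interval. The integer part of
  \<open>\<phi>(X)\<close> locates \<open>Y\<close> and its fractional part recovers \<open>X\<close>, so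
  \<open>\<phi>\<close> is injective, and the ranks of \<open>\<phi>(X)\<close> and \<open>Y\<close> lie in the
  same interval. Hence the copula of \<open>\<phi>(X)\<close> and \<open>Y\<close> is almost maximal on the
  diagonal, which makes its Sobolev distance from the product copula almost maximal. Equivalent variables have
  the same star distance, and \<open>N\<close> is arbitrary.\<close>

lemma star_dist_completely_dependent:
  assumes X: "continuous_rv M X" and Y: "continuous_rv M Y"
    and h: "h \<in> borel_measurable borel" and dep: "AE \<omega> in M. Y \<omega> = h (X \<omega>)"
  shows "star_dist (rank_copula X Y) prod_copula = sqrt (1 / 3)"
proof (rule antisym[OF star_dist_prod_upper[OF rank_copula_copula[OF X Y]]])
  note Xm = continuous_rv_measurable[OF X] and Ym = continuous_rv_measurable[OF Y]
  let ?V = "rank_rv M Y"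
  have approx: "sqrt (1 / 3 - 8 / real (Suc n)) \<le> star_dist (rank_copula X Y) prod_copula" for n
  proof -
    define N where "N = real (Suc n)"
    have N: "N > 0" by (simp add: N_def)
    define \<sigma> :: "real \<Rightarrow> real" where "\<sigma> x = 1 / 2 + arctan x / pi" for x
    have \<sigma>: "0 < \<sigma> x" "\<sigma> x < 1" for x
      using arctan_lbound[of x] arctan_ubound[of x] by (auto simp: \<sigma>_def field_simps)
    define \<phi> where "\<phi> x = real_of_int \<lfloor>N * cdf (distr M borel Y) (h x)\<rfloor> + \<sigma> x" for x
    have \<phi>_borel: "\<phi> \<in> borel_measurable borel"
    proof -
      have [measurable]: "(\<lambda>x. cdf (distr M borel Y) (h x)) \<in> borel_measurable borel"
        by (rule measurable_compose[OF h cdf_borel[OF Y]])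
      have [measurable]: "\<sigma> \<in> borel_measurable borel"
        unfolding \<sigma>_def by (intro borel_measurable_continuous_onI continuous_intros) auto
      show ?thesis unfolding \<phi>_def by measurable
    qed
    have floor_\<phi>: "\<lfloor>\<phi> x\<rfloor> = \<lfloor>N * cdf (distr M borel Y) (h x)\<rfloor>" for x
      using \<sigma>[of x] unfolding \<phi>_def by (intro floor_unique) auto
    have inj: "inj \<phi>"
    proof (rule injI)
      fix x x' assume eq: "\<phi> x = \<phi> x'"
      then have "\<sigma> x = \<sigma> x'" using floor_\<phi>[of x] floor_\<phi>[of x'] by (simp add: \<phi>_def)
      then show "x = x'" by (simp add: \<sigma>_def arctan_eq_iff)
    qed
    define X' where "X' \<omega> = \<phi> (X \<omega>)" for \<omega>
    have X': "continuous_rv M X'"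
      unfolding X'_def by (rule continuous_rv_injective_image[OF X \<phi>_borel inj])
    note [measurable] = rank_measurable[OF X'] rank_measurable[OF Y] continuous_rv_measurable[OF X']
    have X'_eq: "AE \<omega> in M. X' \<omega> = real_of_int \<lfloor>N * ?V \<omega>\<rfloor> + \<sigma> (X \<omega>)"
      using dep by eventually_elim (simp add: X'_def \<phi>_def rank_rv_def)
    have diag: "y - 2 / N \<le> rank_copula X' Y (y, y)" if y: "y \<in> {0<..<1}" for y
    proof (cases "\<lfloor>N * y\<rfloor> \<le> 1")
      case True
      then have "N * y < 2" by linarith
      then have "y - 2 / N \<le> 0" using N by (simp add: field_simps)
      also have "0 \<le> rank_copula X' Y (y, y)" using y by (simp add: rank_copula_eq)
      finally show ?thesis .
    next
      case False
      define k where "k = real_of_int \<lfloor>N * y\<rfloor>"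
      have k: "2 \<le> k" "k \<le> N * y" "N * y < k + 1" using False by (auto simp: k_def; linarith)+
      have "N * y < N * 1" using y N by (intro mult_strict_left_mono) auto
      with k have "k \<le> N" by simp
      \<comment> \<open>Stopping one interval earlier than \<open>k / N\<close> makes the ranks concerned lie strictly below \<open>k / N\<close>.\<close>
      define c where "c = (k - 1) / N"
      have c: "c \<in> {0..1}" using k N \<open>k \<le> N\<close> by (auto simp: c_def field_simps)
      have kN: "k / N \<in> {0..1}" "k / N \<le> y" "c \<le> k / N" using k N \<open>k \<le> N\<close> by (auto simp: c_def field_simps)
      have cdf_k: "cdf (distr M borel X') k \<le> k / N"
      proof -
        have "cdf (distr M borel X') k = prob {\<omega> \<in> space M. X' \<omega> \<le> k}" by (rule cdf_eq_prob[OF X'])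
        also have "\<dots> \<le> prob {\<omega> \<in> space M. ?V \<omega> \<le> k / N}"
        proof (rule finite_measure_mono_AE)
          show "AE \<omega> in M. \<omega> \<in> {\<omega> \<in> space M. X' \<omega> \<le> k} \<longrightarrow> \<omega> \<in> {\<omega> \<in> space M. ?V \<omega> \<le> k / N}"
            using X'_eq
          proof eventually_elim
            case (elim \<omega>)
            show ?case
            proof
              assume *: "\<omega> \<in> {\<omega> \<in> space M. X' \<omega> \<le> k}"
              then have "real_of_int \<lfloor>N * ?V \<omega>\<rfloor> < k" using elim \<sigma>(1)[of "X \<omega>"] by simp
              then have "\<lfloor>N * ?V \<omega>\<rfloor> < \<lfloor>N * y\<rfloor>" by (simp only: k_def of_int_less_iff)
              then have "N * ?V \<omega> < k" unfolding k_def by (simp only: floor_less_iff)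
              then show "\<omega> \<in> {\<omega> \<in> space M. ?V \<omega> \<le> k / N}" using * N by (simp add: field_simps)
            qed
          qed
        qed measurable
        also have "\<dots> = k / N" by (rule rank_uniform[OF Y kN(1)])
        finally show ?thesis .
      qed
      have "y - 2 / N = (N * y - 2) / N" using N by (simp add: diff_divide_distrib)
      also have "\<dots> \<le> c" unfolding c_def using k N by (intro divide_right_mono) auto
      also have "c = prob {\<omega> \<in> space M. ?V \<omega> \<le> c}" by (rule rank_uniform[OF Y c, symmetric])
      also have "\<dots> \<le> prob {\<omega> \<in> space M. rank_rv M X' \<omega> \<le> y \<and> ?V \<omega> \<le> y}"
      proof (rule finite_measure_mono_AE)
        show "AE \<omega> in M. \<omega> \<in> {\<omega> \<in> space M. ?V \<omega> \<le> c} \<longrightarrow>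
            \<omega> \<in> {\<omega> \<in> space M. rank_rv M X' \<omega> \<le> y \<and> ?V \<omega> \<le> y}"
          using X'_eq
        proof eventually_elim
          case (elim \<omega>)
          show ?case
          proof
            assume *: "\<omega> \<in> {\<omega> \<in> space M. ?V \<omega> \<le> c}"
            then have "N * ?V \<omega> \<le> k - 1" using N by (simp add: c_def field_simps)
            then have "real_of_int \<lfloor>N * ?V \<omega>\<rfloor> \<le> k - 1" by linarith
            then have "X' \<omega> \<le> k" using elim \<sigma>(2)[of "X \<omega>"] by simp
            then have "rank_rv M X' \<omega> \<le> cdf (distr M borel X') k" unfolding rank_rv_def by (rule cdf_mono[OF X'])
            then show "\<omega> \<in> {\<omega> \<in> space M. rank_rv M X' \<omega> \<le> y \<and> ?V \<omega> \<le> y}"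
              using * cdf_k kN by auto
          qed
        qed
      qed measurable
      also have "\<dots> = rank_copula X' Y (y, y)" using y by (simp add: rank_copula_eq)
      finally show ?thesis .
    qed
    have "sqrt (1 / 3 - 4 * (2 / N)) \<le> sobolev_dist (rank_copula X' Y) prod_copula"
      by (rule sobolev_dist_prod_lower[OF rank_copula_copula[OF X' Y] diag])
    also have "\<dots> \<le> star_dist (rank_copula X' Y) prod_copula"
      by (rule sobolev_dist_le_star_dist[OF rank_copula_copula[OF X' Y] prod_copula_copula])
    also have "\<dots> \<le> star_dist (rank_copula X Y) prod_copula"
    proof (rule star_dist_determines_le[OF X X' Y Y])
      show "determines M X X'" unfolding X'_def by (rule determines_image[OF Xm \<phi>_borel])
      show "determines M X' X" unfolding X'_def by (rule injective_image_determines[OF Xm \<phi>_borel inj])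
    qed (rule determines_self[OF Ym])+
    finally show ?thesis by (simp add: N_def)
  qed
  have "(\<lambda>n. sqrt (1 / 3 - 8 * (1 / real (Suc n)))) \<longlonglongrightarrow> sqrt (1 / 3 - 8 * 0)"
    by (intro tendsto_intros LIMSEQ_Suc lim_1_over_n)
  then show "sqrt (1 / 3) \<le> star_dist (rank_copula X Y) prod_copula"
    using approx by (intro LIMSEQ_le_const2) auto
qed

text \<open>The half-line events are closed under intersection and generate the events of each variable.\<close>

lemma indep_var_iff_joint_cdf:
  fixes X Y :: "'a \<Rightarrow> real"
  assumes [measurable]: "X \<in> borel_measurable M" "Y \<in> borel_measurable M"
  shows "indep_var borel X borel Y \<longleftrightarrow>
    (\<forall>x y. prob {\<omega> \<in> space M. X \<omega> \<le> x \<and> Y \<omega> \<le> y} = prob {\<omega> \<in> space M. X \<omega> \<le> x} * prob {\<omega> \<in> space M. Y \<omega> \<le> y})"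
proof (intro iffI allI)
  fix x y assume indep: "indep_var borel X borel Y"
  have "prob ((\<lambda>\<omega>. (X \<omega>, Y \<omega>)) -` ({..x} \<times> {..y}) \<inter> space M) =
      prob (X -` {..x} \<inter> space M) * prob (Y -` {..y} \<inter> space M)"
    by (rule indep_varD[OF indep]) simp_all
  moreover have "(\<lambda>\<omega>. (X \<omega>, Y \<omega>)) -` ({..x} \<times> {..y}) \<inter> space M = {\<omega> \<in> space M. X \<omega> \<le> x \<and> Y \<omega> \<le> y}"
    "X -` {..x} \<inter> space M = {\<omega> \<in> space M. X \<omega> \<le> x}" "Y -` {..y} \<inter> space M = {\<omega> \<in> space M. Y \<omega> \<le> y}" by auto
  ultimately show "prob {\<omega> \<in> space M. X \<omega> \<le> x \<and> Y \<omega> \<le> y} = prob {\<omega> \<in> space M. X \<omega> \<le> x} * prob {\<omega> \<in> space M. Y \<omega> \<le> y}"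
    by simp
next
  assume prod: "\<forall>x y. prob {\<omega> \<in> space M. X \<omega> \<le> x \<and> Y \<omega> \<le> y} =
      prob {\<omega> \<in> space M. X \<omega> \<le> x} * prob {\<omega> \<in> space M. Y \<omega> \<le> y}"
  let ?G = "\<lambda>Z. {Z -` A \<inter> space M |A. A \<in> range (atMost :: real \<Rightarrow> _)}"
  have stable: "Int_stable (?G Z)" for Z
  proof (rule Int_stableI)
    fix a b assume "a \<in> ?G Z" "b \<in> ?G Z"
    then obtain s t where "a = Z -` {..s} \<inter> space M" "b = Z -` {..t} \<inter> space M" by blast
    then have "a \<inter> b = Z -` {..min s t} \<inter> space M" by auto
    then show "a \<inter> b \<in> ?G Z" by blast
  qed
  have gen: "sigma_sets (space M) {Z -` A \<inter> space M |A. A \<in> sets borel} = sigma_sets (space M) (?G Z)" for Z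
  proof -
    have "sets (borel :: real measure) = sigma_sets UNIV (range atMost)" unfolding borel_eq_atMost by simp
    then have "{Z -` A \<inter> space M |A. A \<in> sets borel} = sigma_sets (space M) (?G Z)"
      using sigma_sets_vimage_commute[of Z "space M" UNIV "range atMost"] by simp
    moreover have "?G Z \<subseteq> Pow (space M)" by auto
    ultimately show ?thesis by (simp add: sigma_sets_sigma_sets_eq)
  qed
  have "indep_set (?G X) (?G Y)"
  proof (rule indep_setI)
    show "?G X \<subseteq> events" "?G Y \<subseteq> events" by auto
    fix a b assume "a \<in> ?G X" "b \<in> ?G Y"
    then obtain s t where st: "a = X -` {..s} \<inter> space M" "b = Y -` {..t} \<inter> space M" by blast
    have "a = {\<omega> \<in> space M. X \<omega> \<le> s}" "b = {\<omega> \<in> space M. Y \<omega> \<le> t}"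
      "a \<inter> b = {\<omega> \<in> space M. X \<omega> \<le> s \<and> Y \<omega> \<le> t}" by (auto simp: st)
    then show "prob (a \<inter> b) = prob a * prob b" using prod by simp
  qed
  then have "indep_set (sigma_sets (space M) (?G X)) (sigma_sets (space M) (?G Y))"
    by (intro indep_set_sigma_sets stable)
  then show "indep_var borel X borel Y" unfolding indep_var_eq gen by simp
qed

lemma indep_var_iff_prod_copula:
  assumes X: "continuous_rv M X" and Y: "continuous_rv M Y"
  shows "indep_var borel X borel Y \<longleftrightarrow> rank_copula X Y = prod_copula"
proof -
  have prod: "prod_copula (cdf (distr M borel X) x, cdf (distr M borel Y) y) =
      prob {\<omega> \<in> space M. X \<omega> \<le> x} * prob {\<omega> \<in> space M. Y \<omega> \<le> y}" for x y
    using cdf_range[OF X, of x] cdf_range[OF Y, of y]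
    by (simp add: prod_copula_def cdf_eq_prob[OF X] cdf_eq_prob[OF Y])
  have "indep_var borel X borel Y \<longleftrightarrow>
      (\<forall>x y. joint_cdf M X Y x y = prod_copula (cdf (distr M borel X) x, cdf (distr M borel Y) y))"
    unfolding indep_var_iff_joint_cdf[OF continuous_rv_measurable[OF X] continuous_rv_measurable[OF Y]] prod joint_cdf_def ..
  also have "\<dots> \<longleftrightarrow> rank_copula X Y = prod_copula"
  proof
    assume "\<forall>x y. joint_cdf M X Y x y = prod_copula (cdf (distr M borel X) x, cdf (distr M borel Y) y)"
    then show "rank_copula X Y = prod_copula"
      by (intro copula_of_unique[OF X Y prod_copula_copula, symmetric]) simp
  qed (simp add: joint_cdf_eq_rank_copula[OF X Y])
  finally show ?thesis .
qed

lemma omega_star_injective_image: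
  assumes X: "continuous_rv M X" and Y: "continuous_rv M Y"
    and f: "f \<in> borel_measurable borel" "inj f" and g: "g \<in> borel_measurable borel" "inj g"
  shows "omega_star M (\<lambda>\<omega>. f (X \<omega>)) (\<lambda>\<omega>. g (Y \<omega>)) = omega_star M X Y"
proof -
  note Xm = continuous_rv_measurable[OF X] and Ym = continuous_rv_measurable[OF Y]
  note fX = continuous_rv_injective_image[OF X f] and gY = continuous_rv_injective_image[OF Y g]
  note det = determines_image[OF Xm f(1)] injective_image_determines[OF Xm f]
    determines_image[OF Ym g(1)] injective_image_determines[OF Ym g]
  show ?thesis
    using star_dist_determines_le[OF X fX Y gY det] star_dist_determines_le[OF fX X gY Y det(2,1,4,3)]
    by (simp add: omega_star_eq[OF X Y] omega_star_eq[OF fX gY])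
qed

lemma omega_star_commute:
  assumes X: "continuous_rv M X" and Y: "continuous_rv M Y"
  shows "omega_star M X Y = omega_star M Y X"
  using star_dist_flip[OF rank_copula_copula[OF X Y] prod_copula_copula]
  by (simp add: omega_star_eq X Y flip_rank_copula flip_prod_copula)

lemma omega_star_completely_dependent:
  assumes X: "continuous_rv M X" and Y: "continuous_rv M Y" and dep: "completely_dependent M Y X"
  shows "omega_star M X Y = 1"
proof -
  obtain h where "h \<in> borel_measurable borel" "AE \<omega> in M. Y \<omega> = h (X \<omega>)"
    using dep unfolding completely_dependent_def by blast
  then have "star_dist (rank_copula X Y) prod_copula = sqrt (1 / 3)"
    by (rule star_dist_completely_dependent[OF X Y])
  then show ?thesis by (simp add: omega_star_eq[OF X Y] real_sqrt_mult[symmetric])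
qed

lemma copula_of_copula: "continuous_rv M X \<Longrightarrow> continuous_rv M Y \<Longrightarrow> copula_of M X Y \<in> copulas"
  by (simp add: copula_of_eq rank_copula_copula)

end

theorem theorem6p1:
  fixes M :: "'a measure" and X Y :: "'a \<Rightarrow> real" and C :: "real \<times> real \<Rightarrow> real"
  assumes "prob_space M"
    and "continuous_rv M X" and "continuous_rv M Y"
    and "C = copula_of M X Y"
  shows "omega_star M X Y = omega_star M Y X \<and>
    (0 \<le> omega_star M X Y \<and> omega_star M X Y \<le> 1) \<and>
    (omega_star M X Y = 0 \<longleftrightarrow> prob_space.indep_var M borel X borel Y) \<and>
    (completely_dependent M Y X \<or> completely_dependent M X Y \<longrightarrow> omega_star M X Y = 1) \<and>
    (\<forall>(f :: real \<Rightarrow> real) (g :: real \<Rightarrow> real).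
       f \<in> borel_measurable borel \<longrightarrow> bij f \<longrightarrow> g \<in> borel_measurable borel \<longrightarrow> bij g \<longrightarrow>
       omega_star M (\<lambda>\<omega>. f (X \<omega>)) (\<lambda>\<omega>. g (Y \<omega>)) = omega_star M X Y) \<and>
    (\<forall>(N :: nat \<Rightarrow> 'b measure) Xs Ys Cs.
       (\<forall>n. prob_space (N n) \<and> continuous_rv (N n) (Xs n) \<and> continuous_rv (N n) (Ys n) \<and>
            Cs n = copula_of (N n) (Xs n) (Ys n)) \<longrightarrow>
       (\<lambda>n. star_norm (\<lambda>p. Cs n p - C p)) \<longlonglongrightarrow> 0 \<longrightarrow>
       (\<lambda>n. omega_star (N n) (Xs n) (Ys n)) \<longlonglongrightarrow> omega_star M X Y)"
proof -
  interpret prob_space M by fact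
  note X = assms(2) and Y = assms(3)
  have C: "C \<in> copulas" using copula_of_copula[OF X Y] assms(4) by simp
  have omega: "omega_star M X Y = sqrt 3 * star_dist C prod_copula"
    by (simp add: omega_star_def star_dist_def assms(4))
  have "0 \<le> omega_star M X Y"
    using star_dist_nonneg[OF C prod_copula_copula] by (simp add: omega)
  moreover have "omega_star M X Y \<le> 1"
  proof -
    have "omega_star M X Y \<le> sqrt 3 * sqrt (1 / 3)"
      unfolding omega by (intro mult_left_mono star_dist_prod_upper C) simp
    then show ?thesis by (simp add: real_sqrt_mult[symmetric])
  qed
  moreover have "omega_star M X Y = 0 \<longleftrightarrow> indep_var borel X borel Y"
    unfolding omega assms(4) copula_of_eq[OF X Y] indep_var_iff_prod_copula[OF X Y]
    by (simp add: star_dist_prod_eq_0_iff[OF rank_copula_copula[OF X Y]])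
  moreover have "omega_star M X Y = 1" if "completely_dependent M Y X \<or> completely_dependent M X Y"
    using that omega_star_completely_dependent[OF X Y] omega_star_completely_dependent[OF Y X]
      omega_star_commute[OF X Y] by auto
  moreover have "(\<lambda>n. omega_star (N n) (Xs n) (Ys n)) \<longlonglongrightarrow> omega_star M X Y"
    if N: "\<forall>n. prob_space (N n) \<and> continuous_rv (N n) (Xs n) \<and> continuous_rv (N n) (Ys n) \<and>
        Cs n = copula_of (N n) (Xs n) (Ys n)"
      and lim: "(\<lambda>n. star_norm (\<lambda>p. Cs n p - C p)) \<longlonglongrightarrow> 0"
    for N :: "nat \<Rightarrow> 'b measure" and Xs Ys Cs
  proof (rule LIM_zero_cancel, rule Lim_null_comparison)
    have Cs: "Cs n \<in> copulas" for n using N prob_space.copula_of_copula[of "N n" "Xs n" "Ys n"] by simp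
    have omega_n: "omega_star (N n) (Xs n) (Ys n) = sqrt 3 * star_dist (Cs n) prod_copula" for n
      using N by (simp add: omega_star_def star_dist_def)
    have "\<bar>star_dist (Cs n) prod_copula - star_dist C prod_copula\<bar> \<le> star_dist (Cs n) C" for n
      using star_dist_triangle[OF Cs[of n] C prod_copula_copula] star_dist_triangle[OF C Cs[of n] prod_copula_copula]
        star_dist_commute[OF C Cs[of n]] by linarith
    then have "sqrt 3 * \<bar>star_dist (Cs n) prod_copula - star_dist C prod_copula\<bar> \<le> sqrt 3 * star_dist (Cs n) C" for n
      by (intro mult_left_mono) auto
    then show "\<forall>\<^sub>F n in sequentially. norm (omega_star (N n) (Xs n) (Ys n) - omega_star M X Y) \<le> sqrt 3 * star_dist (Cs n) C"
      by (simp add: omega omega_n right_diff_distrib[symmetric] abs_mult)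
    have "(\<lambda>n. sqrt 3 * star_dist (Cs n) C) \<longlonglongrightarrow> sqrt 3 * 0"
      using lim unfolding star_dist_def by (rule tendsto_mult_left)
    then show "(\<lambda>n. sqrt 3 * star_dist (Cs n) C) \<longlonglongrightarrow> 0" by simp
  qed
  moreover have "omega_star M (\<lambda>\<omega>. f (X \<omega>)) (\<lambda>\<omega>. g (Y \<omega>)) = omega_star M X Y"
    if "f \<in> borel_measurable borel" "bij f" "g \<in> borel_measurable borel" "bij g" for f g
    by (rule omega_star_injective_image[OF X Y]) (use that bij_is_inj in auto)
  ultimately show ?thesis
    using omega_star_commute[OF X Y] by blast
qed

end
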